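(* Let $\sum_i h_i(u)^2\,du_i^2$ be a $\partial$-invariant flat Egoroff metric on $\Omega$, $\beta$ its rotation coefficient matrix, $E(u,\lambda)$ the frame for $\mathrm{i}\lambda\delta+[\delta,\beta]$, $c=h(0)$, and $X(u,\lambda)=-\mathrm{i}\lambda^{-1}(E(u,\lambda)E(u,0)^{-1}c-c)$ its associated family of flat Lagrangian immersions. Let $\tilde E=g_{\mathrm{i}\alpha,\pi}\,E\,g_{\mathrm{i}\alpha,\tilde\pi}^{-1}$, where $\alpha\in\mathbb{R}\setminus\{0\}$, $\pi$ is a Hermitian projection with $\bar\pi=\pi$, and $\tilde\pi(u)$ is the Hermitian projection onto $E(u,\mathrm{i}\alpha)^{-1}(\mathrm{Im}\,\pi)$. Let $\hat E=f_{z,\pi}\,E\,g_{z,\hat\pi}^{-1}g_{-\bar z,\hat\rho}^{-1}$, where $z\in\mathbb{C}\setminus(\mathbb{R}\cup\mathrm{i}\mathbb{R})$, $\pi$ is a Hermitian projection, $f_{z,\pi}=g_{-\bar z,\rho}g_{z,\pi}$ with $\rho$ the Hermitian projection onto $g_{z,\pi}(-\bar z)(\mathrm{Im}\,\bar\pi)$, $\hat\pi(u)$ is the Hermitian projection onto $E(u,z)^{-1}(\mathrm{Im}\,\pi)$, and $\hat\rho(u)$ is the Hermitian projection onto $E_1(u,-\bar z)^{-1}(\mathrm{Im}\,\rho)$ with $E_1=g_{z,\pi}Eg_{z,\hat\pi}^{-1}$. Let $\tilde c,\hat c\in\mathbb{R}^n$ be constant vectors. Then $$\tilde h(u)=\tilde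 E(u,0)^{-1}\tilde c,\qquad \tilde X=-\mathrm{i}\lambda^{-1}\big(\tilde E(u,\lambda)\tilde E(u,0)^{-1}\tilde c-\tilde c\big),$$ $$\hat h(u)=\hat E(u,0)^{-1}\hat c,\qquad \hat X=-\mathrm{i}\lambda^{-1}\big(\hat E(u,\lambda)\hat E(u,0)^{-1}\hat c-\hat c\big)$$ give new $\partial$-invariant flat Egoroff metrics $\sum_i\tilde h_i^2du_i^2$ and $\sum_i\hat h_i^2du_i^2$ (on any connected open set where all entries of $\tilde h$, respectively $\hat h$, are nonzero), and, for $\lambda\in\mathbb{R}\setminus\{0\}$, associated families $\tilde X(\cdot,\lambda)$, $\hat X(\cdot,\lambda)$ of flat Lagrangian immersions in $\mathbb{C}^n$ lying in hyperspheres, with these respective metrics as induced metrics.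
   Context: $\Omega\subset\mathbb{R}^n$ is a connected, simply connected open neighbourhood of $0$ with coordinates $u$. $\delta=\mathrm{diag}(du_1,\dots,du_n)$, $[\delta,\beta]=\delta\beta-\beta\delta$. A flat Egoroff metric is a flat Riemannian metric $\sum_i h_i^2\,du_i^2$, with $h_i$ smooth, real-valued and nowhere zero, for which there is a function $\phi$ with $\partial\phi/\partial u_i=h_i^2$ for all $i$; $h=(h_1,\dots,h_n)^t$. Its rotation coefficient matrix is $\beta_{ij}=(h_i)_{u_j}/h_j$ for $i\ne j$, $\beta_{ii}=0$ (symmetric). It is $\partial$-invariant if $\partial h_i=0$ for all $i$, $\partial=\sum_j\partial/\partial u_j$ (equivalently $\sum_ih_i^2$ is constant). The frame $E$ is the unique solution of $E^{-1}dE=\mathrm{i}\lambda\delta+[\delta,\beta]$, $E(0,\lambda)=\mathrm{I}$, $\lambda\in\mathbb{C}$. An immersion in $\mathbb{C}^n=\mathbb{R}^{2n}$ of an $n$-manifold is Lagrangian if $\omega(Z_1,Z_2)=\mathrm{Im}(\bar Z_1^tZ_2)$ pulls back to $0$, and flat if its induced metric is flat. A Hermitian projection is a matrix $\pi$ with $\pi^2=\pi=\pi^*$; $\pi^\perp=\mathrm{I}-\pi$; $\bar\pi$ is the entrywise conjugate. For $z\in\mathbb{C}\setminus\mathbb{R}$, $g_{z,\pi}(\lambda)=\pi+\frac{\lambda-\bar z}{\lambda-z}\pi^\perp$. *)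

theory Defs
  imports "HOL-Analysis.Analysis"
begin

section \<open>Smooth maps on open subsets of coordinate space\<close>

definition partial :: "'n \<Rightarrow> (real^'n \<Rightarrow> 'b::real_normed_vector) \<Rightarrow> real^'n \<Rightarrow> 'b::real_normed_vector"
  where "partial j f u = frechet_derivative f (at u) (axis j 1)"

text \<open>The following two notions are meant for open sets only.\<close>

primrec Ck_on :: "nat \<Rightarrow> (real^'n) set \<Rightarrow> (real^'n \<Rightarrow> 'b::real_normed_vector) \<Rightarrow> bool" where
  "Ck_on 0 S f \<longleftrightarrow> continuous_on S f"
| "Ck_on (Suc k) S f \<longleftrightarrow> (\<forall>u\<in>S. f differentiable (at u)) \<and> (\<forall>j. Ck_on k S (partial j f))"

definition smooth_on :: "(real^'n) set \<Rightarrow> (real^'n \<Rightarrow> 'b::real_normed_vector) \<Rightarrow> bool"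
  where "smooth_on S f \<longleftrightarrow> (\<forall>k. Ck_on k S f)"


section \<open>Flat metrics in coordinates\<close>

text \<open>A metric is given by its coefficient matrix \<open>g\<^sub>i\<^sub>j(u)\<close>.  \<open>christoffel g k i j\<close> is
  \<open>\<Gamma>\<^sup>k\<^sub>i\<^sub>j\<close> of the Levi-Civita connection, and \<open>riemann_curvature g l k i j\<close> is the
  \<open>\<partial>\<^sub>l\<close>-component of \<open>R(\<partial>\<^sub>i, \<partial>\<^sub>j) \<partial>\<^sub>k\<close>.\<close>

definition riemannian_metric_on :: "(real^'n) set \<Rightarrow> (real^'n \<Rightarrow> real^'n^'n) \<Rightarrow> bool"
  where "riemannian_metric_on S g \<longleftrightarrow> smooth_on S g \<and>
    (\<forall>u\<in>S. transpose (g u) = g u \<and> (\<forall>v. v \<noteq> 0 \<longrightarrow> v \<bullet> (g u *v v) > 0))"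

definition christoffel :: "(real^'n \<Rightarrow> real^'n^'n) \<Rightarrow> 'n \<Rightarrow> 'n \<Rightarrow> 'n \<Rightarrow> real^'n \<Rightarrow> real"
  where "christoffel g k i j u = 1/2 * (\<Sum>l\<in>UNIV. matrix_inv (g u) $ k $ l *
    (partial i (\<lambda>v. g v $ j $ l) u + partial j (\<lambda>v. g v $ i $ l) u - partial l (\<lambda>v. g v $ i $ j) u))"

definition riemann_curvature ::
    "(real^'n \<Rightarrow> real^'n^'n) \<Rightarrow> 'n \<Rightarrow> 'n \<Rightarrow> 'n \<Rightarrow> 'n \<Rightarrow> real^'n \<Rightarrow> real"
  where "riemann_curvature g l k i j u =
    partial i (christoffel g l j k) u - partial j (christoffel g l i k) u
    + (\<Sum>m\<in>UNIV. christoffel g l i m u * christoffel g m j k u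
                - christoffel g l j m u * christoffel g m i k u)"

definition flat_metric_on :: "(real^'n) set \<Rightarrow> (real^'n \<Rightarrow> real^'n^'n) \<Rightarrow> bool"
  where "flat_metric_on S g \<longleftrightarrow> riemannian_metric_on S g \<and>
    (\<forall>u\<in>S. \<forall>l k i j. riemann_curvature g l k i j u = 0)"


section \<open>Egoroff metrics\<close>

definition diag_metric :: "(real^'n \<Rightarrow> real^'n) \<Rightarrow> real^'n \<Rightarrow> real^'n^'n"
  where "diag_metric h u = (\<chi> i j. if i = j then (h u $ i)\<^sup>2 else 0)"

definition flat_egoroff_metric_on :: "(real^'n) set \<Rightarrow> (real^'n \<Rightarrow> real^'n) \<Rightarrow> bool"
  where "flat_egoroff_metric_on S h \<longleftrightarrow>
    smooth_on S h \<and> (\<forall>u\<in>S. \<forall>i. h u $ i \<noteq> 0) \<and> flat_metric_on S (diag_metric h) \<and>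
    (\<exists>\<phi>::real^'n \<Rightarrow> real. \<forall>u\<in>S. \<phi> differentiable (at u) \<and> (\<forall>i. partial i \<phi> u = (h u $ i)\<^sup>2))"

definition rotation_coeffs :: "(real^'n \<Rightarrow> real^'n) \<Rightarrow> real^'n \<Rightarrow> real^'n^'n"
  where "rotation_coeffs h u =
    (\<chi> i j. if i = j then 0 else partial j (\<lambda>v. h v $ i) u / h u $ j)"

definition d_invariant_on :: "(real^'n) set \<Rightarrow> (real^'n \<Rightarrow> real^'n) \<Rightarrow> bool"
  where "d_invariant_on S h \<longleftrightarrow> (\<forall>u\<in>S. \<forall>i. (\<Sum>j\<in>UNIV. partial j (\<lambda>v. h v $ i) u) = 0)"


section \<open>Frames and associated families\<close>

definition complex_vec :: "real^'n \<Rightarrow> complex^'n"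
  where "complex_vec c = (\<chi> i. complex_of_real (c $ i))"

text \<open>\<open>diag_unit j\<close> is the coefficient of \<open>du\<^sub>j\<close> in \<open>\<delta> = diag(du\<^sub>1, \<dots>, du\<^sub>n)\<close>, and
  \<open>connection_coeff B \<mu> j\<close> that of \<open>du\<^sub>j\<close> in \<open>i \<mu> \<delta> + [\<delta>, B]\<close>.  Here and below,
  \<open>mat a ** A\<close> is the scalar multiple of the matrix \<open>A\<close> by \<open>a\<close>, and the spectral
  parameter is written \<open>\<mu>\<close>.\<close>

definition diag_unit :: "'n \<Rightarrow> complex^'n^'n"
  where "diag_unit j = (\<chi> a b. if a = j \<and> b = j then 1 else 0)"

definition connection_coeff :: "real^'n^'n \<Rightarrow> complex \<Rightarrow> 'n \<Rightarrow> complex^'n^'n"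
  where "connection_coeff B \<mu> j = mat (\<i> * \<mu>) ** diag_unit j
    + (diag_unit j ** map_matrix complex_of_real B - map_matrix complex_of_real B ** diag_unit j)"

definition frame_equation_on ::
    "(real^'n) set \<Rightarrow> (real^'n \<Rightarrow> real^'n^'n) \<Rightarrow> complex \<Rightarrow> (real^'n \<Rightarrow> complex \<Rightarrow> complex^'n^'n) \<Rightarrow> bool"
  where "frame_equation_on S \<beta> \<mu> E \<longleftrightarrow>
    (\<forall>u\<in>S. invertible (E u \<mu>) \<and> (\<lambda>v. E v \<mu>) differentiable (at u) \<and>
      (\<forall>j. matrix_inv (E u \<mu>) ** partial j (\<lambda>v. E v \<mu>) u = connection_coeff (\<beta> u) \<mu> j))"

definition is_frame ::
    "(real^'n) set \<Rightarrow> (real^'n \<Rightarrow> real^'n^'n) \<Rightarrow> (real^'n \<Rightarrow> complex \<Rightarrow> complex^'n^'n) \<Rightarrow> bool"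
  where "is_frame S \<beta> E \<longleftrightarrow> (\<forall>\<mu>. frame_equation_on S \<beta> \<mu> E \<and> E 0 \<mu> = mat 1)"

definition associated_family ::
    "(real^'n \<Rightarrow> complex \<Rightarrow> complex^'n^'n) \<Rightarrow> real^'n \<Rightarrow> real^'n \<Rightarrow> complex \<Rightarrow> complex^'n"
  where "associated_family E c u \<mu> =
    (- \<i> * inverse \<mu>) *s (E u \<mu> *v (matrix_inv (E u 0) *v complex_vec c) - complex_vec c)"


section \<open>Flat Lagrangian immersions in complex space\<close>

definition immersion_on :: "(real^'n) set \<Rightarrow> (real^'n \<Rightarrow> complex^'n) \<Rightarrow> bool"
  where "immersion_on S X \<longleftrightarrow> smooth_on S X \<and> (\<forall>u\<in>S. inj (frechet_derivative X (at u)))"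

definition symplectic_form :: "complex^'n \<Rightarrow> complex^'n \<Rightarrow> real"
  where "symplectic_form Z W = Im (\<Sum>i\<in>UNIV. cnj (Z $ i) * W $ i)"

text \<open>The library's inner product \<open>\<bullet>\<close> on \<open>complex^'n\<close> is the Euclidean one of
  \<open>\<real>\<^sup>2\<^sup>n\<close>, that is, the real part of the Hermitian product.\<close>

definition induced_metric :: "(real^'n \<Rightarrow> complex^'n) \<Rightarrow> real^'n \<Rightarrow> real^'n^'n"
  where "induced_metric X u = (\<chi> i j. partial i X u \<bullet> partial j X u)"

definition flat_lagrangian_immersion_on :: "(real^'n) set \<Rightarrow> (real^'n \<Rightarrow> complex^'n) \<Rightarrow> bool"
  where "flat_lagrangian_immersion_on S X \<longleftrightarrow> immersion_on S X \<and>
    (\<forall>u\<in>S. \<forall>v w. symplectic_form (frechet_derivative X (at u) v) (frechet_derivative X (at u) w) = 0) \<and>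
    flat_metric_on S (induced_metric X)"


section \<open>Hermitian projections and simple factors\<close>

definition hermitian_projection :: "complex^'n^'n \<Rightarrow> bool"
  where "hermitian_projection P \<longleftrightarrow> P ** P = P \<and> transpose (map_matrix cnj P) = P"

definition image_of :: "complex^'n^'n \<Rightarrow> (complex^'n) set"
  where "image_of P = range ((*v) P)"

definition hermitian_projection_onto :: "complex^'n^'n \<Rightarrow> (complex^'n) set \<Rightarrow> bool"
  where "hermitian_projection_onto P V \<longleftrightarrow> hermitian_projection P \<and> image_of P = V"

text \<open>\<open>simple_factor z P\<close> is \<open>g\<^sub>z\<^sub>,\<^sub>P\<close>; it is meant for \<open>z\<close> off the real line.  At its pole
  \<open>\<mu> = z\<close> the division yields the meaningless value \<open>P\<close>.\<close>

definition simple_factor :: "complex \<Rightarrow> complex^'n^'n \<Rightarrow> complex \<Rightarrow> complex^'n^'n"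
  where "simple_factor z P \<mu> = P + mat ((\<mu> - cnj z) / (\<mu> - z)) ** (mat 1 - P)"

end

theory Submission
  imports Defs
begin

text \<open>
  The connection form \<open>\<theta>(\<mu>) = i \<mu> \<delta> + [\<delta>, b]\<close> with a Hermitian matrix \<open>b\<close> satisfies \<open>\<theta>(\<mu>)\<^sup>* = - \<theta>(cnj \<mu>)\<close>.
  Uniqueness of solutions therefore gives \<open>E(\<mu>)\<^sup>-\<^sup>1 = E(cnj \<mu>)\<^sup>*\<close> for the frame.  The Hermitian
  projection \<open>P\<close> onto \<open>E(z)\<^sup>-\<^sup>1 (Im \<pi>)\<close> obeys an equation in which the frame no longer occurs,
  \<open>dP = P \<theta>(cnj z) (1 - P) - (1 - P) \<theta>(z) P\<close>.  With this equation, a polynomial identity in \<open>P\<close>, \<open>\<delta>\<close>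
  and \<open>b\<close> shows that \<open>g\<^sub>z\<^sub>,\<^sub>\<pi> E g\<^sub>z\<^sub>,\<^sub>P\<^sup>-\<^sup>1\<close> is a frame for the Hermitian matrix \<open>b + i (z - cnj z) P\<close>
  (\<open>dressing_identity\<close>, \<open>hermitian_frame_dressing\<close>).  This applies to one simple factor, and
  again to the second one of a pair.

  The off-diagonal entries of the new matrix are real and symmetric as soon as the new frame is real at
  parameter zero, because there the connection form is \<open>[\<delta>, b]\<close>.  For an imaginary pole and
  real \<open>\<pi>\<close>, conjugation fixes every ingredient.  For a pair of poles \<open>z\<close>, \<open>- cnj z\<close>, the choice of \<open>\<rho>\<close>
  makes the product \<open>G(\<mu>)\<close> of the two constant simple factors satisfy \<open>G(\<mu>) G(- \<mu>)\<^sup>T = 1\<close>, since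
  all residues vanish; so \<open>G(0)\<close> is both orthogonal and unitary, hence real (\<open>two_factor_real_at_0\<close>).
  The projections at a point \<open>u\<close> are in the same relative position as \<open>\<pi>\<close> and \<open>\<rho>\<close>, so the product
  of their simple factors at zero is real, too.

  A frame \<open>F\<close> that is unitary at real parameters and real at zero carries the whole geometry (the locale
  \<open>real_unitary_frame\<close>).  For \<open>h = F(0)\<^sup>-\<^sup>1 c\<close> one has \<open>dh = - [\<delta>, b] h\<close>, which gives the rotation
  coefficients and \<open>\<partial> h = 0\<close>.  The logarithmic derivative of \<open>F(0) diag(h)\<close> is the Levi-Civita connection of
  \<open>\<Sum> h\<^sub>i\<^sup>2 du\<^sub>i\<^sup>2\<close>, which is therefore flat.  The form \<open>\<Sum> h\<^sub>i\<^sup>2 du\<^sub>i\<close> equals \<open>c\<^sup>* F(0) \<delta> F(0)\<^sup>-\<^sup>1 c\<close>, and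
  \<open>F(0) \<delta> F(0)\<^sup>-\<^sup>1\<close> is exact: it is the limit, for real \<open>\<mu>\<close> tending to zero, of the differentials of
  \<open>(F(\<mu>) F(0)\<^sup>-\<^sup>1 - 1) / (i \<mu>)\<close> (\<open>frame_form_exact\<close>).  Finally \<open>dX = F(\<mu>) \<delta> h\<close> for the associated
  family; since \<open>F(\<mu>)\<close> is unitary, \<open>X\<close> induces the metric, is Lagrangian, and has constant distance from
  the point \<open>i c / \<mu>\<close>.
\<close>

section \<open>Complex matrices with adjoints\<close>

definition cscale :: "complex \<Rightarrow> complex^'n^'n \<Rightarrow> complex^'n^'n" (infixr "*\<^sub>m" 75)
  where "a *\<^sub>m A = mat a ** A"

definition adj :: "complex^'n^'n \<Rightarrow> complex^'n^'n"
  where "adj A = transpose (map_matrix cnj A)"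

abbreviation (input) conj_mat :: "complex^'n^'n \<Rightarrow> complex^'n^'n"
  where "conj_mat \<equiv> map_matrix cnj"

lemma cscale_nth [simp]: "(a *\<^sub>m A) $ i $ j = a * A $ i $ j"
proof -
  have "(a *\<^sub>m A) $ i $ j = (\<Sum>k\<in>UNIV. if i = k then a * A $ k $ j else 0)"
    unfolding cscale_def matrix_matrix_mult_def mat_def by (auto intro!: sum.cong simp del: sum.delta sum.delta')
  then show ?thesis by simp
qed

lemma adj_nth [simp]: "adj A $ i $ j = cnj (A $ j $ i)"
  by (simp add: adj_def transpose_def)

lemma matrix_add_rdistrib':
  fixes A B C :: "complex^'n^'n" shows "(A + B) ** C = A ** C + B ** C"
  by (simp add: vec_eq_iff matrix_matrix_mult_def sum.distrib distrib_right)

lemma matrix_diff_rdistrib: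
  fixes A B C :: "complex^'n^'n" shows "(A - B) ** C = A ** C - B ** C"
  by (simp add: vec_eq_iff matrix_matrix_mult_def sum_subtractf left_diff_distrib)

lemma matrix_diff_ldistrib:
  fixes A B C :: "complex^'n^'n" shows "A ** (B - C) = A ** B - A ** C"
  by (simp add: vec_eq_iff matrix_matrix_mult_def sum_subtractf right_diff_distrib)

lemma matrix_minus_left: fixes A B :: "complex^'n^'n" shows "(- A) ** B = - (A ** B)"
  by (simp add: vec_eq_iff matrix_matrix_mult_def sum_negf)

lemma matrix_minus_right: fixes A B :: "complex^'n^'n" shows "A ** (- B) = - (A ** B)"
  by (simp add: vec_eq_iff matrix_matrix_mult_def sum_negf)

lemma matrix_zero_left: fixes A :: "complex^'n^'n" shows "0 ** A = 0"
  by (simp add: vec_eq_iff matrix_matrix_mult_def)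

lemma matrix_zero_right: fixes A :: "complex^'n^'n" shows "A ** 0 = 0"
  by (simp add: vec_eq_iff matrix_matrix_mult_def)

lemma cscale_mult_left: "(a *\<^sub>m A) ** B = a *\<^sub>m (A ** B)"
  by (simp add: cscale_def matrix_mul_assoc)

lemma cscale_mult_right: "A ** (a *\<^sub>m B) = a *\<^sub>m (A ** B)"
  by (simp add: vec_eq_iff, simp add: matrix_matrix_mult_def sum_distrib_left mult.left_commute)

lemma cscale_cscale: "a *\<^sub>m b *\<^sub>m A = (a * b) *\<^sub>m A"
  by (simp add: vec_eq_iff)

lemma cscale_1 [simp]: "1 *\<^sub>m A = A"
  and cscale_0 [simp]: "0 *\<^sub>m A = 0"
  and cscale_zero [simp]: "a *\<^sub>m 0 = 0"
  and cscale_minus_left: "(- a) *\<^sub>m A = - (a *\<^sub>m A)"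
  and cscale_minus_right: "a *\<^sub>m (- A) = - (a *\<^sub>m A)"
  and cscale_add_left: "(a + b) *\<^sub>m A = a *\<^sub>m A + b *\<^sub>m A"
  and cscale_diff_left: "(a - b) *\<^sub>m A = a *\<^sub>m A - b *\<^sub>m A"
  and cscale_add_right: "a *\<^sub>m (A + B) = a *\<^sub>m A + a *\<^sub>m B"
  and cscale_diff_right: "a *\<^sub>m (A - B) = a *\<^sub>m A - a *\<^sub>m B"
  by (simp_all add: vec_eq_iff algebra_simps)

lemmas matrix_expand =
  matrix_mul_assoc[symmetric] matrix_add_ldistrib matrix_add_rdistrib'
  matrix_diff_ldistrib matrix_diff_rdistrib matrix_minus_left matrix_minus_right
  cscale_mult_left cscale_mult_right cscale_cscale cscale_minus_left cscale_minus_right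
  cscale_add_right cscale_diff_right matrix_zero_left matrix_zero_right

lemma adj_mult: "adj (A ** B) = adj B ** adj A"
  by (simp add: vec_eq_iff matrix_matrix_mult_def mult.commute)

lemma adj_adj [simp]: "adj (adj A) = A"
  and adj_add: "adj (A + B) = adj A + adj B"
  and adj_diff: "adj (A - B) = adj A - adj B"
  and adj_minus: "adj (- A) = - adj A"
  and adj_cscale: "adj (a *\<^sub>m A) = cnj a *\<^sub>m adj A"
  and adj_zero [simp]: "adj 0 = 0"
  by (simp_all add: vec_eq_iff)

lemma adj_one [simp]: "adj (mat 1) = mat 1"
  by (auto simp add: vec_eq_iff mat_def)

lemma conj_mult: "conj_mat (A ** B) = conj_mat A ** conj_mat B"
  by (simp add: vec_eq_iff matrix_matrix_mult_def)

lemma conj_conj [simp]: "conj_mat (conj_mat A) = A"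
  and conj_add: "conj_mat (A + B) = conj_mat A + conj_mat B"
  and conj_diff: "conj_mat (A - B) = conj_mat A - conj_mat B"
  and conj_cscale: "conj_mat (a *\<^sub>m A) = cnj a *\<^sub>m conj_mat A"
  and conj_adj: "conj_mat (adj A) = adj (conj_mat A)"
  by (simp_all add: vec_eq_iff)

lemma conj_one [simp]: "conj_mat (mat 1) = (mat 1 :: complex^'n^'n)"
  by (auto simp add: vec_eq_iff mat_def)

lemma bounded_bilinear_matrix_mult: "bounded_bilinear ((**) :: complex^'n^'n \<Rightarrow> complex^'n^'n \<Rightarrow> _)"
  by (subst bilinear_conv_bounded_bilinear [symmetric])
    (auto simp: bilinear_def vec_eq_iff matrix_matrix_mult_def sum.distrib distrib_left distrib_right
       scaleR_sum_right intro!: linearI)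

lemma bounded_linear_adj: "bounded_linear (adj :: complex^'n^'n \<Rightarrow> _)"
  by (auto simp: linear_conv_bounded_linear [symmetric] vec_eq_iff intro!: linearI)

lemma bounded_linear_conj: "bounded_linear (conj_mat :: complex^'n^'n \<Rightarrow> _)"
  by (auto simp: linear_conv_bounded_linear [symmetric] vec_eq_iff intro!: linearI)

lemma bounded_linear_cscale: "bounded_linear (cscale a)"
  by (auto simp: linear_conv_bounded_linear [symmetric] vec_eq_iff algebra_simps intro!: linearI)

lemma bounded_bilinear_matrix_vector: "bounded_bilinear ((*v) :: complex^'n^'n \<Rightarrow> complex^'n \<Rightarrow> _)"
  by (subst bilinear_conv_bounded_bilinear [symmetric])
    (auto simp: bilinear_def vec_eq_iff matrix_vector_mult_def sum.distrib distrib_left distrib_right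
       scaleR_sum_right intro!: linearI)

lemma matrix_inv_eqI:
  fixes A B :: "complex^'n^'n"
  assumes "A ** B = mat 1"
  shows "matrix_inv A = B" "invertible A"
proof -
  have BA: "B ** A = mat 1" using assms matrix_left_right_inverse by blast
  show "invertible A" unfolding invertible_def using assms BA by blast
  then have "matrix_inv A ** A = mat 1"
    unfolding matrix_inv_def invertible_def by (rule someI2_ex) simp
  then have "matrix_inv A ** (A ** B) = B" by (simp add: matrix_mul_assoc)
  with assms show "matrix_inv A = B" by simp
qed


section \<open>Hermitian projections\<close>

lemma hermitian_projection_iff: "hermitian_projection P \<longleftrightarrow> P ** P = P \<and> adj P = P"
  by (simp add: hermitian_projection_def adj_def)

lemma hermitian_projection_idem: "hermitian_projection P \<Longrightarrow> P ** P = P"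
  and hermitian_projection_adj: "hermitian_projection P \<Longrightarrow> adj P = P"
  by (simp_all add: hermitian_projection_iff)

lemma idem_left_absorb: fixes P :: "complex^'n^'n" shows "P ** P = P \<Longrightarrow> P ** (P ** X) = P ** X"
  by (simp add: matrix_mul_assoc)

lemma hermitian_projection_conj:
  assumes "hermitian_projection P" shows "hermitian_projection (conj_mat P)"
  using assms by (metis conj_adj conj_mult hermitian_projection_iff)

lemma image_of_mult: "image_of (A ** B) = (*v) A ` image_of B"
  by (auto simp: image_of_def image_image matrix_vector_mul_assoc)

lemma image_of_subset_iff:
  fixes P A :: "complex^'n^'n"
  assumes "P ** P = P"
  shows "image_of A \<subseteq> image_of P \<longleftrightarrow> P ** A = A"
proof
  assume "image_of A \<subseteq> image_of P"
  then have "\<exists>y. A *v x = P *v y" for x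
    by (auto simp: image_of_def)
  then have "P *v (A *v x) = A *v x" for x
    using assms by (metis matrix_vector_mul_assoc)
  then show "P ** A = A"
    by (metis (no_types) matrix_eq matrix_vector_mul_assoc)
next
  assume "P ** A = A"
  then show "image_of A \<subseteq> image_of P"
    by (metis image_of_def image_of_mult image_mono subset_UNIV)
qed

text \<open>Two Hermitian projections with the same image absorb each other from the left.  The adjoint of
  one absorption reverses its order, so both are equal to the same product.\<close>

lemma hermitian_projection_unique:
  fixes P Q :: "complex^'n^'n"
  assumes "hermitian_projection P" "hermitian_projection Q" "image_of P = image_of Q"
  shows "P = Q"
proof -
  have "Q ** P = P" "P ** Q = Q"
    using assms image_of_subset_iff hermitian_projection_idem by blast+
  then show ?thesis
    using assms adj_mult[of Q P] by (simp add: hermitian_projection_iff)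
qed

text \<open>The oblique projection \<open>A \<pi> B\<close> along \<open>A\<close> has the same image as \<open>P\<close>; unlike \<open>P\<close> it
  depends on \<open>A\<close> in an explicit way.\<close>

lemma hermitian_projection_onto_absorb:
  fixes P \<pi> A B :: "complex^'n^'n"
  assumes "hermitian_projection_onto P ((*v) A ` image_of \<pi>)" "B ** A = mat 1" "\<pi> ** \<pi> = \<pi>"
  shows "P ** (A ** \<pi> ** B) = A ** \<pi> ** B" "(A ** \<pi> ** B) ** P = P" "P ** (A ** \<pi>) = A ** \<pi>"
proof -
  have PP: "P ** P = P" and im: "image_of P = image_of (A ** \<pi>)"
    using assms(1) by (auto simp: hermitian_projection_onto_def hermitian_projection_iff image_of_mult)
  show *: "P ** (A ** \<pi>) = A ** \<pi>" using im PP image_of_subset_iff by blast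
  then show "P ** (A ** \<pi> ** B) = A ** \<pi> ** B" by (simp add: matrix_mul_assoc)
  have idem: "(A ** \<pi> ** B) ** (A ** \<pi> ** B) = A ** \<pi> ** B"
    by (metis assms(2,3) matrix_mul_assoc matrix_mul_rid)
  have "image_of (A ** \<pi>) \<subseteq> image_of (A ** \<pi> ** B)"
    unfolding image_of_subset_iff[OF idem]
    by (metis assms(2,3) matrix_mul_assoc matrix_mul_rid)
  then show "(A ** \<pi> ** B) ** P = P"
    using im idem image_of_subset_iff by metis
qed

text \<open>Comparing diagonal entries in \<open>P = P P\<^sup>*\<close>, each row has squared norm \<open>P\<^sub>i\<^sub>i\<close>, so
  \<open>P\<^sub>i\<^sub>i\<^sup>2 \<le> P\<^sub>i\<^sub>i\<close>.  Boundedness is what makes a family of projections continuous below.\<close>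

lemma hermitian_projection_entry_bound:
  assumes "hermitian_projection P"
  shows "cmod (P $ i $ j) \<le> 1"
proof -
  have adjP: "P $ k $ i = cnj (P $ i $ k)" for k
    using arg_cong[OF hermitian_projection_adj[OF assms], of "\<lambda>A. A $ k $ i"] by simp
  have "P $ i $ i = (\<Sum>k\<in>UNIV. P $ i $ k * P $ k $ i)"
    using arg_cong[OF hermitian_projection_idem[OF assms], of "\<lambda>A. A $ i $ i"]
    by (simp add: matrix_matrix_mult_def)
  also have "\<dots> = of_real (\<Sum>k\<in>UNIV. (cmod (P $ i $ k))\<^sup>2)"
    by (simp add: adjP complex_norm_square del: of_real_power)
  finally have eq: "P $ i $ i = of_real (\<Sum>k\<in>UNIV. (cmod (P $ i $ k))\<^sup>2)" .
  have le: "(cmod (P $ i $ k))\<^sup>2 \<le> cmod (P $ i $ i)" for k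
  proof -
    have "(cmod (P $ i $ k))\<^sup>2 \<le> (\<Sum>k\<in>UNIV. (cmod (P $ i $ k))\<^sup>2)"
      by (rule member_le_sum) auto
    also have "\<dots> = cmod (P $ i $ i)"
      by (subst eq) (simp add: sum_nonneg del: of_real_sum of_real_power)
    finally show ?thesis .
  qed
  have "cmod (P $ i $ i) \<le> 1"
  proof (rule ccontr)
    assume "\<not> cmod (P $ i $ i) \<le> 1"
    then have "1 * cmod (P $ i $ i) < cmod (P $ i $ i) * cmod (P $ i $ i)"
      by (intro mult_strict_right_mono) auto
    with le[of i] show False by (simp add: power2_eq_square)
  qed
  with le[of j] have "(cmod (P $ i $ j))\<^sup>2 \<le> 1\<^sup>2" by simp
  then show ?thesis using power2_le_imp_le zero_le_one by blast
qed

lemma hermitian_projections_bounded: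
  "bounded {P :: complex^'n^'n. hermitian_projection P}"
proof (rule boundedI)
  fix P :: "complex^'n^'n" assume "P \<in> {P. hermitian_projection P}"
  then have P: "hermitian_projection P" by simp
  have "norm (P $ i) \<le> real CARD('n)" for i
  proof -
    have "norm (P $ i) \<le> (\<Sum>j\<in>UNIV. norm (P $ i $ j))"
      unfolding norm_vec_def by (rule L2_set_le_sum) auto
    also have "\<dots> \<le> (\<Sum>j\<in>(UNIV::'n set). 1)"
      by (rule sum_mono) (rule hermitian_projection_entry_bound[OF P])
    finally show ?thesis by simp
  qed
  then have "(\<Sum>i\<in>UNIV. norm (P $ i)) \<le> (\<Sum>i\<in>(UNIV::'n set). real CARD('n))"
    by (intro sum_mono)
  moreover have "norm P \<le> (\<Sum>i\<in>UNIV. norm (P $ i))"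
    unfolding norm_vec_def by (rule L2_set_le_sum) auto
  ultimately show "norm P \<le> real CARD('n) * real CARD('n)" by simp
qed

text \<open>This writes the difference of two orthogonal projections through the difference of arbitrary
  idempotents with the same images, and linearly in the latter.  So the orthogonal projection is as
  regular as any oblique one, and its derivative can be read off; no matrix has to be inverted.\<close>

lemma hermitian_projection_diff:
  fixes P Q M N :: "complex^'n^'n"
  assumes "hermitian_projection P" "hermitian_projection Q"
    "P ** M = M" "M ** P = P" "Q ** N = N" "N ** Q = Q"
  shows "P - Q = adj ((mat 1 - Q) ** ((M - N) ** P)) + (mat 1 - P) ** ((M - N) ** Q)"
proof -
  have "(mat 1 - Q) ** ((M - N) ** P) = P - Q ** P"
    using assms by (simp add: matrix_expand) (simp add: matrix_mul_assoc)
  then have "adj ((mat 1 - Q) ** ((M - N) ** P)) = P - P ** Q"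
    using assms(1,2) by (simp add: adj_diff adj_mult hermitian_projection_adj)
  moreover have "(mat 1 - P) ** ((M - N) ** Q) = P ** Q - Q"
    using assms by (simp add: matrix_expand) (simp add: matrix_mul_assoc)
  ultimately show ?thesis by simp
qed

section \<open>The frame equation\<close>

definition diag_form :: "real^'n \<Rightarrow> complex^'n^'n"
  where "diag_form v = (\<chi> i j. if i = j then complex_of_real (v $ i) else 0)"

definition conn_form :: "complex^'n^'n \<Rightarrow> complex \<Rightarrow> real^'n \<Rightarrow> complex^'n^'n"
  where "conn_form b \<mu> v = (\<i> * \<mu>) *\<^sub>m diag_form v + (diag_form v ** b - b ** diag_form v)"

definition solves_frame_on ::
    "(real^'n) set \<Rightarrow> (real^'n \<Rightarrow> complex^'n^'n) \<Rightarrow> complex \<Rightarrow> (real^'n \<Rightarrow> complex^'n^'n) \<Rightarrow> bool"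
  where "solves_frame_on S b \<mu> F \<longleftrightarrow>
    (\<forall>u\<in>S. (F has_derivative (\<lambda>v. F u ** conn_form (b u) \<mu> v)) (at u))"

lemma diag_form_nth [simp]: "diag_form v $ i $ j = (if i = j then complex_of_real (v $ i) else 0)"
  by (simp add: diag_form_def)

lemma adj_diag_form [simp]: "adj (diag_form v) = diag_form v"
  and conj_diag_form [simp]: "conj_mat (diag_form v) = diag_form v"
  by (simp_all add: vec_eq_iff)

lemma diag_form_mult_nth: "(diag_form v ** b) $ i $ j = complex_of_real (v $ i) * b $ i $ j"
  and mult_diag_form_nth: "(b ** diag_form v) $ i $ j = b $ i $ j * complex_of_real (v $ j)"
proof -
  have "(diag_form v ** b) $ i $ j = (\<Sum>k\<in>UNIV. if i = k then complex_of_real (v $ i) * b $ k $ j else 0)"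
    unfolding matrix_matrix_mult_def diag_form_def by (auto intro!: sum.cong simp del: sum.delta sum.delta')
  then show "(diag_form v ** b) $ i $ j = complex_of_real (v $ i) * b $ i $ j" by simp
  have "(b ** diag_form v) $ i $ j = (\<Sum>k\<in>UNIV. if k = j then b $ i $ k * complex_of_real (v $ j) else 0)"
    unfolding matrix_matrix_mult_def diag_form_def by (auto intro!: sum.cong simp del: sum.delta sum.delta')
  then show "(b ** diag_form v) $ i $ j = b $ i $ j * complex_of_real (v $ j)" by simp
qed

lemma conn_form_nth: "conn_form b \<mu> v $ i $ j =
    (if i = j then \<i> * \<mu> * complex_of_real (v $ i) else (complex_of_real (v $ i) - complex_of_real (v $ j)) * b $ i $ j)"
  by (simp add: conn_form_def diag_form_mult_nth mult_diag_form_nth algebra_simps)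

lemma linear_conn_form: "linear (conn_form b \<mu>)"
  by (rule linearI) (auto simp: vec_eq_iff conn_form_nth algebra_simps scaleR_conv_of_real[where 'a=complex])

lemma adj_conn_form: "adj (conn_form b \<mu> v) = - conn_form (adj b) (cnj \<mu>) v"
  by (auto simp: vec_eq_iff conn_form_nth algebra_simps)

lemma conj_conn_form: "conj_mat (conn_form b \<mu> v) = conn_form (conj_mat b) (- cnj \<mu>) v"
  by (auto simp: vec_eq_iff conn_form_nth algebra_simps)

lemma connection_coeff_eq_conn_form:
  fixes B :: "real^'n^'n"
  shows "connection_coeff B \<mu> j = conn_form (map_matrix complex_of_real B) \<mu> (axis j 1)"
proof -
  have "diag_unit j = (diag_form (axis j 1) :: complex^'n^'n)"
    by (auto simp: vec_eq_iff diag_unit_def axis_def)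
  then show ?thesis by (simp add: connection_coeff_def conn_form_def cscale_def)
qed

lemma solves_frame_onD:
  "solves_frame_on S b \<mu> F \<Longrightarrow> u \<in> S \<Longrightarrow> (F has_derivative (\<lambda>v. F u ** conn_form (b u) \<mu> v)) (at u)"
  by (simp add: solves_frame_on_def)

lemma solves_frame_on_subset:
  "solves_frame_on S b \<mu> F \<Longrightarrow> U \<subseteq> S \<Longrightarrow> solves_frame_on U b \<mu> F"
  by (auto simp: solves_frame_on_def)

lemma solves_frame_on_cong:
  assumes "solves_frame_on S b \<mu> F" "open S" "\<And>u. u \<in> S \<Longrightarrow> G u = F u"
  shows "solves_frame_on S b \<mu> G"
  unfolding solves_frame_on_def
proof
  fix u assume "u \<in> S"
  then show "(G has_derivative (\<lambda>v. G u ** conn_form (b u) \<mu> v)) (at u)"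
    using has_derivative_transform_within_open[OF solves_frame_onD[OF assms(1)] assms(2), of u G] assms(3)
    by simp
qed

text \<open>A derivative is determined by its values on the coordinate directions, so the frame equation in
  coordinates amounts to the invariant one.\<close>

lemma has_derivative_sum_partial:
  fixes f :: "real^'n \<Rightarrow> 'b::real_normed_vector"
  assumes "f differentiable (at u)" "linear D" "\<And>j. partial j f u = D (axis j 1)"
  shows "(f has_derivative D) (at u)"
proof -
  let ?D = "frechet_derivative f (at u)"
  have f: "(f has_derivative ?D) (at u)" using assms(1) frechet_derivative_works by blast
  have "?D v = D v" for v
  proof -
    have v: "v = (\<Sum>j\<in>UNIV. v $ j *\<^sub>R axis j 1)"
      using basis_expansion[of v] by (simp add: scalar_mult_eq_scaleR)
    have sum: "L (\<Sum>j\<in>UNIV. v $ j *\<^sub>R axis j 1) = (\<Sum>j\<in>UNIV. v $ j *\<^sub>R L (axis j 1))"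
      if "linear L" for L :: "real^'n \<Rightarrow> 'b"
      using that by (simp add: linear_sum linear_scale)
    have lin: "L v = (\<Sum>j\<in>UNIV. v $ j *\<^sub>R L (axis j 1))" if "linear L" for L :: "real^'n \<Rightarrow> 'b"
      using sum[OF that] by (simp only: v[symmetric])
    show ?thesis
      using assms(3) lin[OF has_derivative_linear[OF f]] lin[OF assms(2)] by (simp add: partial_def)
  qed
  then have "?D = D" by auto
  with f show ?thesis by simp
qed

lemma partial_eqI: "(f has_derivative D) (at u) \<Longrightarrow> partial j f u = D (axis j 1)"
  using frechet_derivative_at[of f D] by (simp add: partial_def)

lemma linear_mult_conn_form:
  fixes A b :: "complex^'n^'n" shows "linear (\<lambda>v. A ** conn_form b \<mu> v)"
  using linear_conn_form[of b \<mu>]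
  using bounded_bilinear.scaleR_right[OF bounded_bilinear_matrix_mult, of A]
  by (auto simp: linear_iff matrix_add_ldistrib)

lemma frame_equation_imp_solves:
  assumes "frame_equation_on S B \<mu> E"
  shows "solves_frame_on S (\<lambda>u. map_matrix complex_of_real (B u)) \<mu> (\<lambda>u. E u \<mu>)"
  unfolding solves_frame_on_def
proof
  fix u assume u: "u \<in> S"
  have inv: "invertible (E u \<mu>)" and diff: "(\<lambda>v. E v \<mu>) differentiable (at u)"
    and eq: "\<And>j. matrix_inv (E u \<mu>) ** partial j (\<lambda>v. E v \<mu>) u = connection_coeff (B u) \<mu> j"
    using assms u by (auto simp: frame_equation_on_def)
  have "E u \<mu> ** matrix_inv (E u \<mu>) = mat 1"
    using inv unfolding invertible_def matrix_inv_def by (rule someI2_ex) simp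
  then have "partial j (\<lambda>v. E v \<mu>) u = E u \<mu> ** connection_coeff (B u) \<mu> j" for j
    using eq[of j] by (metis matrix_mul_assoc matrix_mul_lid)
  then show "((\<lambda>v. E v \<mu>) has_derivative
      (\<lambda>v. E u \<mu> ** conn_form (map_matrix complex_of_real (B u)) \<mu> v)) (at u)"
    by (intro has_derivative_sum_partial diff linear_mult_conn_form) (simp add: connection_coeff_eq_conn_form)
qed

lemma solves_imp_frame_equation:
  assumes "solves_frame_on S b \<mu> (\<lambda>u. E u \<mu>)"
    and "\<And>u. u \<in> S \<Longrightarrow> C u ** E u \<mu> = mat 1"
    and "\<And>u i j. u \<in> S \<Longrightarrow> i \<noteq> j \<Longrightarrow> b u $ i $ j = complex_of_real (B u $ i $ j)"
  shows "frame_equation_on S B \<mu> E"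
  unfolding frame_equation_on_def
proof (intro ballI conjI allI)
  fix u assume u: "u \<in> S"
  have C: "E u \<mu> ** C u = mat 1" using assms(2)[OF u] matrix_left_right_inverse by blast
  show "invertible (E u \<mu>)" using matrix_inv_eqI(2)[OF C] .
  show "(\<lambda>v. E v \<mu>) differentiable (at u)"
    using solves_frame_onD[OF assms(1) u] by (auto simp: differentiable_def)
  fix j
  have "connection_coeff (B u) \<mu> j = conn_form (b u) \<mu> (axis j 1)"
    using assms(3)[OF u] by (auto simp: connection_coeff_eq_conn_form vec_eq_iff conn_form_nth)
  then show "matrix_inv (E u \<mu>) ** partial j (\<lambda>v. E v \<mu>) u = connection_coeff (B u) \<mu> j"
    using assms(2)[OF u] partial_eqI[OF solves_frame_onD[OF assms(1) u]]
    by (simp add: matrix_inv_eqI(1)[OF C] matrix_mul_assoc)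
qed

lemmas has_derivative_matrix_mult = bounded_bilinear.FDERIV[OF bounded_bilinear_matrix_mult]
lemmas has_derivative_adj = bounded_linear.has_derivative[OF bounded_linear_adj]
lemmas has_derivative_conj = bounded_linear.has_derivative[OF bounded_linear_conj]
lemmas has_derivative_cscale = bounded_linear.has_derivative[OF bounded_linear_cscale]

text \<open>For Hermitian \<open>b\<close> the connection form at \<open>\<mu>\<close> is minus the adjoint of the one at
  the conjugate parameter, so a solution at \<open>\<mu>\<close> times the adjoint of one at the conjugate
  parameter is constant.  This expresses inverses of frames through frames.\<close>

lemma frame_mult_adj_constant:
  assumes S: "open S" "connected S" "x0 \<in> S"
    and F: "solves_frame_on S b \<mu> F" and G: "solves_frame_on S b (cnj \<mu>) G"
    and b: "\<And>u. u \<in> S \<Longrightarrow> adj (b u) = b u" and u: "u \<in> S"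
  shows "F u ** adj (G u) = F x0 ** adj (G x0)"
proof (rule has_derivative_zero_unique_connected[OF S(1,2) _ u S(3)])
  fix x assume x: "x \<in> S"
  have "((\<lambda>u. F u ** adj (G u)) has_derivative
      (\<lambda>v. F x ** adj (G x ** conn_form (b x) (cnj \<mu>) v) + (F x ** conn_form (b x) \<mu> v) ** adj (G x))) (at x)"
    by (intro has_derivative_matrix_mult has_derivative_adj solves_frame_onD[OF F x] solves_frame_onD[OF G x])
  then show "((\<lambda>u. F u ** adj (G u)) has_derivative (\<lambda>v. 0)) (at x)"
    by (simp add: adj_mult adj_conn_form b[OF x] matrix_expand)
qed

text \<open>Two solutions with equal initial values have the same constant product with the adjoint solution,
  which inverts both.\<close>

lemma frame_unique:
  assumes S: "open S" "connected S" "x0 \<in> S"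
    and F: "solves_frame_on S b \<mu> F" and H: "solves_frame_on S b \<mu> H"
    and G: "solves_frame_on S b (cnj \<mu>) G"
    and b: "\<And>u. u \<in> S \<Longrightarrow> adj (b u) = b u" and u: "u \<in> S"
    and x0: "F x0 = mat 1" "H x0 = mat 1" "G x0 = mat 1"
  shows "F u = H u"
proof -
  have "F u ** adj (G u) = mat 1" "H u ** adj (G u) = mat 1"
    using frame_mult_adj_constant[OF S _ G b u] F H x0 by auto
  then show ?thesis
    by (metis matrix_left_right_inverse matrix_mul_assoc matrix_mul_lid matrix_mul_rid)
qed


section \<open>Dressing by a simple factor\<close>

lemma simple_factor_eq: "simple_factor z P \<mu> = P + ((\<mu> - cnj z) / (\<mu> - z)) *\<^sub>m (mat 1 - P)"
  by (simp add: simple_factor_def cscale_def)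

lemma simple_factor_inverse:
  assumes "P ** P = P" "\<mu> \<noteq> z" "\<mu> \<noteq> cnj z"
  shows "simple_factor z P \<mu> ** simple_factor (cnj z) P \<mu> = mat 1"
    and "simple_factor (cnj z) P \<mu> ** simple_factor z P \<mu> = mat 1"
proof -
  define s where "s = (\<mu> - cnj z) / (\<mu> - z)"
  define t where "t = (\<mu> - z) / (\<mu> - cnj z)"
  have st: "s * t = 1" "t * s = 1" using assms(2,3) by (simp_all add: s_def t_def)
  have *: "(P + a *\<^sub>m (mat 1 - P)) ** (P + b *\<^sub>m (mat 1 - P)) = mat 1" if "a * b = 1" for a b
    using that assms(1) by (simp add: matrix_expand idem_left_absorb mult.commute[of b])
  show "simple_factor z P \<mu> ** simple_factor (cnj z) P \<mu> = mat 1"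
    using *[OF st(1)] by (simp add: simple_factor_eq s_def t_def)
  show "simple_factor (cnj z) P \<mu> ** simple_factor z P \<mu> = mat 1"
    using *[OF st(2)] by (simp add: simple_factor_eq s_def t_def)
qed

lemma matrix_inv_simple_factor:
  assumes "hermitian_projection P" "\<mu> \<noteq> z" "\<mu> \<noteq> cnj z"
  shows "matrix_inv (simple_factor z P \<mu>) = simple_factor (cnj z) P \<mu>"
  using assms simple_factor_inverse(1) matrix_inv_eqI(1) hermitian_projection_idem by blast

lemma adj_simple_factor:
  assumes "hermitian_projection P"
  shows "adj (simple_factor z P \<mu>) = simple_factor (cnj z) P (cnj \<mu>)"
  using assms by (simp add: simple_factor_eq adj_add adj_cscale adj_diff hermitian_projection_adj)

lemma conj_simple_factor:
  "conj_mat (simple_factor z P \<mu>) = simple_factor (- cnj z) (conj_mat P) (- cnj \<mu>)"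
proof -
  have "(cnj \<mu> - z) / (cnj \<mu> - cnj z) = (z - cnj \<mu>) / (cnj z - cnj \<mu>)"
    by (metis minus_diff_eq minus_divide_divide)
  then show ?thesis by (simp add: simple_factor_eq conj_add conj_cscale conj_diff)
qed

text \<open>At a point where one factor vanishes, continuity of the other factor suffices for the product rule.\<close>

lemma has_derivative_bilinear_vanishing:
  assumes p: "bounded_bilinear p" and f: "isCont f x"
    and g: "(g has_derivative g') (at x)" and gx: "g x = 0"
  shows "((\<lambda>y. p (f y) (g y)) has_derivative (\<lambda>h. p (f x) (g' h))) (at x)"
proof -
  interpret p: bounded_bilinear p by (rule p)
  interpret g': bounded_linear g' using g by (rule has_derivative_bounded_linear)
  have r: "Zfun (\<lambda>y. (g y - g' (y - x)) /\<^sub>R norm (y - x)) (at x)"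
    using g gx unfolding has_derivative_at_within by (simp add: tendsto_Zfun_iff)
  have fZ: "Zfun (\<lambda>y. f y - f x) (at x)"
    using f unfolding isCont_def by (simp add: tendsto_Zfun_iff)
  have "\<forall>\<^sub>F y in at x. dist (f y) (f x) < 1"
    using f unfolding isCont_def by (rule tendstoD) simp
  then have fB: "Bfun f (at x)"
    by (intro BfunI[of _ "norm (f x) + 1"])
       (auto elim!: eventually_mono simp: dist_norm intro: order_trans[OF norm_triangle_sub[of _ "f x"]])
  obtain K where K: "\<And>h. norm (g' h) \<le> norm h * K" using g'.bounded by blast
  have gB: "Bfun (\<lambda>y. g' (y - x) /\<^sub>R norm (y - x)) (at x)"
  proof (rule BfunI)
    show "\<forall>\<^sub>F y in at x. norm (g' (y - x) /\<^sub>R norm (y - x)) \<le> K"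
      unfolding eventually_at_filter
      by (rule always_eventually) (use K in \<open>auto simp: divide_simps mult.commute\<close>)
  qed
  have "Zfun (\<lambda>y. p (f y) ((g y - g' (y - x)) /\<^sub>R norm (y - x))
      + p (f y - f x) (g' (y - x) /\<^sub>R norm (y - x))) (at x)"
    by (intro Zfun_add p.Bfun_prod_Zfun[OF fB r] p.Zfun_prod_Bfun[OF fZ gB])
  moreover have "(\<lambda>y. p (f y) ((g y - g' (y - x)) /\<^sub>R norm (y - x))
      + p (f y - f x) (g' (y - x) /\<^sub>R norm (y - x)))
      = (\<lambda>y. (p (f y) (g y) - p (f x) (g x) - p (f x) (g' (y - x))) /\<^sub>R norm (y - x))"
    by (auto simp: fun_eq_iff gx p.zero_right p.scaleR_right p.diff_right p.diff_left scaleR_right_diff_distrib)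
  ultimately show ?thesis
    unfolding has_derivative_at_within tendsto_Zfun_iff
    using bounded_linear_compose[OF p.bounded_linear_right g'.bounded_linear_axioms]
    by (simp add: o_def)
qed

text \<open>The oblique projection \<open>M = F\<^sup>-\<^sup>1 \<pi> F\<close> satisfies \<open>dM = [M, \<theta>]\<close> with the connection form \<open>\<theta>\<close> at \<open>z\<close>.
  The formula for the difference of two projections gives first the continuity of \<open>P\<close>, as
  projections are bounded, and then the derivative: \<open>(1 - P) dM P = - (1 - P) \<theta> P\<close> plus its adjoint.
  The result is an equation for \<open>P\<close> alone, without \<open>F\<close> and \<open>\<pi>\<close>.\<close>

lemma has_derivative_hermitian_projection_onto:
  fixes P :: "real^'n \<Rightarrow> complex^'n^'n"
  assumes S: "open S" and u: "u \<in> S"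
    and F: "solves_frame_on S b z F" and G: "solves_frame_on S b (cnj z) G"
    and inv: "\<And>x. x \<in> S \<Longrightarrow> F x ** adj (G x) = mat 1"
    and b: "\<And>x. x \<in> S \<Longrightarrow> adj (b x) = b x"
    and \<pi>: "hermitian_projection \<pi>"
    and P: "\<And>x. x \<in> S \<Longrightarrow> hermitian_projection_onto (P x) ((*v) (adj (G x)) ` image_of \<pi>)"
  shows "(P has_derivative (\<lambda>v. P u ** conn_form (b u) (cnj z) v ** (mat 1 - P u)
      - (mat 1 - P u) ** conn_form (b u) z v ** P u)) (at u)"
proof -
  define M where "M x = adj (G x) ** \<pi> ** F x" for x
  define Q where "Q = P u"
  have herm: "hermitian_projection (P x)" if "x \<in> S" for x
    using P[OF that] by (simp add: hermitian_projection_onto_def)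
  have abs: "P x ** M x = M x" "M x ** P x = P x" if "x \<in> S" for x
    using hermitian_projection_onto_absorb[OF P[OF that] inv[OF that] hermitian_projection_idem[OF \<pi>]]
    by (auto simp: M_def)
  have diff: "P x = Q + (adj ((mat 1 - Q) ** ((M x - M u) ** P x)) + (mat 1 - P x) ** ((M x - M u) ** Q))"
    if "x \<in> S" for x
    using hermitian_projection_diff[OF herm[OF that] herm[OF u] abs[OF that] abs[OF u]]
    unfolding Q_def by (simp add: algebra_simps)
  have dM: "(M has_derivative (\<lambda>v. M u ** conn_form (b u) z v - conn_form (b u) z v ** M u)) (at u)"
  proof -
    have "(M has_derivative (\<lambda>v. (adj (G u) ** \<pi>) ** (F u ** conn_form (b u) z v) +
        (adj (G u) ** 0 + adj (G u ** conn_form (b u) (cnj z) v) ** \<pi>) ** F u)) (at u)"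
      unfolding M_def
      by (intro has_derivative_matrix_mult has_derivative_adj has_derivative_const
           solves_frame_onD[OF F u] solves_frame_onD[OF G u])
    then show ?thesis
      by (simp add: adj_mult adj_conn_form b[OF u] matrix_expand M_def)
  qed
  have evS: "\<forall>\<^sub>F x in at u. x \<in> S"
    using S u by (rule eventually_at_in_open')
  have cont: "isCont P u"
  proof -
    obtain C where C: "\<And>A::complex^'n^'n. hermitian_projection A \<Longrightarrow> norm A \<le> C"
      using hermitian_projections_bounded by (auto simp: bounded_iff)
    have PB: "Bfun P (at u)"
    proof (rule BfunI)
      show "\<forall>\<^sub>F x in at u. norm (P x) \<le> C"
        using evS by eventually_elim (rule C[OF herm])
    qed
    have PB': "Bfun (\<lambda>x. mat 1 - P x) (at u)"
    proof (rule BfunI)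
      show "\<forall>\<^sub>F x in at u. norm (mat 1 - P x) \<le> norm (mat 1 :: complex^'n^'n) + C"
        using evS
      proof eventually_elim
        case (elim x)
        show ?case
          using norm_triangle_ineq4[of "mat 1" "P x"] C[OF herm[OF elim]] by linarith
      qed
    qed
    have MZ: "Zfun (\<lambda>x. M x - M u) (at u)"
      using has_derivative_continuous[OF dM] by (simp add: continuous_at tendsto_Zfun_iff)
    note mm = bounded_bilinear_matrix_mult
    have "Zfun (\<lambda>x. adj ((mat 1 - Q) ** ((M x - M u) ** P x)) + (mat 1 - P x) ** ((M x - M u) ** Q)) (at u)"
      by (intro Zfun_add bounded_linear.Zfun[OF bounded_linear_adj]
           bounded_bilinear.Bfun_prod_Zfun[OF mm PB'] bounded_bilinear.Zfun_prod_Bfun[OF mm MZ PB]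
           bounded_linear.Zfun[OF bounded_bilinear.bounded_linear_right[OF mm]]
           bounded_linear.Zfun[OF bounded_bilinear.bounded_linear_left[OF mm]] MZ)
    then have "((\<lambda>x. Q + (adj ((mat 1 - Q) ** ((M x - M u) ** P x)) + (mat 1 - P x) ** ((M x - M u) ** Q)))
       \<longlongrightarrow> Q) (at u)"
      by (simp add: tendsto_Zfun_iff)
    then have "(P \<longlongrightarrow> Q) (at u)"
      by (rule Lim_transform_eventually) (use evS diff in \<open>auto elim!: eventually_mono\<close>)
    then show ?thesis by (simp add: isCont_def Q_def)
  qed
  have dM0: "((\<lambda>x. M x - M u) has_derivative (\<lambda>v. M u ** conn_form (b u) z v - conn_form (b u) z v ** M u)) (at u)"
    using has_derivative_diff[OF dM has_derivative_const[of "M u"]] by simp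
  have dM0Q: "((\<lambda>x. (M x - M u) ** Q) has_derivative (\<lambda>v. (M u ** conn_form (b u) z v - conn_form (b u) z v ** M u) ** Q)) (at u)"
    by (rule bounded_linear.has_derivative[OF bounded_bilinear.bounded_linear_left[OF bounded_bilinear_matrix_mult] dM0])
  note flip = bounded_bilinear.flip[OF bounded_bilinear_matrix_mult]
  have d1: "((\<lambda>x. (M x - M u) ** P x) has_derivative (\<lambda>v. (M u ** conn_form (b u) z v - conn_form (b u) z v ** M u) ** Q)) (at u)"
    using has_derivative_bilinear_vanishing[OF flip cont dM0] by (simp add: Q_def)
  have d1': "((\<lambda>x. adj ((mat 1 - Q) ** ((M x - M u) ** P x))) has_derivative
      (\<lambda>v. adj ((mat 1 - Q) ** ((M u ** conn_form (b u) z v - conn_form (b u) z v ** M u) ** Q)))) (at u)"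
    by (intro has_derivative_adj
        bounded_linear.has_derivative[OF bounded_bilinear.bounded_linear_right[OF bounded_bilinear_matrix_mult]] d1)
  have d2: "((\<lambda>x. (mat 1 - P x) ** ((M x - M u) ** Q)) has_derivative
      (\<lambda>v. (mat 1 - P u) ** ((M u ** conn_form (b u) z v - conn_form (b u) z v ** M u) ** Q))) (at u)"
    by (rule has_derivative_bilinear_vanishing[OF bounded_bilinear_matrix_mult _ dM0Q])
       (auto intro!: continuous_intros cont simp: matrix_zero_left)
  have "((\<lambda>x. Q + (adj ((mat 1 - Q) ** ((M x - M u) ** P x)) + (mat 1 - P x) ** ((M x - M u) ** Q)))
     has_derivative (\<lambda>v. 0 + (adj ((mat 1 - Q) ** ((M u ** conn_form (b u) z v - conn_form (b u) z v ** M u) ** Q))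
       + (mat 1 - P u) ** ((M u ** conn_form (b u) z v - conn_form (b u) z v ** M u) ** Q)))) (at u)"
    by (intro has_derivative_add has_derivative_const d1' d2)
  then have dP: "(P has_derivative (\<lambda>v. 0 + (adj ((mat 1 - Q) ** ((M u ** conn_form (b u) z v - conn_form (b u) z v ** M u) ** Q))
       + (mat 1 - P u) ** ((M u ** conn_form (b u) z v - conn_form (b u) z v ** M u) ** Q)))) (at u)"
    by (rule has_derivative_transform_within_open[OF _ S u]) (simp add: diff[symmetric])
  have QM: "Q ** M u = M u" "M u ** Q = Q" using abs[OF u] by (simp_all add: Q_def)
  have QM': "Q ** (M u ** X) = M u ** X" for X using QM(1) by (metis matrix_mul_assoc)
  have key: "(mat 1 - Q) ** ((M u ** A - A ** M u) ** Q) = - ((mat 1 - Q) ** A ** Q)" for A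
    by (simp add: matrix_expand QM QM')
  have adjQ: "adj Q = Q" using herm[OF u] by (simp add: Q_def hermitian_projection_adj)
  have "0 + (adj ((mat 1 - Q) ** ((M u ** conn_form (b u) z v - conn_form (b u) z v ** M u) ** Q))
       + (mat 1 - P u) ** ((M u ** conn_form (b u) z v - conn_form (b u) z v ** M u) ** Q))
      = P u ** conn_form (b u) (cnj z) v ** (mat 1 - P u) - (mat 1 - P u) ** conn_form (b u) z v ** P u" for v
    unfolding Q_def[symmetric] key
    by (simp add: adj_minus adj_mult adj_diff adjQ adj_conn_form b[OF u] matrix_minus_left matrix_minus_right matrix_mul_assoc)
  with dP show ?thesis by simp
qed

text \<open>The inverse simple factor \<open>T = P + t (1 - P)\<close> has the derivative \<open>(1 - t) dP\<close>, which is the last summand.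
  So with the old and the new connection form \<open>\<theta>\<close> and \<open>\<theta>'\<close> this is the gauge equation
  \<open>T \<theta>' = \<theta> T + dT\<close>.  The terms in \<open>b\<close> agree for every \<open>t\<close>; the terms in \<open>\<delta>\<close> agree because
  \<open>t (\<mu> - cnj z) = \<mu> - z\<close>.\<close>

lemma dressing_identity:
  fixes P b :: "complex^'n^'n"
  assumes P: "P ** P = P" and mu: "\<mu> \<noteq> cnj z" and t: "t = (\<mu> - z) / (\<mu> - cnj z)"
  shows "(P + t *\<^sub>m (mat 1 - P)) ** conn_form (b + (\<i> * (z - cnj z)) *\<^sub>m P) \<mu> v
    = conn_form b \<mu> v ** (P + t *\<^sub>m (mat 1 - P))
      + (1 - t) *\<^sub>m (P ** conn_form b (cnj z) v ** (mat 1 - P) - (mat 1 - P) ** conn_form b z v ** P)"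
proof -
  define w where "w = cnj z"
  define D where "D = (diag_form v :: complex^'n^'n)"
  define k where "k = \<i> * (z - w)"
  have tw: "t * (\<mu> - w) = \<mu> - z" using mu by (simp add: t w_def)
  have e1: "\<i> * \<mu> * (1 - t) - k = \<i> * (1 - t) * w"
    using tw unfolding k_def by (simp add: algebra_simps) (metis add.commute distrib_left)
  have e2: "k * t = \<i> * \<mu> * (1 - t) - \<i> * (1 - t) * z"
    using tw unfolding k_def by (simp add: algebra_simps) (metis add.commute distrib_left)
  have "(P + t *\<^sub>m (mat 1 - P)) ** (k *\<^sub>m (D ** P - P ** D) + (\<i> * \<mu>) *\<^sub>m D)
     = (\<i> * \<mu> * t) *\<^sub>m D + (\<i> * \<mu> * (1 - t) - k) *\<^sub>m (P ** D) + (k * t) *\<^sub>m (D ** P)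
       + (k * (1 - t)) *\<^sub>m (P ** (D ** P))"
    by (simp add: matrix_expand P idem_left_absorb[OF P] cscale_add_left cscale_diff_left algebra_simps)
  also have "\<dots> = (\<i> * \<mu> * t) *\<^sub>m D + (\<i> * (1 - t) * w) *\<^sub>m (P ** D)
      + (\<i> * \<mu> * (1 - t) - \<i> * (1 - t) * z) *\<^sub>m (D ** P) + (k * (1 - t)) *\<^sub>m (P ** (D ** P))"
    by (simp only: e1 e2)
  also have "\<dots> = ((\<i> * \<mu>) *\<^sub>m D) ** (P + t *\<^sub>m (mat 1 - P)) + (1 - t) *\<^sub>m
     (P ** ((\<i> * w) *\<^sub>m D) ** (mat 1 - P) - (mat 1 - P) ** ((\<i> * z) *\<^sub>m D) ** P)"
    by (simp add: matrix_expand P idem_left_absorb[OF P] cscale_add_left cscale_diff_left k_def algebra_simps)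
  finally have D_part: "(P + t *\<^sub>m (mat 1 - P)) ** (k *\<^sub>m (D ** P - P ** D) + (\<i> * \<mu>) *\<^sub>m D) = \<dots>" .
  have B_part: "(P + t *\<^sub>m (mat 1 - P)) ** B = B ** (P + t *\<^sub>m (mat 1 - P))
     + (1 - t) *\<^sub>m (P ** B ** (mat 1 - P) - (mat 1 - P) ** B ** P)" for B
    by (simp add: matrix_expand cscale_add_left cscale_diff_left algebra_simps)
  have c1: "conn_form (b + (\<i> * (z - cnj z)) *\<^sub>m P) \<mu> v
      = (k *\<^sub>m (D ** P - P ** D) + (\<i> * \<mu>) *\<^sub>m D) + (D ** b - b ** D)"
    by (simp add: conn_form_def D_def k_def w_def matrix_expand algebra_simps)
  have c2: "conn_form b \<nu> v = (\<i> * \<nu>) *\<^sub>m D + (D ** b - b ** D)" for \<nu>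
    by (simp add: conn_form_def D_def)
  show ?thesis
    unfolding c1 matrix_add_ldistrib D_part[unfolded matrix_add_ldistrib] B_part[of "D ** b - b ** D"]
    unfolding c2 w_def[symmetric]
    by (simp add: matrix_add_ldistrib matrix_add_rdistrib' cscale_add_right cscale_diff_right)
qed

text \<open>The factor \<open>A\<close> stands for the constant simple factor on the left, which does not affect the
  connection form.\<close>

lemma dressed_frame_solves:
  fixes P :: "real^'n \<Rightarrow> complex^'n^'n"
  assumes S: "open S"
    and F: "solves_frame_on S b z F" and G: "solves_frame_on S b (cnj z) G"
    and inv: "\<And>x. x \<in> S \<Longrightarrow> F x ** adj (G x) = mat 1"
    and b: "\<And>x. x \<in> S \<Longrightarrow> adj (b x) = b x"
    and \<pi>: "hermitian_projection \<pi>"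
    and P: "\<And>x. x \<in> S \<Longrightarrow> hermitian_projection_onto (P x) ((*v) (adj (G x)) ` image_of \<pi>)"
    and H: "solves_frame_on S b \<mu> H" and mu: "\<mu> \<noteq> z" "\<mu> \<noteq> cnj z"
  shows "solves_frame_on S (\<lambda>u. b u + (\<i> * (z - cnj z)) *\<^sub>m P u) \<mu>
    (\<lambda>u. A ** H u ** simple_factor (cnj z) (P u) \<mu>)"
  unfolding solves_frame_on_def
proof
  fix u assume u: "u \<in> S"
  define t where "t = (\<mu> - z) / (\<mu> - cnj z)"
  define dP where "dP v = P u ** conn_form (b u) (cnj z) v ** (mat 1 - P u)
      - (mat 1 - P u) ** conn_form (b u) z v ** P u" for v
  have PP: "P u ** P u = P u"
    using P[OF u] by (simp add: hermitian_projection_onto_def hermitian_projection_idem)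
  have dP: "(P has_derivative dP) (at u)"
    unfolding dP_def by (rule has_derivative_hermitian_projection_onto[OF S u F G inv b \<pi> P])
  have sf: "simple_factor (cnj z) (P u) \<mu> = P u + t *\<^sub>m (mat 1 - P u)" for u
    by (simp add: simple_factor_eq t_def)
  have "((\<lambda>u. P u + t *\<^sub>m (mat 1 - P u)) has_derivative (\<lambda>v. dP v + t *\<^sub>m (0 - dP v))) (at u)"
    by (intro has_derivative_add has_derivative_cscale has_derivative_diff has_derivative_const dP)
  then have "((\<lambda>u. A ** H u ** (P u + t *\<^sub>m (mat 1 - P u))) has_derivative
      (\<lambda>v. A ** H u ** (dP v + t *\<^sub>m (0 - dP v)) + (A ** (H u ** conn_form (b u) \<mu> v) + 0 ** H u) ** (P u + t *\<^sub>m (mat 1 - P u)))) (at u)"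
    by (intro has_derivative_matrix_mult has_derivative_const solves_frame_onD[OF H u])
  moreover have "A ** H u ** (dP v + t *\<^sub>m (0 - dP v)) + (A ** (H u ** conn_form (b u) \<mu> v) + 0 ** H u) ** (P u + t *\<^sub>m (mat 1 - P u))
     = A ** H u ** (conn_form (b u) \<mu> v ** (P u + t *\<^sub>m (mat 1 - P u)) + (1 - t) *\<^sub>m dP v)" for v
  proof -
    have "dP v + t *\<^sub>m (0 - dP v) = (1 - t) *\<^sub>m dP v"
      by (simp add: cscale_diff_left cscale_minus_right)
    then show ?thesis
      by (simp add: matrix_zero_left matrix_add_ldistrib matrix_mul_assoc add.commute)
  qed
  ultimately show "((\<lambda>u. A ** H u ** simple_factor (cnj z) (P u) \<mu>) has_derivative
      (\<lambda>v. A ** H u ** simple_factor (cnj z) (P u) \<mu> ** conn_form (b u + (\<i> * (z - cnj z)) *\<^sub>m P u) \<mu> v)) (at u)"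
    unfolding sf dP_def
    by (simp add: matrix_mul_assoc[symmetric] dressing_identity[OF PP mu(2) t_def])
qed

section \<open>Calculus of smooth maps\<close>

lemma differentiable_transform_open:
  assumes "open S" "u \<in> S" "\<And>x. x \<in> S \<Longrightarrow> f x = g x" "f differentiable (at u)"
  shows "g differentiable (at u)"
  using assms has_derivative_transform_within_open unfolding differentiable_def by metis

lemma partial_cong:
  assumes "open S" "u \<in> S" "\<And>x. x \<in> S \<Longrightarrow> f x = g x"
  shows "partial j f u = partial j g u"
proof -
  have "(f has_derivative D) (at u) \<longleftrightarrow> (g has_derivative D) (at u)" for D
    using assms has_derivative_transform_within_open[of f D u UNIV S g]
      has_derivative_transform_within_open[of g D u UNIV S f] by auto
  then show ?thesis by (simp add: partial_def frechet_derivative_def)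
qed

lemma Ck_on_cong:
  assumes "open S" "\<And>x. x \<in> S \<Longrightarrow> f x = g x" "Ck_on k S f"
  shows "Ck_on k S g"
  using assms(2,3)
proof (induction k arbitrary: f g)
  case 0
  then show ?case using continuous_on_eq[of S f g] by simp
next
  case (Suc k)
  have "Ck_on k S (partial j g)" for j
  proof (rule Suc.IH)
    show "partial j f x = partial j g x" if "x \<in> S" for x
      by (rule partial_cong[OF assms(1) that Suc.prems(1)])
    show "Ck_on k S (partial j f)" using Suc.prems(2) by simp
  qed
  moreover have "g differentiable (at u)" if "u \<in> S" for u
    using differentiable_transform_open[OF assms(1) that Suc.prems(1)] Suc.prems(2) that by auto
  ultimately show ?case by auto
qed

lemma Ck_on_Suc_imp: "Ck_on (Suc k) S f \<Longrightarrow> Ck_on k S f"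
proof (induction k arbitrary: f)
  case 0
  then show ?case
    by (simp add: continuous_at_imp_continuous_on differentiable_imp_continuous_within)
next
  case (Suc k)
  then show ?case by (metis Ck_on.simps(2))
qed

lemma Ck_on_subset: "Ck_on k S f \<Longrightarrow> U \<subseteq> S \<Longrightarrow> Ck_on k U f"
  by (induction k arbitrary: f) (auto intro: continuous_on_subset)

lemma Ck_on_SucI:
  assumes "open S" "\<And>u. u \<in> S \<Longrightarrow> (f has_derivative D u) (at u)"
    "\<And>j. Ck_on k S (\<lambda>u. D u (axis j 1))"
  shows "Ck_on (Suc k) S f"
proof -
  have "Ck_on k S (partial j f)" for j
    by (rule Ck_on_cong[OF assms(1) _ assms(3)[of j]]) (simp add: partial_eqI[OF assms(2)])
  with assms(2) show ?thesis by (auto simp: differentiable_def)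
qed

lemma Ck_on_const: fixes S :: "(real^'n) set" shows "Ck_on k S (\<lambda>u. c)"
proof (induction k arbitrary: c)
  case (Suc k)
  have "partial j (\<lambda>u. c) = (\<lambda>u. 0)" for j :: 'n
    by (auto intro!: partial_eqI)
  with Suc show ?case by simp
qed simp

lemma Ck_on_add:
  assumes S: "open S" shows "Ck_on k S f \<Longrightarrow> Ck_on k S g \<Longrightarrow> Ck_on k S (\<lambda>u. f u + g u)"
proof (induction k arbitrary: f g)
  case 0 then show ?case by (auto intro: continuous_intros)
next
  case (Suc k)
  show ?case
  proof (rule Ck_on_SucI[OF S])
    fix u assume "u \<in> S"
    then show "((\<lambda>u. f u + g u) has_derivative
        (\<lambda>v. frechet_derivative f (at u) v + frechet_derivative g (at u) v)) (at u)"
      using Suc.prems by (auto intro!: has_derivative_add simp: frechet_derivative_works[symmetric])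
  next
    fix j show "Ck_on k S (\<lambda>u. frechet_derivative f (at u) (axis j 1) + frechet_derivative g (at u) (axis j 1))"
      using Suc by (simp add: partial_def[abs_def])
  qed
qed

lemma Ck_on_bounded_linear:
  assumes L: "bounded_linear L" and S: "open S"
  shows "Ck_on k S f \<Longrightarrow> Ck_on k S (\<lambda>u. L (f u))"
proof (induction k arbitrary: f)
  case 0 then show ?case using bounded_linear.continuous_on[OF L] by auto
next
  case (Suc k)
  show ?case
  proof (rule Ck_on_SucI[OF S])
    fix u assume "u \<in> S"
    then show "((\<lambda>u. L (f u)) has_derivative (\<lambda>v. L (frechet_derivative f (at u) v))) (at u)"
      using Suc.prems by (auto intro!: bounded_linear.has_derivative[OF L] simp: frechet_derivative_works[symmetric])
  next
    fix j show "Ck_on k S (\<lambda>u. L (frechet_derivative f (at u) (axis j 1)))"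
      using Suc by (simp add: partial_def[abs_def])
  qed
qed

lemma Ck_on_bilinear:
  assumes p: "bounded_bilinear p" and S: "open S"
  shows "Ck_on k S f \<Longrightarrow> Ck_on k S g \<Longrightarrow> Ck_on k S (\<lambda>u. p (f u) (g u))"
proof (induction k arbitrary: f g)
  case 0 then show ?case using bounded_bilinear.continuous_on[OF p] by auto
next
  case (Suc k)
  show ?case
  proof (rule Ck_on_SucI[OF S])
    fix u assume "u \<in> S"
    then show "((\<lambda>u. p (f u) (g u)) has_derivative
        (\<lambda>v. p (f u) (frechet_derivative g (at u) v) + p (frechet_derivative f (at u) v) (g u))) (at u)"
      using Suc.prems by (auto intro!: bounded_bilinear.FDERIV[OF p] simp: frechet_derivative_works[symmetric])
  next
    fix j
    have "Ck_on k S (partial j f)" "Ck_on k S (partial j g)" using Suc.prems by auto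
    moreover have "Ck_on k S f" "Ck_on k S g" using Suc.prems Ck_on_Suc_imp by blast+
    ultimately have "Ck_on k S (\<lambda>u. p (f u) (partial j g u) + p (partial j f u) (g u))"
      by (intro Ck_on_add[OF S] Suc.IH)
    then show "Ck_on k S (\<lambda>u. p (f u) (frechet_derivative g (at u) (axis j 1)) + p (frechet_derivative f (at u) (axis j 1)) (g u))"
      by (simp add: partial_def[abs_def])
  qed
qed

lemma Ck_on_minus: "open S \<Longrightarrow> Ck_on k S f \<Longrightarrow> Ck_on k S (\<lambda>u. - f u)"
  using Ck_on_bounded_linear[OF bounded_linear_minus[OF bounded_linear_ident]] .

lemma Ck_on_diff: "open S \<Longrightarrow> Ck_on k S f \<Longrightarrow> Ck_on k S g \<Longrightarrow> Ck_on k S (\<lambda>u. f u - g u)"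
  using Ck_on_add[of S k f "\<lambda>u. - g u"] Ck_on_minus[of S k g] by simp

lemma Ck_on_sum:
  assumes "open S" "\<And>i. i \<in> I \<Longrightarrow> Ck_on k S (f i)"
  shows "Ck_on k S (\<lambda>u. \<Sum>i\<in>I. f i u)"
  using assms(2) by (induction I rule: infinite_finite_induct) (auto intro!: Ck_on_const Ck_on_add[OF assms(1)])

lemma Ck_on_inverse:
  fixes f :: "real^'n \<Rightarrow> real"
  assumes S: "open S" and nz: "\<And>u. u \<in> S \<Longrightarrow> f u \<noteq> 0"
  shows "Ck_on k S f \<Longrightarrow> Ck_on k S (\<lambda>u. inverse (f u))"
proof (induction k)
  case 0 then show ?case using nz by (auto intro: continuous_intros)
next
  case (Suc k)
  have f: "Ck_on k S f" "\<And>j. Ck_on k S (partial j f)" using Suc.prems Ck_on_Suc_imp by auto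
  show ?case
  proof (rule Ck_on_SucI[OF S])
    fix u assume "u \<in> S"
    then show "((\<lambda>u. inverse (f u)) has_derivative
        (\<lambda>v. - (inverse (f u) * frechet_derivative f (at u) v * inverse (f u)))) (at u)"
      using Suc.prems nz by (auto intro!: has_derivative_inverse simp: frechet_derivative_works[symmetric])
  next
    fix j show "Ck_on k S (\<lambda>u. - (inverse (f u) * frechet_derivative f (at u) (axis j 1) * inverse (f u)))"
      using f(2)[of j] unfolding partial_def[abs_def]
      by (intro Ck_on_minus[OF S] Ck_on_bilinear[OF bounded_bilinear_mult S] Suc.IH f)
  qed
qed

lemma Ck_on_vec:
  fixes f :: "real^'n \<Rightarrow> 'b::real_normed_vector^'m"
  assumes S: "open S" and f: "\<And>i. Ck_on k S (\<lambda>u. f u $ i)"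
  shows "Ck_on k S f"
proof -
  have lin: "bounded_linear (\<lambda>x. axis i x :: 'b^'m)" for i :: 'm
  proof (rule bounded_linear_intro[of _ 1])
    fix x :: 'b
    have "norm (axis i x :: 'b^'m) \<le> (\<Sum>k\<in>UNIV. norm ((axis i x :: 'b^'m) $ k))"
      unfolding norm_vec_def by (rule L2_set_le_sum) auto
    also have "\<dots> = norm x * 1"
      by (simp add: axis_def if_distrib[of norm] cong: if_cong)
    finally show "norm (axis i x :: 'b^'m) \<le> norm x * 1" .
  qed (auto simp: vec_eq_iff axis_def)
  have "Ck_on k S (\<lambda>u. \<Sum>i\<in>UNIV. axis i (f u $ i))"
    by (intro Ck_on_sum[OF S] Ck_on_bounded_linear[OF lin S] f)
  moreover have "(\<Sum>i\<in>UNIV. axis i (f u $ i)) = f u" for u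
    by (simp add: vec_eq_iff axis_def)
  ultimately show ?thesis by simp
qed

lemma Ck_on_nth: "open S \<Longrightarrow> Ck_on k S f \<Longrightarrow> Ck_on k S (\<lambda>u. f u $ i)"
  using Ck_on_bounded_linear[OF bounded_linear_vec_nth] .

lemma smooth_on_vec_iff:
  assumes "open S" shows "smooth_on S f \<longleftrightarrow> (\<forall>i. smooth_on S (\<lambda>u. f u $ i))"
  using Ck_on_vec[OF assms] Ck_on_nth[OF assms] unfolding smooth_on_def by blast

lemma smooth_on_cong: "open S \<Longrightarrow> (\<And>x. x \<in> S \<Longrightarrow> f x = g x) \<Longrightarrow> smooth_on S f \<Longrightarrow> smooth_on S g"
  using Ck_on_cong[of S f g] by (auto simp: smooth_on_def)

lemma smooth_on_subset: "smooth_on S f \<Longrightarrow> U \<subseteq> S \<Longrightarrow> smooth_on U f"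
  using Ck_on_subset[of _ S f] by (auto simp: smooth_on_def)

lemma smooth_on_const: "smooth_on S (\<lambda>u. c)"
  by (simp add: smooth_on_def Ck_on_const)

lemma smooth_on_add: "open S \<Longrightarrow> smooth_on S f \<Longrightarrow> smooth_on S g \<Longrightarrow> smooth_on S (\<lambda>u. f u + g u)"
  by (simp add: smooth_on_def Ck_on_add)

lemma smooth_on_bounded_linear:
  "bounded_linear L \<Longrightarrow> open S \<Longrightarrow> smooth_on S f \<Longrightarrow> smooth_on S (\<lambda>u. L (f u))"
  by (simp add: smooth_on_def Ck_on_bounded_linear)

lemma smooth_on_bilinear:
  "bounded_bilinear p \<Longrightarrow> open S \<Longrightarrow> smooth_on S f \<Longrightarrow> smooth_on S g \<Longrightarrow> smooth_on S (\<lambda>u. p (f u) (g u))"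
  by (simp add: smooth_on_def Ck_on_bilinear)

lemma smooth_on_divide:
  fixes f g :: "real^'n \<Rightarrow> real"
  assumes "open S" "\<And>u. u \<in> S \<Longrightarrow> g u \<noteq> 0" "smooth_on S f" "smooth_on S g"
  shows "smooth_on S (\<lambda>u. f u / g u)"
  unfolding divide_inverse
  by (rule smooth_on_bilinear[OF bounded_bilinear_mult assms(1,3)])
     (use assms Ck_on_inverse[of S g] in \<open>simp add: smooth_on_def\<close>)

lemma smooth_on_partial: "smooth_on S f \<Longrightarrow> smooth_on S (partial j f)"
  unfolding smooth_on_def by (metis Ck_on.simps(2))

lemma smooth_on_differentiable: "smooth_on S f \<Longrightarrow> u \<in> S \<Longrightarrow> f differentiable (at u)"
  unfolding smooth_on_def by (metis Ck_on.simps(2))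

text \<open>The regularity of a solution of a total differential equation is bounded only by that of the
  coefficients: each derivative is an expression in the map itself.\<close>

lemma smooth_on_bootstrap:
  assumes S: "open S" and D: "\<And>u. u \<in> S \<Longrightarrow> (f has_derivative D u) (at u)"
    and step: "\<And>k j. Ck_on k S f \<Longrightarrow> Ck_on k S (\<lambda>u. D u (axis j 1))"
  shows "smooth_on S f"
  unfolding smooth_on_def
proof
  fix k show "Ck_on k S f"
  proof (induction k)
    case 0
    show ?case using D by (auto intro!: continuous_at_imp_continuous_on has_derivative_continuous)
  next
    case (Suc k)
    then show ?case by (intro Ck_on_SucI[OF S D] step)
  qed
qed

lemma Ck_on_conn_form:
  assumes S: "open S" and b: "smooth_on S b"
  shows "Ck_on k S (\<lambda>u. conn_form (b u) \<mu> v)"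
  unfolding conn_form_def
  using b unfolding smooth_on_def
  by (intro Ck_on_add[OF S] Ck_on_diff[OF S] Ck_on_const Ck_on_bilinear[OF bounded_bilinear_matrix_mult S]) auto

lemma solves_frame_smooth:
  assumes S: "open S" and F: "solves_frame_on S b \<mu> F" and b: "smooth_on S b"
  shows "smooth_on S F"
  by (rule smooth_on_bootstrap[OF S solves_frame_onD[OF F]])
     (assumption | intro Ck_on_bilinear[OF bounded_bilinear_matrix_mult S] Ck_on_conn_form[OF S b])+

lemma smooth_on_hermitian_projection_onto:
  fixes P :: "real^'n \<Rightarrow> complex^'n^'n"
  assumes S: "open S"
    and F: "solves_frame_on S b z F" and G: "solves_frame_on S b (cnj z) G"
    and inv: "\<And>x. x \<in> S \<Longrightarrow> F x ** adj (G x) = mat 1"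
    and adjb: "\<And>x. x \<in> S \<Longrightarrow> adj (b x) = b x"
    and \<pi>: "hermitian_projection \<pi>"
    and P: "\<And>x. x \<in> S \<Longrightarrow> hermitian_projection_onto (P x) ((*v) (adj (G x)) ` image_of \<pi>)"
    and b: "smooth_on S b"
  shows "smooth_on S P"
  by (rule smooth_on_bootstrap[OF S has_derivative_hermitian_projection_onto[OF S _ F G inv adjb \<pi> P]])
     (assumption | intro Ck_on_diff[OF S] Ck_on_bilinear[OF bounded_bilinear_matrix_mult S]
        Ck_on_conn_form[OF S b] Ck_on_const)+


section \<open>Symmetry of second partial derivatives\<close>

lemma DERIV_partial:
  assumes "f differentiable (at (w + s *\<^sub>R axis i 1))"
  shows "((\<lambda>s. f (w + s *\<^sub>R axis i 1)) has_real_derivative partial i f (w + s *\<^sub>R axis i 1)) (at s)"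
proof -
  let ?D = "frechet_derivative f (at (w + s *\<^sub>R axis i 1))"
  have "((\<lambda>s. w + s *\<^sub>R axis i 1) has_derivative (\<lambda>h. h *\<^sub>R axis i 1)) (at s)"
    by (auto intro!: derivative_eq_intros)
  moreover have "(f has_derivative ?D) (at (w + s *\<^sub>R axis i 1))"
    using assms frechet_derivative_works by blast
  ultimately have "((\<lambda>s. f (w + s *\<^sub>R axis i 1)) has_derivative (\<lambda>h. ?D (h *\<^sub>R axis i 1))) (at s)"
    by (rule has_derivative_compose)
  moreover have "?D (h *\<^sub>R axis i 1) = ?D (axis i 1) * h" for h
    using linear_frechet_derivative[OF assms] by (simp add: linear_scale)
  ultimately show ?thesis by (simp add: has_field_derivative_def partial_def)
qed

text \<open>The mean value theorem in direction \<open>i\<close>, applied to the difference in direction \<open>j\<close>, and then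
  once more in direction \<open>j\<close>.\<close>

lemma second_difference_mean_value:
  fixes f :: "real^'n \<Rightarrow> real"
  assumes f: "Ck_on 2 S f" and S: "ball u e \<subseteq> S" and h: "0 < h" "2 * h < e"
  shows "\<exists>p \<in> ball u e. dist u p \<le> 2 * h \<and>
    f (u + h *\<^sub>R axis j 1 + h *\<^sub>R axis i 1) - f (u + h *\<^sub>R axis i 1) - f (u + h *\<^sub>R axis j 1) + f u
      = h * h * partial j (partial i f) p"
proof -
  have norm_le: "norm (s *\<^sub>R axis i 1 + t *\<^sub>R axis j 1 :: real^'n) \<le> 2 * h" if "0 \<le> s" "s \<le> h" "0 \<le> t" "t \<le> h" for s t
    using norm_triangle_ineq[of "s *\<^sub>R axis i 1 :: real^'n" "t *\<^sub>R axis j 1"] that by simp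
  have in_ball: "u + t *\<^sub>R axis j 1 + s *\<^sub>R axis i 1 \<in> ball u e" "dist u (u + t *\<^sub>R axis j 1 + s *\<^sub>R axis i 1) \<le> 2 * h"
    if "0 \<le> s" "s \<le> h" "0 \<le> t" "t \<le> h" for s t
  proof -
    have "dist u (u + t *\<^sub>R axis j 1 + s *\<^sub>R axis i 1) = norm (s *\<^sub>R axis i 1 + t *\<^sub>R axis j 1 :: real^'n)"
      by (subst dist_commute) (simp add: dist_norm add.commute)
    then show "dist u (u + t *\<^sub>R axis j 1 + s *\<^sub>R axis i 1) \<le> 2 * h" using norm_le[OF that] by simp
    then show "u + t *\<^sub>R axis j 1 + s *\<^sub>R axis i 1 \<in> ball u e" using h by simp
  qed
  have df: "f differentiable (at x)" "partial i f differentiable (at x)" if "x \<in> ball u e" for x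
    using f S that by (auto simp: numeral_2_eq_2)
  have "((\<lambda>s. f (u + h *\<^sub>R axis j 1 + s *\<^sub>R axis i 1) - f (u + s *\<^sub>R axis i 1)) has_real_derivative
      partial i f (u + h *\<^sub>R axis j 1 + s *\<^sub>R axis i 1) - partial i f (u + s *\<^sub>R axis i 1)) (at s)"
    if "0 \<le> s" "s \<le> h" for s
    using in_ball(1)[OF that, of 0] in_ball(1)[OF that, of h] h
    by (intro DERIV_diff DERIV_partial df) auto
  from MVT2[OF h(1) this] obtain s where s: "0 < s" "s < h"
    and eq1: "f (u + h *\<^sub>R axis j 1 + h *\<^sub>R axis i 1) - f (u + h *\<^sub>R axis i 1) - (f (u + h *\<^sub>R axis j 1) - f u)
     = h * (partial i f (u + h *\<^sub>R axis j 1 + s *\<^sub>R axis i 1) - partial i f (u + s *\<^sub>R axis i 1))"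
    by auto
  have "((\<lambda>t. partial i f ((u + s *\<^sub>R axis i 1) + t *\<^sub>R axis j 1)) has_real_derivative
      partial j (partial i f) ((u + s *\<^sub>R axis i 1) + t *\<^sub>R axis j 1)) (at t)"
    if "0 \<le> t" "t \<le> h" for t
    using in_ball(1)[of s t] s that by (intro DERIV_partial df) (auto simp: ac_simps)
  from MVT2[OF h(1) this] obtain t where t: "0 < t" "t < h"
    and eq2: "partial i f (u + s *\<^sub>R axis i 1 + h *\<^sub>R axis j 1) - partial i f (u + s *\<^sub>R axis i 1)
      = h * partial j (partial i f) (u + s *\<^sub>R axis i 1 + t *\<^sub>R axis j 1)"
    by auto
  show ?thesis
  proof (intro bexI conjI)
    show "u + t *\<^sub>R axis j 1 + s *\<^sub>R axis i 1 \<in> ball u e" "dist u (u + t *\<^sub>R axis j 1 + s *\<^sub>R axis i 1) \<le> 2 * h"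
      using in_ball s t by auto
    show "f (u + h *\<^sub>R axis j 1 + h *\<^sub>R axis i 1) - f (u + h *\<^sub>R axis i 1) - f (u + h *\<^sub>R axis j 1) + f u
      = h * h * partial j (partial i f) (u + t *\<^sub>R axis j 1 + s *\<^sub>R axis i 1)"
      using eq1 eq2 by (simp add: ac_simps)
  qed
qed

text \<open>The second difference quotient does not depend on the order of the two directions, and in either
  order it is a mixed partial derivative at a nearby point.\<close>

lemma partial_commute:
  fixes f :: "real^'n \<Rightarrow> real"
  assumes S: "open S" "u \<in> S" and f: "Ck_on 2 S f"
  shows "partial i (partial j f) u = partial j (partial i f) u"
proof (rule ccontr)
  define p where "p = partial i (partial j f)"
  define q where "q = partial j (partial i f)"
  assume "partial i (partial j f) u \<noteq> partial j (partial i f) u"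
  then have d: "\<bar>p u - q u\<bar> / 2 > 0" by (simp add: p_def q_def)
  have "continuous_on S p" "continuous_on S q"
    using f by (simp_all add: numeral_2_eq_2 p_def q_def)
  then have "isCont p u" "isCont q u" using S by (simp_all add: continuous_on_eq_continuous_at)
  then have "\<exists>d>0. \<forall>x. dist x u < d \<longrightarrow> dist (p x) (p u) < \<bar>p u - q u\<bar> / 2"
    "\<exists>d>0. \<forall>x. dist x u < d \<longrightarrow> dist (q x) (q u) < \<bar>p u - q u\<bar> / 2"
    using d unfolding continuous_at_eps_delta by blast+
  then obtain d1 d2 where d1: "d1 > 0" "\<And>x. dist x u < d1 \<Longrightarrow> dist (p x) (p u) < \<bar>p u - q u\<bar> / 2"
    and d2: "d2 > 0" "\<And>x. dist x u < d2 \<Longrightarrow> dist (q x) (q u) < \<bar>p u - q u\<bar> / 2"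
    by blast
  obtain e where e: "e > 0" "ball u e \<subseteq> S" using S open_contains_ball by blast
  \<comment> \<open>Both points at which the mixed derivatives are compared lie within \<open>2 h\<close> of \<open>u\<close>.\<close>
  define h where "h = min e (min d1 d2) / 3"
  have h: "0 < h" "2 * h < e" "2 * h < d1" "2 * h < d2" using e d1 d2 by (auto simp: h_def)
  obtain x where x: "dist u x \<le> 2 * h"
    "f (u + h *\<^sub>R axis j 1 + h *\<^sub>R axis i 1) - f (u + h *\<^sub>R axis i 1) - f (u + h *\<^sub>R axis j 1) + f u = h * h * q x"
    using second_difference_mean_value[OF f e(2) h(1,2), of j i] unfolding q_def by blast
  obtain y where y: "dist u y \<le> 2 * h"
    "f (u + h *\<^sub>R axis i 1 + h *\<^sub>R axis j 1) - f (u + h *\<^sub>R axis j 1) - f (u + h *\<^sub>R axis i 1) + f u = h * h * p y"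
    using second_difference_mean_value[OF f e(2) h(1,2), of i j] unfolding p_def by blast
  have swap: "u + h *\<^sub>R axis i 1 + h *\<^sub>R axis j 1 = u + h *\<^sub>R axis j 1 + h *\<^sub>R axis i 1" by (simp add: ac_simps)
  have "h * h * q x = h * h * p y" using x(2) y(2)[unfolded swap] by linarith
  then have "q x = p y" using h by simp
  moreover have "dist (p y) (p u) < \<bar>p u - q u\<bar> / 2" "dist (q x) (q u) < \<bar>p u - q u\<bar> / 2"
    using d1(2)[of y] d2(2)[of x] x(1) y(1) h dist_commute[of u x] dist_commute[of u y] by linarith+
  ultimately show False unfolding dist_real_def by (smt (verit, best) field_sum_of_halves)
qed

section \<open>Flatness of diagonal metrics\<close>

lemma partial_mult:
  fixes f g :: "real^'n \<Rightarrow> real"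
  assumes "f differentiable (at u)" "g differentiable (at u)"
  shows "partial j (\<lambda>v. f v * g v) u = f u * partial j g u + partial j f u * g u"
  unfolding partial_def[of j f] partial_def[of j g]
  by (rule partial_eqI[where D = "\<lambda>v. f u * frechet_derivative g (at u) v + frechet_derivative f (at u) v * g u"])
     (use assms in \<open>auto intro!: has_derivative_mult simp: frechet_derivative_works[symmetric]\<close>)

lemma partial_sum:
  assumes "\<And>m. m \<in> I \<Longrightarrow> f m differentiable (at u)"
  shows "partial j (\<lambda>v. \<Sum>m\<in>I. f m v) u = (\<Sum>m\<in>I. partial j (f m) u)"
proof -
  have "((\<lambda>v. \<Sum>m\<in>I. f m v) has_derivative (\<lambda>v. \<Sum>m\<in>I. frechet_derivative (f m) (at u) v)) (at u)"
    by (rule has_derivative_sum) (simp add: assms frechet_derivative_works[symmetric])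
  from partial_eqI[OF this] show ?thesis by (simp add: partial_def)
qed

text \<open>A gauge argument: with Christoffel symbols \<open>W\<^sup>-\<^sup>1 dW\<close>, the curvature is
  \<open>W\<^sup>-\<^sup>1 (\<partial>\<^sub>i \<partial>\<^sub>j W - \<partial>\<^sub>j \<partial>\<^sub>i W)\<close>, and second partial derivatives commute.\<close>

lemma curvature_zero_of_parallel_frame:
  fixes g W :: "real^'n \<Rightarrow> real^'n^'n"
  assumes S: "open S" and u: "u \<in> S" and W: "smooth_on S W"
    and \<Gamma>: "\<And>k i j. smooth_on S (christoffel g k i j)"
    and dW: "\<And>x i a k. x \<in> S \<Longrightarrow>
        partial i (\<lambda>v. W v $ a $ k) x = (\<Sum>m\<in>UNIV. W x $ a $ m * christoffel g m i k x)"
    and inv: "C ** W u = mat 1"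
  shows "riemann_curvature g l k i j u = 0"
proof -
  define w where "w a m v = W v $ a $ m" for a m and v :: "real^'n"
  have smooth_w: "smooth_on S (w a m)" for a m
    using W smooth_on_vec_iff[OF S] unfolding w_def by metis
  have dw: "w a m differentiable (at u)" "christoffel g p i k differentiable (at u)" for a m p i k
    using smooth_on_differentiable[OF smooth_w u] smooth_on_differentiable[OF \<Gamma> u] by auto
  have pw: "partial i (w a k) x = (\<Sum>m\<in>UNIV. w a m x * christoffel g m i k x)" if "x \<in> S" for x i a k
    unfolding w_def by (rule dW[OF that])
  have second: "partial j (partial i (w a k)) u = (\<Sum>p\<in>UNIV. w a p u *
      (partial j (christoffel g p i k) u + (\<Sum>m\<in>UNIV. christoffel g p j m u * christoffel g m i k u)))" for i j a
  proof -
    have "partial j (partial i (w a k)) u = partial j (\<lambda>x. \<Sum>m\<in>UNIV. w a m x * christoffel g m i k x) u"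
      by (rule partial_cong[OF S u pw])
    also have "\<dots> = (\<Sum>m\<in>UNIV. w a m u * partial j (christoffel g m i k) u + partial j (w a m) u * christoffel g m i k u)"
      by (subst partial_sum) (auto intro!: differentiable_mult dw simp: partial_mult[OF dw])
    also have "\<dots> = (\<Sum>m\<in>UNIV. w a m u * partial j (christoffel g m i k) u)
        + (\<Sum>m\<in>UNIV. \<Sum>p\<in>UNIV. w a p u * christoffel g p j m u * christoffel g m i k u)"
      by (simp add: sum.distrib pw[OF u] sum_distrib_right)
    also have "(\<Sum>m\<in>UNIV. \<Sum>p\<in>UNIV. w a p u * christoffel g p j m u * christoffel g m i k u)
       = (\<Sum>p\<in>UNIV. w a p u * (\<Sum>m\<in>UNIV. christoffel g p j m u * christoffel g m i k u))"
      by (subst sum.swap) (simp add: sum_distrib_left mult.assoc)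
    finally show ?thesis by (simp add: distrib_left sum.distrib)
  qed
  define R where "R = (\<chi> p. riemann_curvature g p k i j u)"
  \<comment> \<open>By \<open>second\<close>, the commutator of second derivatives of \<open>W\<close> is \<open>W\<close> times the curvature.\<close>
  have "(W u *v R) $ a = 0" for a
  proof -
    have "Ck_on 2 S (w a k)" using smooth_w by (simp add: smooth_on_def)
    from partial_commute[OF S u this, of i j]
    have "0 = partial i (partial j (w a k)) u - partial j (partial i (w a k)) u" by simp
    also have "\<dots> = (\<Sum>p\<in>UNIV. w a p u * riemann_curvature g p k i j u)"
      unfolding second sum_subtractf[symmetric]
      by (rule sum.cong) (auto simp: riemann_curvature_def sum_subtractf algebra_simps)
    finally show ?thesis by (simp add: matrix_vector_mult_def R_def w_def)
  qed
  then have "W u *v R = 0" by (simp add: vec_eq_iff)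
  then have "C *v (W u *v R) = 0" by simp
  with inv have "R = 0" by (simp add: matrix_vector_mul_assoc)
  then show ?thesis by (simp add: R_def vec_eq_iff)
qed

lemma matrix_inv_diag_metric:
  assumes "\<And>i. h u $ i \<noteq> 0"
  shows "matrix_inv (diag_metric h u) $ k $ l = (if k = l then inverse ((h u $ k)\<^sup>2) else 0)"
proof -
  define D where "D = (\<chi> i j. if i = j then inverse ((h u $ i)\<^sup>2) else 0)"
  have "diag_metric h u ** D = mat 1" "D ** diag_metric h u = mat 1"
    using assms by (auto simp: vec_eq_iff matrix_matrix_mult_def D_def diag_metric_def mat_def
        if_distrib[of "\<lambda>x. x * _"] if_distrib[of "\<lambda>x. _ * x"] cong: if_cong)
  note D = this
  then have "\<exists>B. diag_metric h u ** B = mat 1 \<and> B ** diag_metric h u = mat 1" by blast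
  then have "diag_metric h u ** matrix_inv (diag_metric h u) = mat 1"
    unfolding matrix_inv_def by (rule someI2_ex) simp
  then have "matrix_inv (diag_metric h u) = D"
    by (metis D(2) matrix_mul_assoc matrix_mul_lid matrix_mul_rid)
  then show ?thesis by (simp add: D_def)
qed

lemma christoffel_diag_metric:
  assumes nz: "\<And>i. h u $ i \<noteq> 0" and h: "\<And>i. (\<lambda>v. h v $ i) differentiable (at u)"
  shows "christoffel (diag_metric h) k i j u =
    (if j = k then partial i (\<lambda>v. h v $ k) u / h u $ k else 0)
    + (if i = k then partial j (\<lambda>v. h v $ k) u / h u $ k else 0)
    - (if i = j then h u $ i * partial k (\<lambda>v. h v $ i) u / (h u $ k)\<^sup>2 else 0)"
proof -
  have pg: "partial l (\<lambda>v. diag_metric h v $ a $ b) u = (if a = b then 2 * h u $ a * partial l (\<lambda>v. h v $ a) u else 0)"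
    for l a b
  proof (cases "a = b")
    case True
    then have "(\<lambda>v. diag_metric h v $ a $ b) = (\<lambda>v. h v $ a * h v $ a)"
      by (simp add: diag_metric_def power2_eq_square)
    with True show ?thesis by (simp add: partial_mult[OF h h])
  next
    case False
    then have "(\<lambda>v. diag_metric h v $ a $ b) = (\<lambda>v. 0)" by (simp add: diag_metric_def)
    with False show ?thesis using partial_eqI[OF has_derivative_const[of 0 "at u"]] by simp
  qed
  have "christoffel (diag_metric h) k i j u = 1/2 * (\<Sum>l\<in>UNIV. if k = l then inverse ((h u $ k)\<^sup>2) *
     (partial i (\<lambda>v. diag_metric h v $ j $ l) u + partial j (\<lambda>v. diag_metric h v $ i $ l) u
      - partial l (\<lambda>v. diag_metric h v $ i $ j) u) else 0)"
    unfolding christoffel_def matrix_inv_diag_metric[of h u, OF nz]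
    by (intro arg_cong[of _ _ "\<lambda>x. 1/2 * x"] sum.cong) auto
  also have "\<dots> = 1/2 * (inverse ((h u $ k)\<^sup>2) *
     (partial i (\<lambda>v. diag_metric h v $ j $ k) u + partial j (\<lambda>v. diag_metric h v $ i $ k) u
      - partial k (\<lambda>v. diag_metric h v $ i $ j) u))"
    by simp
  finally show ?thesis
    unfolding pg using nz[of k] by (auto simp: field_simps power2_eq_square)
qed

text \<open>The invertible matrix \<open>R\<close> solves the frame equation at parameter zero.  Its columns scaled by the
  Lame coefficients \<open>h\<close> form the Jacobian matrix of flat coordinates, and the logarithmic derivative of
  this matrix is the Levi-Civita connection of \<open>\<Sum> h\<^sub>i\<^sup>2 du\<^sub>i\<^sup>2\<close>.\<close>

lemma flat_diag_metric:
  fixes h :: "real^'n \<Rightarrow> real^'n" and \<beta> R :: "real^'n \<Rightarrow> real^'n^'n"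
  assumes S: "open S" and h: "smooth_on S h" and nz: "\<And>u i. u \<in> S \<Longrightarrow> h u $ i \<noteq> 0"
    and \<beta>: "smooth_on S \<beta>" and R: "smooth_on S R"
    and sym: "\<And>u i j. u \<in> S \<Longrightarrow> i \<noteq> j \<Longrightarrow> \<beta> u $ i $ j = \<beta> u $ j $ i"
    and dh: "\<And>u i k. u \<in> S \<Longrightarrow> i \<noteq> k \<Longrightarrow> partial i (\<lambda>v. h v $ k) u = \<beta> u $ k $ i * h u $ i"
    and dR: "\<And>u i a l. u \<in> S \<Longrightarrow> partial i (\<lambda>v. R v $ a $ l) u =
        (\<Sum>m\<in>UNIV. R u $ a $ m * ((of_bool (m = i) - of_bool (l = i)) * \<beta> u $ m $ l))"
    and inv: "\<And>u. u \<in> S \<Longrightarrow> C u ** R u = mat 1"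
  shows "flat_metric_on S (diag_metric h)"
proof -
  have hi: "smooth_on S (\<lambda>u. h u $ i)" for i using h smooth_on_vec_iff[OF S] by blast
  have \<beta>ij: "smooth_on S (\<lambda>u. \<beta> u $ i $ j)" for i j
    using \<beta> smooth_on_vec_iff[OF S] by metis
  have Rij: "smooth_on S (\<lambda>u. R u $ i $ j)" for i j
    using R smooth_on_vec_iff[OF S] by metis
  note mult = smooth_on_bilinear[OF bounded_bilinear_mult S]
  have hd: "(\<lambda>v. h v $ i) differentiable (at u)" if "u \<in> S" for i u
    using smooth_on_differentiable[OF hi that] .
  have \<Gamma>: "christoffel (diag_metric h) k i j u =
      (of_bool (k = i) - of_bool (j = i)) * \<beta> u $ k $ j * h u $ j / h u $ k
      + of_bool (k = j) * partial i (\<lambda>v. h v $ k) u / h u $ k" if u: "u \<in> S" for k i j u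
    unfolding christoffel_diag_metric[of h u, OF nz[OF u] hd[OF u]]
    using dh[OF u, of j k] dh[OF u, of k i] sym[OF u, of k j] nz[OF u, of k]
    by (auto simp: field_simps power2_eq_square)
  have \<Gamma>_smooth: "smooth_on S (christoffel (diag_metric h) k i j)" for k i j
  proof (rule smooth_on_cong[OF S \<Gamma>[symmetric]])
    show "smooth_on S (\<lambda>u. (of_bool (k = i) - of_bool (j = i)) * \<beta> u $ k $ j * h u $ j / h u $ k
      + of_bool (k = j) * partial i (\<lambda>v. h v $ k) u / h u $ k)"
      by (intro smooth_on_add[OF S] smooth_on_divide[OF S nz] mult smooth_on_const \<beta>ij hi smooth_on_partial)
  qed
  define W where "W u = (\<chi> a l. R u $ a $ l * h u $ l)" for u
  have W: "smooth_on S W"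
    unfolding smooth_on_vec_iff[OF S] W_def by (auto intro!: mult Rij hi)
  have dW: "partial i (\<lambda>v. W v $ a $ k) u = (\<Sum>m\<in>UNIV. W u $ a $ m * christoffel (diag_metric h) m i k u)"
    if u: "u \<in> S" for u i a k
  proof -
    have "partial i (\<lambda>v. W v $ a $ k) u = R u $ a $ k * partial i (\<lambda>v. h v $ k) u
        + (\<Sum>m\<in>UNIV. R u $ a $ m * ((of_bool (m = i) - of_bool (k = i)) * \<beta> u $ m $ k)) * h u $ k"
      unfolding W_def
      using partial_mult[OF smooth_on_differentiable[OF Rij u] hd[OF u], of i a k k] dR[OF u] by simp
    also have "R u $ a $ k * partial i (\<lambda>v. h v $ k) u =
        (\<Sum>m\<in>UNIV. if m = k then R u $ a $ m * partial i (\<lambda>v. h v $ m) u else 0)"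
      by simp
    also have "\<dots> + (\<Sum>m\<in>UNIV. R u $ a $ m * ((of_bool (m = i) - of_bool (k = i)) * \<beta> u $ m $ k)) * h u $ k
      = (\<Sum>m\<in>UNIV. W u $ a $ m * christoffel (diag_metric h) m i k u)"
      unfolding sum_distrib_right sum.distrib[symmetric] W_def \<Gamma>[OF u]
      by (rule sum.cong) (use nz[OF u] in \<open>auto simp: field_simps\<close>)
    finally show ?thesis .
  qed
  have "\<exists>D. D ** W u = mat 1" if u: "u \<in> S" for u
  proof
    define H where "H = (\<chi> l k. if l = k then inverse (h u $ l) else 0)"
    have "(H ** C u ** W u) $ i $ j = (mat 1 :: real^'n^'n) $ i $ j" for i j
    proof -
      have "(H ** (C u ** W u)) $ i $ j = inverse (h u $ i) * (C u ** W u) $ i $ j"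
        by (simp add: matrix_matrix_mult_def H_def if_distrib[of "\<lambda>x. x * _"] cong: if_cong)
      also have "(C u ** W u) $ i $ j = (C u ** R u) $ i $ j * h u $ j"
        by (simp add: matrix_matrix_mult_def W_def sum_distrib_right mult.assoc)
      finally show ?thesis
        using nz[OF u] by (simp add: inv[OF u] mat_def matrix_mul_assoc)
    qed
    then show "(H ** C u) ** W u = mat 1" by (simp add: vec_eq_iff)
  qed
  then have "riemann_curvature (diag_metric h) l k i j u = 0" if "u \<in> S" for l k i j u
    using curvature_zero_of_parallel_frame[OF S that W \<Gamma>_smooth dW] that by blast
  moreover have "riemannian_metric_on S (diag_metric h)"
    unfolding riemannian_metric_on_def
  proof (intro conjI ballI allI impI)
    have "smooth_on S (\<lambda>u. if i = j then (h u $ i)\<^sup>2 else 0)" for i j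
      by (cases "i = j") (auto simp: power2_eq_square intro!: mult hi smooth_on_const)
    then show "smooth_on S (diag_metric h)"
      unfolding smooth_on_vec_iff[OF S] by (simp add: diag_metric_def)
    fix u assume u: "u \<in> S"
    show "transpose (diag_metric h u) = diag_metric h u"
      by (auto simp: vec_eq_iff transpose_def diag_metric_def)
    fix v :: "real^'n" assume "v \<noteq> 0"
    then obtain i where i: "v $ i \<noteq> 0" by (auto simp: vec_eq_iff)
    have "v \<bullet> (diag_metric h u *v v) = (\<Sum>i\<in>UNIV. (h u $ i * v $ i)\<^sup>2)"
      unfolding inner_vec_def
    proof (rule sum.cong)
      fix i
      have "(diag_metric h u *v v) $ i = (\<Sum>j\<in>UNIV. if i = j then (h u $ j)\<^sup>2 * v $ j else 0)"
        unfolding matrix_vector_mult_def diag_metric_def by (auto intro!: sum.cong simp del: sum.delta sum.delta')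
      then show "v $ i \<bullet> (diag_metric h u *v v) $ i = (h u $ i * v $ i)\<^sup>2"
        by (simp add: power2_eq_square)
    qed simp
    also have "\<dots> > 0"
      by (rule sum_pos2[of _ i]) (use i nz[OF u] in auto)
    finally show "0 < v \<bullet> (diag_metric h u *v v)" .
  qed
  ultimately show ?thesis by (simp add: flat_metric_on_def)
qed

lemma flat_metric_on_cong:
  assumes S: "open S" and eq: "\<And>u. u \<in> S \<Longrightarrow> g u = g' u" and flat: "flat_metric_on S g"
  shows "flat_metric_on S g'"
proof -
  have "christoffel g k i j u = christoffel g' k i j u" if "u \<in> S" for k i j u
    unfolding christoffel_def eq[OF that]
    by (simp add: partial_cong[OF S that, of "\<lambda>v. g v $ _ $ _" "\<lambda>v. g' v $ _ $ _"] eq)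
  then have "riemann_curvature g l k i j u = riemann_curvature g' l k i j u" if "u \<in> S" for l k i j u
    unfolding riemann_curvature_def
    using that by (simp add: partial_cong[OF S that, of "christoffel g _ _ _" "christoffel g' _ _ _"])
  with flat eq show ?thesis
    unfolding flat_metric_on_def riemannian_metric_on_def
    using smooth_on_cong[OF S eq] by auto
qed


section \<open>A potential from the spectral parameter\<close>

text \<open>The set where the sequence converges is open and closed: on each ball on which the derivatives
  converge uniformly, the sequence converges everywhere or nowhere.\<close>

lemma has_derivative_sequence_connected:
  fixes f :: "nat \<Rightarrow> 'a::real_normed_vector \<Rightarrow> 'b::banach"
  assumes S: "open S" "connected S" and x0: "x0 \<in> S" and lim: "(\<lambda>n. f n x0) \<longlonglongrightarrow> l"
    and df: "\<And>n x. x \<in> S \<Longrightarrow> (f n has_derivative f' n x) (at x)"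
    and loc: "\<And>x. x \<in> S \<Longrightarrow> \<exists>r>0. ball x r \<subseteq> S \<and>
        (\<forall>e>0. \<forall>\<^sub>F n in sequentially. \<forall>y\<in>ball x r. \<forall>h. norm (f' n y h - g' y h) \<le> e * norm h)"
  shows "\<exists>g. \<forall>x\<in>S. (\<lambda>n. f n x) \<longlonglongrightarrow> g x \<and> (g has_derivative g' x) (at x)"
proof -
  define cv where "cv x = convergent (\<lambda>n. f n x)" for x
  have ball: "\<exists>g. \<forall>y\<in>ball x r. (\<lambda>n. f n y) \<longlonglongrightarrow> g y \<and> (g has_derivative g' y) (at y within ball x r)"
    if r: "ball x r \<subseteq> S" and le: "\<And>e. e > 0 \<Longrightarrow> \<forall>\<^sub>F n in sequentially. \<forall>y\<in>ball x r. \<forall>h. norm (f' n y h - g' y h) \<le> e * norm h"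
      and z: "z \<in> ball x r" "cv z" for x r z
  proof -
    obtain l where "(\<lambda>n. f n z) \<longlonglongrightarrow> l" using z(2) by (auto simp: cv_def convergent_def)
    show ?thesis
    proof (rule has_derivative_sequence[OF convex_ball])
      show "(f n has_derivative f' n y) (at y within ball x r)" if "y \<in> ball x r" for n y
        using df[of y n] r that has_derivative_at_withinI by blast
      show "\<forall>\<^sub>F n in sequentially. \<forall>y\<in>ball x r. \<forall>h. norm (f' n y h - g' y h) \<le> e * norm h" if "e > 0" for e
        by (rule le[OF that])
    qed fact+
  qed
  have "cv x = cv x0" if x: "x \<in> S" for x
  proof (rule connected_local_const[where f = cv, OF S(2) x x0], rule ballI)
    fix a assume a: "a \<in> S"
    obtain r where r: "r > 0" "ball a r \<subseteq> S"
      "\<And>e. e > 0 \<Longrightarrow> \<forall>\<^sub>F n in sequentially. \<forall>y\<in>ball a r. \<forall>h. norm (f' n y h - g' y h) \<le> e * norm h"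
      using loc[OF a] by blast
    have "cv a = cv b" if "b \<in> ball a r" for b
    proof -
      have "cv y" if "cv z" "z \<in> ball a r" "y \<in> ball a r" for y z
        using ball[OF r(2,3) that(2,1)] that(3) by (auto simp: cv_def convergent_def)
      then show ?thesis using that r(1) by (metis centre_in_ball)
    qed
    moreover have "\<forall>\<^sub>F b in at a within S. b \<in> ball a r"
      by (rule eventually_mono[OF eventually_at_ball[OF r(1)]]) simp
    ultimately show "\<forall>\<^sub>F b in at a within S. cv a = cv b" by (auto elim: eventually_mono)
  qed
  moreover have "cv x0" using lim by (auto simp: cv_def convergent_def)
  ultimately have cv: "cv x" if "x \<in> S" for x using that by blast
  show ?thesis
  proof (intro exI[of _ "\<lambda>x. lim (\<lambda>n. f n x)"] ballI conjI)
    fix x assume x: "x \<in> S"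
    show "(\<lambda>n. f n x) \<longlonglongrightarrow> lim (\<lambda>n. f n x)" using cv[OF x] by (simp add: cv_def convergent_LIMSEQ_iff)
    obtain r where r: "r > 0" "ball x r \<subseteq> S"
      "\<And>e. e > 0 \<Longrightarrow> \<forall>\<^sub>F n in sequentially. \<forall>y\<in>ball x r. \<forall>h. norm (f' n y h - g' y h) \<le> e * norm h"
      using loc[OF x] by blast
    obtain g where g: "\<And>y. y \<in> ball x r \<Longrightarrow> (\<lambda>n. f n y) \<longlonglongrightarrow> g y"
      "\<And>y. y \<in> ball x r \<Longrightarrow> (g has_derivative g' y) (at y within ball x r)"
      using ball[OF r(2,3) _ cv[OF x]] centre_in_ball r(1) by metis
    have "(g has_derivative g' x) (at x)"
      using g(2)[of x] r(1) by (simp add: at_within_open[OF _ open_ball])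
    then show "((\<lambda>x. lim (\<lambda>n. f n x)) has_derivative g' x) (at x)"
      by (rule has_derivative_transform_within_open[OF _ open_ball[of x r]])
         (use r(1) limI[OF g(1)] in auto)
  qed
qed

lemma norm_unitary_le:
  fixes A :: "complex^'n^'n"
  assumes "A ** adj A = mat 1"
  shows "norm A \<le> real CARD('n)"
proof -
  have "norm (A $ i) = 1" for i
  proof -
    have "(\<Sum>k\<in>UNIV. A $ i $ k * cnj (A $ i $ k)) = 1"
      using arg_cong[OF assms, of "\<lambda>B. B $ i $ i"] by (simp add: matrix_matrix_mult_def mat_def)
    then have "complex_of_real (\<Sum>k\<in>UNIV. (cmod (A $ i $ k))\<^sup>2) = 1"
      by (simp add: complex_norm_square del: of_real_power)
    then have "(\<Sum>k\<in>UNIV. (cmod (A $ i $ k))\<^sup>2) = 1" using of_real_eq_1_iff by blast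
    then show ?thesis by (simp add: norm_vec_def L2_set_def)
  qed
  moreover have "norm A \<le> (\<Sum>i\<in>UNIV. norm (A $ i))"
    unfolding norm_vec_def by (rule L2_set_le_sum) auto
  ultimately show ?thesis by simp
qed

lemma bounded_linear_diag_form: "bounded_linear diag_form"
  by (auto simp: linear_conv_bounded_linear [symmetric] vec_eq_iff scaleR_conv_of_real[where 'a=complex] intro!: linearI)

lemma norm_sandwich_le:
  obtains K where "K > 0"
    "\<And>(A::complex^'n^'n) v B. norm (\<i> *\<^sub>m (A ** diag_form v ** B)) \<le> K * norm A * norm B * norm v"
proof -
  have "\<exists>K>0. \<forall>(A::complex^'n^'n) (B::complex^'n^'n). norm (A ** B) \<le> norm A * norm B * K"
    by (rule bounded_bilinear.pos_bounded[OF bounded_bilinear_matrix_mult])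
  then obtain K1 where K1: "K1 > 0" "\<And>(A::complex^'n^'n) (B::complex^'n^'n). norm (A ** B) \<le> norm A * norm B * K1"
    by blast
  obtain K2 where K2: "K2 > 0" "\<And>v::real^'n. norm (diag_form v) \<le> norm v * K2"
    using bounded_linear.pos_bounded[OF bounded_linear_diag_form] by metis
  obtain K3 where K3: "K3 > 0" "\<And>A::complex^'n^'n. norm (\<i> *\<^sub>m A) \<le> norm A * K3"
    using bounded_linear.pos_bounded[OF bounded_linear_cscale] by metis
  show ?thesis
  proof
    show "K1 * K1 * K2 * K3 > 0" using K1 K2 K3 by simp
    fix A B :: "complex^'n^'n" and v :: "real^'n"
    have "norm (\<i> *\<^sub>m (A ** diag_form v ** B)) \<le> norm (A ** diag_form v ** B) * K3" by (rule K3)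
    also have "\<dots> \<le> (norm (A ** diag_form v) * norm B * K1) * K3"
      using K1(2)[of "A ** diag_form v" B] K3(1) by (intro mult_right_mono) auto
    also have "\<dots> \<le> ((norm A * norm (diag_form v) * K1) * norm B * K1) * K3"
      using K1 K3(1) by (intro mult_right_mono) auto
    also have "\<dots> \<le> ((norm A * (norm v * K2) * K1) * norm B * K1) * K3"
      using K1 K3(1) K2 by (intro mult_right_mono mult_left_mono) auto
    finally show "norm (\<i> *\<^sub>m (A ** diag_form v ** B)) \<le> K1 * K1 * K2 * K3 * norm A * norm B * norm v"
      by (simp add: ac_simps)
  qed
qed

text \<open>The commutator parts of the two connection forms cancel, and only the spectral term remains.\<close>

lemma has_derivative_frame_quotient:
  assumes F: "solves_frame_on S b \<mu> F" and G: "solves_frame_on S b 0 G"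
    and b: "\<And>u. u \<in> S \<Longrightarrow> adj (b u) = b u" and u: "u \<in> S"
  shows "((\<lambda>u. F u ** adj (G u)) has_derivative (\<lambda>v. F u ** ((\<i> * \<mu>) *\<^sub>m diag_form v) ** adj (G u))) (at u)"
proof -
  have "((\<lambda>u. F u ** adj (G u)) has_derivative
      (\<lambda>v. F u ** adj (G u ** conn_form (b u) 0 v) + F u ** conn_form (b u) \<mu> v ** adj (G u))) (at u)"
    by (intro has_derivative_matrix_mult has_derivative_adj solves_frame_onD[OF F u] solves_frame_onD[OF G u])
  moreover have "F u ** adj (G u ** conn_form (b u) 0 v) + F u ** conn_form (b u) \<mu> v ** adj (G u)
      = F u ** (conn_form (b u) \<mu> v - conn_form (b u) 0 v) ** adj (G u)" for v
    by (simp add: adj_mult adj_conn_form b[OF u] matrix_expand)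
  moreover have "conn_form (b u) \<mu> v - conn_form (b u) 0 v = (\<i> * \<mu>) *\<^sub>m diag_form v" for v
    by (simp add: conn_form_def)
  ultimately show ?thesis by simp
qed

text \<open>The quotients \<open>K\<^sub>\<mu> = F(\<mu>) F(0)\<^sup>-\<^sup>1\<close> have derivative \<open>i \<mu> F(\<mu>) \<delta> F(0)\<^sup>-\<^sup>1\<close>.  For real \<open>\<mu>\<close> the frames are
  unitary, so this derivative is of size \<open>\<mu>\<close> and \<open>K\<^sub>\<mu>\<close> tends to \<open>1\<close> locally uniformly as \<open>\<mu>\<close> tends to
  zero.  Hence the derivatives of \<open>(K\<^sub>\<mu> - 1) / \<mu>\<close> converge locally uniformly to \<open>i F(0) \<delta> F(0)\<^sup>-\<^sup>1\<close>, and
  the limit of these functions is a potential.  It is the derivative of the frame in the spectral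
  parameter at zero.\<close>

lemma frame_form_exact:
  fixes F :: "real^'n \<Rightarrow> complex \<Rightarrow> complex^'n^'n"
  assumes S: "open S" "connected S" "x0 \<in> S"
    and F: "\<And>\<mu>::real. solves_frame_on S b \<mu> (\<lambda>u. F u \<mu>)"
    and b: "\<And>u. u \<in> S \<Longrightarrow> adj (b u) = b u"
    and unit: "\<And>u \<mu>. u \<in> S \<Longrightarrow> F u (complex_of_real \<mu>) ** adj (F u \<mu>) = mat 1"
    and x0: "\<And>\<mu>. F x0 (complex_of_real \<mu>) = mat 1"
  shows "\<exists>\<Phi>. \<forall>u\<in>S. (\<Phi> has_derivative (\<lambda>v. F u 0 ** diag_form v ** adj (F u 0))) (at u)"
proof -
  define m where "m n = inverse (real (Suc n))" for n
  define T where "T n u v = \<i> *\<^sub>m (F u (complex_of_real (m n)) ** diag_form v ** adj (F u 0))" for n u v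
  define K where "K n u = F u (complex_of_real (m n)) ** adj (F u 0)" for n u
  define N where "N = real CARD('n)"
  have m: "m n > 0" "m \<longlonglongrightarrow> 0" for n
    unfolding m_def using LIMSEQ_inverse_real_of_nat by auto
  obtain C where C: "C > 0" "\<And>(A::complex^'n^'n) v B. norm (\<i> *\<^sub>m (A ** diag_form v ** B)) \<le> C * norm A * norm B * norm v"
    using norm_sandwich_le by blast
  have unit0: "F u 0 ** adj (F u 0) = mat 1" "adj (F u 0) ** F u 0 = mat 1" if "u \<in> S" for u
    using unit[OF that, of 0] matrix_left_right_inverse by auto
  have norm_F: "norm (F u (complex_of_real \<mu>)) \<le> N" if "u \<in> S" for u \<mu>
    unfolding N_def by (rule norm_unitary_le[OF unit[OF that]])
  have norm_F0: "norm (F u 0) \<le> N" "norm (adj (F u 0)) \<le> N" if "u \<in> S" for u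
    using norm_F[OF that, of 0] norm_unitary_le[of "adj (F u 0)"] unit0[OF that] by (auto simp: N_def)
  have N: "N \<ge> 0" by (simp add: N_def)
  have norm_T: "norm (T n u v) \<le> C * N * N * norm v" if "u \<in> S" for n u v
  proof -
    have "norm (T n u v) \<le> C * norm (F u (complex_of_real (m n))) * norm (adj (F u 0)) * norm v"
      unfolding T_def by (rule C)
    also have "\<dots> \<le> C * N * N * norm v"
      using C(1) norm_F[OF that] norm_F0[OF that] N by (intro mult_mono) auto
    finally show ?thesis .
  qed
  have dK: "(K n has_derivative (\<lambda>v. m n *\<^sub>R T n u v)) (at u)" if u: "u \<in> S" for n u
  proof -
    have F0: "solves_frame_on S b 0 (\<lambda>u. F u 0)" using F[of 0] by simp
    have "F u (complex_of_real (m n)) ** ((\<i> * m n) *\<^sub>m diag_form v) ** adj (F u 0) = m n *\<^sub>R T n u v" for v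
      by (simp add: T_def matrix_expand mult.commute) (simp add: vec_eq_iff scaleR_conv_of_real[where 'a=complex])
    then show ?thesis
      using has_derivative_frame_quotient[OF F[of "m n"] F0 b u] unfolding K_def by (simp only:)
  qed
  have x0': "F x0 0 = mat 1" using x0[of 0] by simp
  have ballS: "\<exists>r>0. ball x r \<subseteq> S" if "x \<in> S" for x using S(1) that open_contains_ball by blast
  \<comment> \<open>The derivatives tend to zero uniformly, so the limit of \<open>K\<close> is the constant \<open>1\<close>.\<close>
  have "\<exists>g. \<forall>x\<in>S. (\<lambda>n. K n x) \<longlonglongrightarrow> g x \<and> (g has_derivative (\<lambda>v. 0)) (at x)"
  proof (rule has_derivative_sequence_connected[OF S, of K "mat 1"])
    show "(\<lambda>n. K n x0) \<longlonglongrightarrow> mat 1" by (simp add: K_def x0 x0')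
    show "(K n has_derivative (\<lambda>v. m n *\<^sub>R T n x v)) (at x)" if "x \<in> S" for n x by (rule dK[OF that])
    fix x assume "x \<in> S"
    then obtain r where r: "r > 0" "ball x r \<subseteq> S" using ballS by blast
    have "\<forall>\<^sub>F n in sequentially. \<forall>y\<in>ball x r. \<forall>h. norm (m n *\<^sub>R T n y h - 0) \<le> e * norm h" if "e > 0" for e
    proof -
      have "(\<lambda>n. m n * (C * N * N)) \<longlonglongrightarrow> 0" using tendsto_mult_left_zero[OF m(2)] .
      then have "\<forall>\<^sub>F n in sequentially. m n * (C * N * N) < e" using that order_tendstoD(2) by blast
      then show ?thesis
      proof eventually_elim
        case (elim n)
        show ?case
        proof (intro ballI allI)
          fix y h assume "y \<in> ball x r"
          then have "norm (m n *\<^sub>R T n y h) \<le> m n * (C * N * N * norm h)"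
            using m(1)[of n] norm_T[of y n h] r(2) by (auto intro!: mult_left_mono)
          also have "\<dots> \<le> e * norm h" using mult_right_mono[OF less_imp_le[OF elim], of "norm h"] by (simp add: ac_simps)
          finally show "norm (m n *\<^sub>R T n y h - 0) \<le> e * norm h" by simp
        qed
      qed
    qed
    with r show "\<exists>r>0. ball x r \<subseteq> S \<and> (\<forall>e>0. \<forall>\<^sub>F n in sequentially. \<forall>y\<in>ball x r. \<forall>h. norm (m n *\<^sub>R T n y h - 0) \<le> e * norm h)"
      by blast
  qed
  then obtain g where g: "\<And>x. x \<in> S \<Longrightarrow> (\<lambda>n. K n x) \<longlonglongrightarrow> g x" "\<And>x. x \<in> S \<Longrightarrow> (g has_derivative (\<lambda>v. 0)) (at x)"
    by blast
  have "g x = mat 1" if "x \<in> S" for x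
  proof -
    have "g x = g x0" by (rule has_derivative_zero_unique_connected[OF S(1,2) g(2) that S(3)])
    moreover have "g x0 = mat 1"
      by (rule LIMSEQ_unique[OF g(1)[OF S(3)]]) (simp add: K_def x0 x0')
    ultimately show ?thesis by simp
  qed
  with g(1) have K_lim: "(\<lambda>n. K n x) \<longlonglongrightarrow> mat 1" if "x \<in> S" for x using that by metis
  define M where "M n u = (1 / m n) *\<^sub>R (K n u - mat 1)" for n u
  have dM: "(M n has_derivative T n u) (at u)" if "u \<in> S" for n u
  proof -
    have "(M n has_derivative (\<lambda>v. (1 / m n) *\<^sub>R (m n *\<^sub>R T n u v - 0))) (at u)"
      unfolding M_def by (intro has_derivative_scaleR_right has_derivative_diff dK[OF that] has_derivative_const)
    then show ?thesis using m(1)[of n] by simp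
  qed
  \<comment> \<open>On a ball, \<open>F(\<mu>) - F(0) = (K - 1) F(0)\<close> is uniformly small by the mean value bound for \<open>K\<close>.\<close>
  have "\<exists>g. \<forall>x\<in>S. (\<lambda>n. M n x) \<longlonglongrightarrow> g x \<and> (g has_derivative (\<lambda>v. \<i> *\<^sub>m (F x 0 ** diag_form v ** adj (F x 0)))) (at x)"
  proof (rule has_derivative_sequence_connected[OF S, of M 0])
    show "(\<lambda>n. M n x0) \<longlonglongrightarrow> 0" by (simp add: M_def K_def x0 x0')
    show "(M n has_derivative T n x) (at x)" if "x \<in> S" for n x by (rule dM[OF that])
    fix x assume x: "x \<in> S"
    then obtain r where r: "r > 0" "ball x r \<subseteq> S" using ballS by blast
    have K_bound: "norm (K n y - mat 1) \<le> norm (K n x - mat 1) + m n * (C * N * N * r)"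
      if y: "y \<in> ball x r" for n y
    proof -
      have "norm (K n y - K n x) \<le> m n * (C * N * N) * norm (y - x)"
      proof (rule differentiable_bound[of "ball x r"])
        show "(K n has_derivative (\<lambda>v. m n *\<^sub>R T n w v)) (at w within ball x r)" if "w \<in> ball x r" for w
          by (rule has_derivative_at_withinI[OF dK]) (use r(2) that in blast)
        show "onorm (\<lambda>v. m n *\<^sub>R T n w v) \<le> m n * (C * N * N)" if "w \<in> ball x r" for w
        proof (rule onorm_le)
          show "norm (m n *\<^sub>R T n w v) \<le> m n * (C * N * N) * norm v" for v
            using m(1)[of n] norm_T[of w n v] r(2) that
            by (auto simp: mult.assoc intro!: mult_left_mono)
        qed
      qed (use y r in auto)
      also have "\<dots> \<le> m n * (C * N * N) * r"
        using y m(1)[of n] C(1) N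
        by (intro mult_left_mono) (auto simp: dist_norm norm_minus_commute)
      finally have "norm (K n y - K n x) \<le> m n * (C * N * N * r)" by (simp add: ac_simps)
      then show ?thesis
        using norm_triangle_ineq[of "K n y - K n x" "K n x - mat 1"] by simp
    qed
    have "\<forall>\<^sub>F n in sequentially. \<forall>y\<in>ball x r. \<forall>h.
        norm (T n y h - \<i> *\<^sub>m (F y 0 ** diag_form h ** adj (F y 0))) \<le> e * norm h" if e: "e > 0" for e
    proof -
      have "\<exists>K>0. \<forall>(A::complex^'n^'n) (B::complex^'n^'n). norm (A ** B) \<le> norm A * norm B * K"
        by (rule bounded_bilinear.pos_bounded[OF bounded_bilinear_matrix_mult])
      then obtain K1 where K1: "K1 > 0" "\<And>(A::complex^'n^'n) (B::complex^'n^'n). norm (A ** B) \<le> norm A * norm B * K1"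
        by blast
      have "(\<lambda>n. C * ((norm (K n x - mat 1) + m n * (C * N * N * r)) * N * K1) * N) \<longlonglongrightarrow>
          C * ((norm (mat 1 - mat 1 :: complex^'n^'n) + 0 * (C * N * N * r)) * N * K1) * N"
        by (intro tendsto_intros K_lim[OF x] m(2))
      then have "\<forall>\<^sub>F n in sequentially. C * ((norm (K n x - mat 1) + m n * (C * N * N * r)) * N * K1) * N < e"
        using e by (intro order_tendstoD(2)) auto
      then show ?thesis
      proof eventually_elim
        case (elim n)
        show ?case
        proof (intro ballI allI)
          fix y h assume y: "y \<in> ball x r"
          then have yS: "y \<in> S" using r(2) by auto
          have "K n y ** F y 0 = F y (complex_of_real (m n))"
            unfolding K_def by (simp add: matrix_mul_assoc[symmetric] unit0[OF yS])
          then have "T n y h - \<i> *\<^sub>m (F y 0 ** diag_form h ** adj (F y 0))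
             = \<i> *\<^sub>m (((K n y - mat 1) ** F y 0) ** diag_form h ** adj (F y 0))"
            by (simp add: T_def matrix_diff_rdistrib cscale_diff_right)
          then have "norm (T n y h - \<i> *\<^sub>m (F y 0 ** diag_form h ** adj (F y 0)))
             \<le> C * norm ((K n y - mat 1) ** F y 0) * norm (adj (F y 0)) * norm h"
            using C(2) by simp
          also have "\<dots> \<le> C * ((norm (K n x - mat 1) + m n * (C * N * N * r)) * N * K1) * N * norm h"
          proof -
            have B: "0 \<le> norm (K n x - mat 1) + m n * (C * N * N * r)"
              using N m(1)[of n] C(1) r(1) by simp
            have "norm ((K n y - mat 1) ** F y 0) \<le> norm (K n y - mat 1) * norm (F y 0) * K1"
              by (rule K1)
            also have "\<dots> \<le> (norm (K n x - mat 1) + m n * (C * N * N * r)) * N * K1"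
              using K_bound[OF y] norm_F0(1)[OF yS] K1(1) N B
              by (intro mult_right_mono mult_mono) simp_all
            finally show ?thesis
              using norm_F0(2)[OF yS] C(1) N B K1(1)
              by (intro mult_right_mono[OF mult_mono[OF mult_left_mono]]) simp_all
          qed
          also have "\<dots> \<le> e * norm h" using elim by (intro mult_right_mono) auto
          finally show "norm (T n y h - \<i> *\<^sub>m (F y 0 ** diag_form h ** adj (F y 0))) \<le> e * norm h" .
        qed
      qed
    qed
    with r show "\<exists>r>0. ball x r \<subseteq> S \<and> (\<forall>e>0. \<forall>\<^sub>F n in sequentially. \<forall>y\<in>ball x r. \<forall>h.
        norm (T n y h - \<i> *\<^sub>m (F y 0 ** diag_form h ** adj (F y 0))) \<le> e * norm h)"
      by blast
  qed
  then obtain g where g: "\<And>x. x \<in> S \<Longrightarrow> (g has_derivative (\<lambda>v. \<i> *\<^sub>m (F x 0 ** diag_form v ** adj (F x 0)))) (at x)"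
    by blast
  have "((\<lambda>u. (- \<i>) *\<^sub>m g u) has_derivative (\<lambda>v. F x 0 ** diag_form v ** adj (F x 0))) (at x)" if "x \<in> S" for x
    using has_derivative_cscale[OF g[OF that], of "- \<i>"] by (simp add: cscale_cscale)
  then show ?thesis by blast
qed

section \<open>Metrics and immersions of a real unitary frame\<close>

definition hprod :: "complex^'n \<Rightarrow> complex^'n \<Rightarrow> complex"
  where "hprod x y = (\<Sum>i\<in>UNIV. cnj (x $ i) * y $ i)"

lemma inner_eq_hprod: "x \<bullet> y = Re (hprod x y)"
  by (simp add: hprod_def inner_vec_def inner_complex_def)

lemma symplectic_form_eq_hprod: "symplectic_form x y = Im (hprod x y)"
  by (simp add: symplectic_form_def hprod_def)

lemma hprod_mult_right: "hprod x (A *v y) = hprod (adj A *v x) y"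
proof -
  have "hprod x (A *v y) = (\<Sum>i\<in>UNIV. \<Sum>j\<in>UNIV. cnj (x $ i) * (A $ i $ j * y $ j))"
    by (simp add: hprod_def matrix_vector_mult_def sum_distrib_left)
  also have "\<dots> = (\<Sum>j\<in>UNIV. \<Sum>i\<in>UNIV. cnj (x $ i) * (A $ i $ j * y $ j))"
    by (rule sum.swap)
  also have "\<dots> = hprod (adj A *v x) y"
    by (simp add: hprod_def matrix_vector_mult_def sum_distrib_left sum_distrib_right ac_simps)
  finally show ?thesis .
qed

lemma hprod_unitary:
  assumes "adj A ** A = mat 1" shows "hprod (A *v x) (A *v y) = hprod x y"
  using assms by (simp add: hprod_mult_right matrix_vector_mul_assoc)

lemma norm_unitary:
  assumes "adj A ** A = mat 1" shows "norm (A *v x) = norm x"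
  using hprod_unitary[OF assms, of x x] by (simp add: norm_eq_sqrt_inner inner_eq_hprod)

lemma norm_smult_complex: "norm (a *s (x :: complex^'n)) = cmod a * norm x"
  by (simp add: norm_vec_def norm_mult L2_set_right_distrib)

lemma complex_vec_nth [simp]: "complex_vec c $ i = complex_of_real (c $ i)"
  by (simp add: complex_vec_def)

lemma bounded_linear_complex_vec: "bounded_linear complex_vec"
  by (auto simp: linear_conv_bounded_linear [symmetric] vec_eq_iff scaleR_conv_of_real[where 'a=complex] intro!: linearI)

lemma diag_form_mult_vec: "diag_form v *v x = (\<chi> i. complex_of_real (v $ i) * x $ i)"
proof -
  have "(diag_form v *v x) $ i = (\<Sum>j\<in>UNIV. if i = j then complex_of_real (v $ j) * x $ j else 0)" for i
    unfolding matrix_vector_mult_def diag_form_def by (auto intro!: sum.cong simp del: sum.delta sum.delta')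
  then show ?thesis by (simp add: vec_eq_iff)
qed

lemma hprod_diag_form_complex_vec:
  "hprod (diag_form v *v complex_vec h) (diag_form w *v complex_vec h) = complex_of_real (\<Sum>i\<in>UNIV. v $ i * w $ i * (h $ i)\<^sup>2)"
  by (simp add: hprod_def diag_form_mult_vec power2_eq_square ac_simps)

text \<open>These are the properties of a frame from which the geometry follows: unitarity makes the maps
  below isometric and Lagrangian immersions into spheres, and reality at parameter zero makes
  \<open>F(u, 0)\<^sup>-\<^sup>1 c\<close> a real vector of Lame coefficients.\<close>

locale real_unitary_frame =
  fixes S :: "(real^'n) set" and b :: "real^'n \<Rightarrow> complex^'n^'n"
    and F :: "real^'n \<Rightarrow> complex \<Rightarrow> complex^'n^'n" and c :: "real^'n"
  assumes S: "open S" "connected S" "0 \<in> S"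
    and F: "\<And>\<mu>::real. solves_frame_on S b \<mu> (\<lambda>u. F u \<mu>)"
    and b: "\<And>u. u \<in> S \<Longrightarrow> adj (b u) = b u" and smooth_b: "smooth_on S b"
    and unit: "\<And>u \<mu>. u \<in> S \<Longrightarrow> F u (complex_of_real \<mu>) ** adj (F u \<mu>) = mat 1"
    and real_at_0: "\<And>u. u \<in> S \<Longrightarrow> conj_mat (F u 0) = F u 0"
    and F_0: "\<And>\<mu>. F 0 (complex_of_real \<mu>) = mat 1"
begin

lemma F_at_0: "solves_frame_on S b 0 (\<lambda>u. F u 0)"
  using F[of 0] by simp

lemma unit': "u \<in> S \<Longrightarrow> adj (F u (complex_of_real \<mu>)) ** F u \<mu> = mat 1"
  using unit[of u \<mu>] matrix_left_right_inverse by blast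

lemma unit_0: "u \<in> S \<Longrightarrow> F u 0 ** adj (F u 0) = mat 1" "u \<in> S \<Longrightarrow> adj (F u 0) ** F u 0 = mat 1"
  using unit[of u 0] unit'[of u 0] by auto

definition R :: "real^'n \<Rightarrow> real^'n^'n" where "R u = (\<chi> i j. Re (F u 0 $ i $ j))"
definition rot :: "real^'n \<Rightarrow> real^'n^'n" where "rot u = (\<chi> i j. if i = j then 0 else Re (b u $ i $ j))"
definition lame :: "real^'n \<Rightarrow> real^'n" where "lame u = (\<chi> k. \<Sum>a\<in>UNIV. R u $ a $ k * c $ a)"

lemma F_at_0_nth: "u \<in> S \<Longrightarrow> F u 0 $ i $ j = complex_of_real (R u $ i $ j)"
  using arg_cong[OF real_at_0[of u], of "\<lambda>A. Im (A $ i $ j)"] by (simp add: R_def complex_eq_iff)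

lemma complex_vec_lame: "u \<in> S \<Longrightarrow> complex_vec (lame u) = adj (F u 0) *v complex_vec c"
  by (simp add: vec_eq_iff lame_def matrix_vector_mult_def F_at_0_nth)

text \<open>As \<open>F\<close> is real at parameter zero, so is its logarithmic derivative \<open>[\<delta>, b]\<close>, whose entries are,
  up to sign, the off-diagonal entries of \<open>b\<close>.\<close>

lemma b_offdiag:
  assumes u: "u \<in> S" and ij: "i \<noteq> j"
  shows "b u $ i $ j = complex_of_real (rot u $ i $ j)"
proof -
  note dF = solves_frame_onD[OF F_at_0 u]
  have "((\<lambda>u. F u 0) has_derivative (\<lambda>v. conj_mat (F u 0 ** conn_form (b u) 0 v))) (at u)"
    by (rule has_derivative_transform_within_open[OF has_derivative_conj[OF dF] S(1) u])
       (simp add: real_at_0)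
  with dF have "F u 0 ** conn_form (b u) 0 v = conj_mat (F u 0 ** conn_form (b u) 0 v)" for v
    by (metis has_derivative_unique)
  then have "F u 0 ** conn_form (b u) 0 v = F u 0 ** conj_mat (conn_form (b u) 0 v)" for v
    by (simp add: conj_mult real_at_0[OF u])
  then have "conn_form (b u) 0 v = conj_mat (conn_form (b u) 0 v)" for v
    using unit_0(2)[OF u] by (metis matrix_mul_assoc matrix_mul_lid)
  from arg_cong[OF this[of "axis i 1"], of "\<lambda>A. Im (A $ i $ j)"] ij
  have "Im (b u $ i $ j) = 0" by (simp add: conn_form_nth axis_def)
  with ij show ?thesis by (simp add: rot_def complex_eq_iff)
qed

lemma rot_sym:
  assumes "u \<in> S" "i \<noteq> j" shows "rot u $ i $ j = rot u $ j $ i"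
  using arg_cong[OF b[OF assms(1)], of "\<lambda>A. Re (A $ i $ j)"] assms(2) by (simp add: rot_def)

lemma smooth_F: "smooth_on S (\<lambda>u. F u (complex_of_real \<mu>))"
  by (rule solves_frame_smooth[OF S(1) F smooth_b])

lemma smooth_R: "smooth_on S (\<lambda>u. R u $ i $ j)"
proof -
  have "smooth_on S (\<lambda>u. F u 0 $ i $ j)"
    using smooth_F[of 0] by (simp add: smooth_on_vec_iff[OF S(1)])
  then have "smooth_on S (\<lambda>u. Re (F u 0 $ i $ j))"
    by (rule smooth_on_bounded_linear[OF bounded_linear_Re S(1)])
  then show ?thesis by (simp add: R_def)
qed

lemma smooth_rot: "smooth_on S rot"
proof -
  have "smooth_on S (\<lambda>u. b u $ i $ j)" for i j
    using smooth_b by (simp add: smooth_on_vec_iff[OF S(1)])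
  then have "smooth_on S (\<lambda>u. Re (b u $ i $ j))" for i j
    by (rule smooth_on_bounded_linear[OF bounded_linear_Re S(1)])
  then have "smooth_on S (\<lambda>u. if i = j then 0 else Re (b u $ i $ j))" for i j
    by (cases "i = j") (auto intro: smooth_on_const)
  then show ?thesis by (simp add: smooth_on_vec_iff[OF S(1)] rot_def)
qed

lemma partial_R:
  assumes u: "u \<in> S"
  shows "partial i (\<lambda>v. R v $ a $ l) u =
    (\<Sum>m\<in>UNIV. R u $ a $ m * ((of_bool (m = i) - of_bool (l = i)) * rot u $ m $ l))"
proof -
  have "((\<lambda>v. Re (F v 0 $ a $ l)) has_derivative (\<lambda>v. Re ((F u 0 ** conn_form (b u) 0 v) $ a $ l))) (at u)"
    by (intro bounded_linear.has_derivative[OF bounded_linear_Re]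
        bounded_linear.has_derivative[OF bounded_linear_vec_nth] solves_frame_onD[OF F_at_0 u])
  from partial_eqI[OF this] have "partial i (\<lambda>v. R v $ a $ l) u =
      Re (\<Sum>m\<in>UNIV. F u 0 $ a $ m * conn_form (b u) 0 (axis i 1) $ m $ l)"
    by (simp add: R_def matrix_matrix_mult_def)
  also have "(\<Sum>m\<in>UNIV. F u 0 $ a $ m * conn_form (b u) 0 (axis i 1) $ m $ l) =
      (\<Sum>m\<in>UNIV. complex_of_real (R u $ a $ m * ((of_bool (m = i) - of_bool (l = i)) * rot u $ m $ l)))"
  proof (rule sum.cong)
    fix m
    have "conn_form (b u) 0 (axis i 1) $ m $ l = complex_of_real ((of_bool (m = i) - of_bool (l = i)) * rot u $ m $ l)"
    proof (cases "m = l")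
      case True then show ?thesis by (simp add: conn_form_nth rot_def)
    next
      case False then show ?thesis by (auto simp: conn_form_nth b_offdiag[OF u] axis_def)
    qed
    then show "F u 0 $ a $ m * conn_form (b u) 0 (axis i 1) $ m $ l =
        complex_of_real (R u $ a $ m * ((of_bool (m = i) - of_bool (l = i)) * rot u $ m $ l))"
      by (simp add: F_at_0_nth[OF u])
  qed simp
  finally show ?thesis by (simp only: of_real_sum[symmetric] Re_complex_of_real)
qed

lemma smooth_lame: "smooth_on S (\<lambda>u. lame u $ k)"
  unfolding lame_def
  using smooth_R by (auto simp: smooth_on_def intro!: Ck_on_sum[OF S(1)] Ck_on_const
      Ck_on_bilinear[OF bounded_bilinear_mult S(1)])

lemma partial_lame:
  assumes u: "u \<in> S"
  shows "partial i (\<lambda>v. lame v $ k) u =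
    (\<Sum>m\<in>UNIV. (of_bool (m = i) - of_bool (k = i)) * rot u $ m $ k * lame u $ m)"
proof -
  have dR: "(\<lambda>v. R v $ a $ l) differentiable (at u)" for a l
    by (rule smooth_on_differentiable[OF smooth_R u])
  have "partial i (\<lambda>v. lame v $ k) u = partial i (\<lambda>v. \<Sum>a\<in>UNIV. R v $ a $ k * c $ a) u"
    by (simp add: lame_def)
  also have "\<dots> = (\<Sum>a\<in>UNIV. partial i (\<lambda>v. R v $ a $ k) u * c $ a)"
    using dR by (subst partial_sum)
      (auto intro!: differentiable_mult
        simp: partial_mult[OF dR differentiable_const] partial_eqI[OF has_derivative_const])
  also have "\<dots> = (\<Sum>a\<in>UNIV. \<Sum>m\<in>UNIV. R u $ a $ m * ((of_bool (m = i) - of_bool (k = i)) * rot u $ m $ k) * c $ a)"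
    by (simp add: partial_R[OF u] sum_distrib_right)
  also have "\<dots> = (\<Sum>m\<in>UNIV. \<Sum>a\<in>UNIV. R u $ a $ m * ((of_bool (m = i) - of_bool (k = i)) * rot u $ m $ k) * c $ a)"
    by (rule sum.swap)
  also have "\<dots> = (\<Sum>m\<in>UNIV. (of_bool (m = i) - of_bool (k = i)) * rot u $ m $ k * lame u $ m)"
    by (simp add: lame_def sum_distrib_left ac_simps)
  finally show ?thesis .
qed

lemma partial_lame_offdiag:
  assumes u: "u \<in> S" and ik: "i \<noteq> k"
  shows "partial i (\<lambda>v. lame v $ k) u = rot u $ k $ i * lame u $ i"
proof -
  have "partial i (\<lambda>v. lame v $ k) u = (\<Sum>m\<in>UNIV. if m = i then rot u $ m $ k * lame u $ m else 0)"
    unfolding partial_lame[OF u] using ik by (intro sum.cong) auto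
  then show ?thesis using rot_sym[OF u ik] by simp
qed

text \<open>Summing \<open>\<partial>\<^sub>i h = - [\<delta>\<^sub>i, b] h\<close> over \<open>i\<close> gives zero, since the \<open>\<delta>\<^sub>i\<close> add up to the identity.\<close>

lemma d_invariant_lame: "d_invariant_on S lame"
  unfolding d_invariant_on_def
proof (intro ballI allI)
  fix u k assume u: "u \<in> S"
  have "(\<Sum>i\<in>UNIV. partial i (\<lambda>v. lame v $ k) u) =
      (\<Sum>m\<in>UNIV. (\<Sum>i\<in>UNIV. of_bool (m = i) - of_bool (k = i)) * rot u $ m $ k * lame u $ m)"
    unfolding partial_lame[OF u] by (subst sum.swap) (simp add: sum_distrib_right)
  moreover have "(\<Sum>i\<in>UNIV. of_bool (m = i) - of_bool (k = i)) = (0::real)" for m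
    by (simp add: sum_subtractf of_bool_def)
  ultimately show "(\<Sum>i\<in>UNIV. partial i (\<lambda>v. lame v $ k) u) = 0" by simp
qed

text \<open>For \<open>h = F(0)\<^sup>-\<^sup>1 c\<close> the form \<open>\<Sum> h\<^sub>i\<^sup>2 du\<^sub>i\<close> is \<open>h\<^sup>* \<delta> h = c\<^sup>* F(0) \<delta> F(0)\<^sup>-\<^sup>1 c\<close>, a matrix coefficient of
  the exact form \<open>F(0) \<delta> F(0)\<^sup>-\<^sup>1\<close>.\<close>

lemma lame_potential:
  "\<exists>\<phi>::real^'n \<Rightarrow> real. \<forall>u\<in>S. \<phi> differentiable (at u) \<and> (\<forall>i. partial i \<phi> u = (lame u $ i)\<^sup>2)"
proof -
  obtain \<Phi> where \<Phi>: "\<And>u. u \<in> S \<Longrightarrow> (\<Phi> has_derivative (\<lambda>v. F u 0 ** diag_form v ** adj (F u 0))) (at u)"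
    using frame_form_exact[OF S F b unit F_0] by blast
  define C where "C = complex_vec c"
  have d: "((\<lambda>u. C \<bullet> (\<Phi> u *v C)) has_derivative (\<lambda>v. C \<bullet> ((F u 0 ** diag_form v ** adj (F u 0)) *v C))) (at u)"
    if "u \<in> S" for u
    by (intro has_derivative_inner_right bounded_linear.has_derivative[OF
        bounded_bilinear.bounded_linear_left[OF bounded_bilinear_matrix_vector]] \<Phi>[OF that])
  have "C \<bullet> ((F u 0 ** diag_form (axis i 1) ** adj (F u 0)) *v C) = (lame u $ i)\<^sup>2" if u: "u \<in> S" for u i
  proof -
    have "(F u 0 ** diag_form (axis i 1) ** adj (F u 0)) *v C = F u 0 *v (diag_form (axis i 1) *v complex_vec (lame u))"
      by (simp add: matrix_vector_mul_assoc[symmetric] C_def complex_vec_lame[OF u])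
    then have "C \<bullet> ((F u 0 ** diag_form (axis i 1) ** adj (F u 0)) *v C) =
        Re (hprod (complex_vec (lame u)) (diag_form (axis i 1) *v complex_vec (lame u)))"
      by (simp add: inner_eq_hprod hprod_mult_right complex_vec_lame[OF u] C_def)
    also have "\<dots> = (\<Sum>k\<in>UNIV. if k = i then (lame u $ k)\<^sup>2 else 0)"
      unfolding hprod_def diag_form_mult_vec Re_sum by (rule sum.cong) (auto simp: axis_def power2_eq_square)
    finally show ?thesis by simp
  qed
  with d show ?thesis
    by (intro exI[of _ "\<lambda>u. C \<bullet> (\<Phi> u *v C)"]) (auto simp: differentiable_def partial_eqI[OF d])
qed

lemma flat_egoroff_lame:
  assumes U: "open U" "U \<subseteq> S" and nz: "\<And>u i. u \<in> U \<Longrightarrow> lame u $ i \<noteq> 0"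
  shows "flat_egoroff_metric_on U lame"
proof -
  have "smooth_on S lame" by (simp add: smooth_on_vec_iff[OF S(1)] smooth_lame)
  note smooth = smooth_on_subset[OF this U(2)]
  have "smooth_on S R" by (simp add: smooth_on_vec_iff[OF S(1)] smooth_R)
  note smooth_R' = smooth_on_subset[OF this U(2)]
  have inv: "(\<chi> i j. R u $ j $ i) ** R u = mat 1" if "u \<in> U" for u
  proof -
    have "u \<in> S" using that U by auto
    from arg_cong[OF unit_0(2)[OF this], of "\<lambda>A. Re (A $ i $ j)" for i j]
    have "(\<Sum>k\<in>UNIV. R u $ k $ i * R u $ k $ j) = (if i = j then 1 else 0)" for i j
      by (simp add: matrix_matrix_mult_def F_at_0_nth[OF \<open>u \<in> S\<close>] mat_def split: if_splits)
    then show ?thesis by (simp add: vec_eq_iff matrix_matrix_mult_def mat_def)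
  qed
  have "flat_metric_on U (diag_metric lame)"
    by (rule flat_diag_metric[OF U(1) smooth nz smooth_on_subset[OF smooth_rot U(2)] smooth_R'
          rot_sym partial_lame_offdiag partial_R inv]) (use U(2) in auto)
  then show ?thesis
    using smooth nz lame_potential U(2) unfolding flat_egoroff_metric_on_def by blast
qed

lemma frame_equation_lame:
  assumes U: "open U" "U \<subseteq> S" and nz: "\<And>u i. u \<in> U \<Longrightarrow> lame u $ i \<noteq> 0"
  shows "frame_equation_on U (rotation_coeffs lame) (complex_of_real \<mu>) F"
proof (rule solves_imp_frame_equation)
  show "solves_frame_on U b (complex_of_real \<mu>) (\<lambda>u. F u (complex_of_real \<mu>))"
    by (rule solves_frame_on_subset[OF F U(2)])
  fix u assume u: "u \<in> U"
  then show "adj (F u (complex_of_real \<mu>)) ** F u (complex_of_real \<mu>) = mat 1" using U(2) unit' by blast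
  fix i j :: 'n assume "i \<noteq> j"
  then show "b u $ i $ j = complex_of_real (rotation_coeffs lame u $ i $ j)"
    using b_offdiag[of u i j] partial_lame_offdiag[of u j i] nz[OF u, of j] u U(2)
    by (auto simp: rotation_coeffs_def)
qed

lemma associated_family_eq:
  assumes "u \<in> S"
  shows "associated_family F c u (complex_of_real \<mu>) = (- \<i> * inverse (complex_of_real \<mu>)) *s
    ((F u \<mu> ** adj (F u 0)) *v complex_vec c - complex_vec c)"
  by (simp add: associated_family_def matrix_inv_eqI(1)[OF unit_0(1)[OF assms]] matrix_vector_mul_assoc)

lemma has_derivative_associated_family:
  assumes u: "u \<in> S" and mu: "\<mu> \<noteq> 0"
  shows "((\<lambda>u. associated_family F c u (complex_of_real \<mu>)) has_derivative
    (\<lambda>v. F u \<mu> *v (diag_form v *v complex_vec (lame u)))) (at u)"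
proof -
  let ?s = "\<lambda>x::complex^'n. (- \<i> * inverse (complex_of_real \<mu>)) *s x"
  have lin: "bounded_linear ?s"
    by (auto simp: linear_conv_bounded_linear [symmetric] vec_eq_iff algebra_simps intro!: linearI)
  have "((\<lambda>u. ?s ((F u \<mu> ** adj (F u 0)) *v complex_vec c - complex_vec c)) has_derivative
      (\<lambda>v. ?s ((F u \<mu> ** ((\<i> * \<mu>) *\<^sub>m diag_form v) ** adj (F u 0)) *v complex_vec c - 0))) (at u)"
    by (intro bounded_linear.has_derivative[OF lin] has_derivative_diff has_derivative_const
        bounded_linear.has_derivative[OF bounded_bilinear.bounded_linear_left[OF bounded_bilinear_matrix_vector]]
        has_derivative_frame_quotient[OF F F_at_0 b u])
  moreover have "?s ((F u \<mu> ** ((\<i> * \<mu>) *\<^sub>m diag_form v) ** adj (F u 0)) *v complex_vec c - 0)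
      = F u \<mu> *v (diag_form v *v complex_vec (lame u))" for v
  proof -
    have "(F u \<mu> ** ((\<i> * \<mu>) *\<^sub>m diag_form v) ** adj (F u 0)) *v complex_vec c
        = ((\<i> * \<mu>) *\<^sub>m (F u \<mu> ** diag_form v ** adj (F u 0))) *v complex_vec c"
      by (simp add: matrix_expand)
    also have "\<dots> = (\<i> * \<mu>) *s ((F u \<mu> ** diag_form v ** adj (F u 0)) *v complex_vec c)"
      by (simp add: vec_eq_iff matrix_vector_mult_def sum_distrib_left ac_simps)
    moreover have "(- \<i> * inverse (complex_of_real \<mu>)) * (\<i> * \<mu>) = 1" using mu by (simp add: field_simps)
    ultimately show ?thesis
      by (simp only: diff_0_right vector_smult_assoc vector_smult_lid)
         (simp add: complex_vec_lame[OF u] matrix_vector_mul_assoc matrix_mul_assoc)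
  qed
  ultimately have d: "((\<lambda>u. ?s ((F u \<mu> ** adj (F u 0)) *v complex_vec c - complex_vec c)) has_derivative
      (\<lambda>v. F u \<mu> *v (diag_form v *v complex_vec (lame u)))) (at u)" by simp
  show ?thesis
    by (rule has_derivative_transform_within_open[OF d S(1) u]) (simp add: associated_family_eq)
qed

text \<open>Real values of the Hermitian product mean that the symplectic form vanishes; the values themselves
  are those of the metric.\<close>

lemma hprod_derivative_associated_family:
  assumes "u \<in> S"
  shows "hprod (F u (complex_of_real \<mu>) *v (diag_form v *v complex_vec (lame u)))
      (F u (complex_of_real \<mu>) *v (diag_form w *v complex_vec (lame u)))
    = complex_of_real (\<Sum>i\<in>UNIV. v $ i * w $ i * (lame u $ i)\<^sup>2)"
  by (simp only: hprod_unitary[OF unit'[OF assms]] hprod_diag_form_complex_vec)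

lemma induced_metric_associated_family:
  assumes u: "u \<in> S" and mu: "\<mu> \<noteq> 0"
  shows "induced_metric (\<lambda>u. associated_family F c u (complex_of_real \<mu>)) u = diag_metric lame u"
proof -
  have "induced_metric (\<lambda>u. associated_family F c u (complex_of_real \<mu>)) u $ i $ j = diag_metric lame u $ i $ j" for i j
  proof -
    have "induced_metric (\<lambda>u. associated_family F c u (complex_of_real \<mu>)) u $ i $ j
        = (\<Sum>k\<in>UNIV. axis i 1 $ k * axis j 1 $ k * (lame u $ k)\<^sup>2)"
      by (simp add: induced_metric_def partial_eqI[OF has_derivative_associated_family[OF assms]]
          inner_eq_hprod hprod_derivative_associated_family[OF u] del: of_real_sum)
    also have "\<dots> = (\<Sum>k\<in>UNIV. if k = i then (if i = j then (lame u $ k)\<^sup>2 else 0) else 0)"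
      by (rule sum.cong) (auto simp: axis_def)
    finally show ?thesis by (simp add: diag_metric_def)
  qed
  then show ?thesis by (simp add: vec_eq_iff)
qed

lemma flat_lagrangian_associated_family:
  assumes U: "open U" "U \<subseteq> S" and nz: "\<And>u i. u \<in> U \<Longrightarrow> lame u $ i \<noteq> 0" and mu: "\<mu> \<noteq> 0"
  shows "flat_lagrangian_immersion_on U (\<lambda>u. associated_family F c u (complex_of_real \<mu>))"
proof -
  let ?X = "\<lambda>u. associated_family F c u (complex_of_real \<mu>)"
  have fd: "frechet_derivative ?X (at u) = (\<lambda>v. F u \<mu> *v (diag_form v *v complex_vec (lame u)))" if "u \<in> U" for u
    using frechet_derivative_at[OF has_derivative_associated_family[OF _ mu], of u] that U(2) by auto
  have "smooth_on S ?X"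
  proof (rule smooth_on_bootstrap[OF S(1) has_derivative_associated_family[OF _ mu]])
    have "smooth_on S lame" by (simp add: smooth_on_vec_iff[OF S(1)] smooth_lame)
    then have "smooth_on S (\<lambda>u. F u (complex_of_real \<mu>) *v (diag_form v *v complex_vec (lame u)))" for v
      by (intro smooth_on_bilinear[OF bounded_bilinear_matrix_vector S(1)] smooth_F smooth_on_const
          smooth_on_bounded_linear[OF bounded_linear_complex_vec S(1)])
    then show "Ck_on k S (\<lambda>u. F u (complex_of_real \<mu>) *v (diag_form (axis j 1) *v complex_vec (lame u)))" for k j
      by (simp add: smooth_on_def)
  qed
  then have "smooth_on U ?X" by (rule smooth_on_subset[OF _ U(2)])
  moreover have "inj (frechet_derivative ?X (at u))" if u: "u \<in> U" for u
  proof (rule injI)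
    fix v w assume "frechet_derivative ?X (at u) v = frechet_derivative ?X (at u) w"
    then have "adj (F u \<mu>) *v (F u \<mu> *v (diag_form v *v complex_vec (lame u))) =
        adj (F u \<mu>) *v (F u \<mu> *v (diag_form w *v complex_vec (lame u)))"
      by (simp add: fd[OF u])
    then have "diag_form v *v complex_vec (lame u) = diag_form w *v complex_vec (lame u)"
      using unit'[of u \<mu>] u U(2) by (auto simp: matrix_vector_mul_assoc[of "adj _"])
    then show "v = w" using nz[OF u] by (simp add: vec_eq_iff diag_form_mult_vec)
  qed
  moreover have "symplectic_form (frechet_derivative ?X (at u) v) (frechet_derivative ?X (at u) w) = 0" if "u \<in> U" for u v w
    using that U(2) hprod_derivative_associated_family[of u \<mu> v w]
    by (auto simp: fd symplectic_form_eq_hprod simp del: of_real_sum)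
  moreover have "flat_metric_on U (induced_metric ?X)"
  proof (rule flat_metric_on_cong[OF U(1)])
    show "diag_metric lame u = induced_metric ?X u" if "u \<in> U" for u
      using induced_metric_associated_family[OF _ mu, of u] that U(2) by auto
    show "flat_metric_on U (diag_metric lame)"
      using flat_egoroff_lame[OF U nz] by (simp add: flat_egoroff_metric_on_def)
  qed
  ultimately show ?thesis
    by (simp add: flat_lagrangian_immersion_on_def immersion_on_def)
qed

text \<open>Up to the constant \<open>i c / \<mu>\<close> the immersion is \<open>- i / \<mu>\<close> times \<open>F(u, \<mu>) h(u)\<close>,
  which has the norm of \<open>c\<close> because both frames are unitary.\<close>

lemma associated_family_in_sphere:
  assumes u: "u \<in> S"
  shows "associated_family F c u (complex_of_real \<mu>) \<in>
    sphere ((\<i> * inverse (complex_of_real \<mu>)) *s complex_vec c) (norm (complex_vec c) / \<bar>\<mu>\<bar>)"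
proof -
  let ?Y = "F u \<mu> *v (adj (F u 0) *v complex_vec c)"
  have "associated_family F c u (complex_of_real \<mu>) - (\<i> * inverse (complex_of_real \<mu>)) *s complex_vec c
     = (- \<i> * inverse (complex_of_real \<mu>)) *s ?Y"
    unfolding associated_family_eq[OF u] by (simp add: vec_eq_iff matrix_vector_mul_assoc[symmetric] algebra_simps)
  then have "norm (associated_family F c u (complex_of_real \<mu>) - (\<i> * inverse (complex_of_real \<mu>)) *s complex_vec c)
     = norm ?Y / \<bar>\<mu>\<bar>"
    by (simp add: norm_smult_complex norm_mult norm_inverse divide_inverse)
  also have "norm ?Y = norm (complex_vec c)"
    using norm_unitary[OF unit'[OF u]] norm_unitary[of "adj (F u 0)"] unit_0[OF u] by simp
  finally show ?thesis by (simp add: dist_norm norm_minus_commute)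
qed

lemma lame_nonzero_imp: "u \<in> S \<Longrightarrow> lame u $ i \<noteq> 0 \<Longrightarrow> complex_vec c \<noteq> 0"
  by (force simp: lame_def vec_eq_iff intro: sum.neutral)

lemma new_metric_and_immersions:
  "\<exists>ht::real^'n \<Rightarrow> real^'n.
    (\<forall>u\<in>S. complex_vec (ht u) = matrix_inv (F u 0) *v complex_vec c) \<and>
    (\<forall>\<mu>::real. F 0 (complex_of_real \<mu>) = mat 1) \<and>
    (\<forall>U. open U \<and> connected U \<and> U \<subseteq> S \<and> (\<forall>u\<in>U. \<forall>i. ht u $ i \<noteq> 0) \<longrightarrow>
      flat_egoroff_metric_on U ht \<and> d_invariant_on U ht \<and>
      (\<forall>\<mu>::real. frame_equation_on U (rotation_coeffs ht) (complex_of_real \<mu>) F) \<and>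
      (\<forall>\<mu>::real. \<mu> \<noteq> 0 \<longrightarrow>
        flat_lagrangian_immersion_on U (\<lambda>u. associated_family F c u (complex_of_real \<mu>)) \<and>
        (\<forall>u\<in>U. induced_metric (\<lambda>u. associated_family F c u (complex_of_real \<mu>)) u = diag_metric ht u) \<and>
        (\<exists>a r. r > 0 \<and> (\<lambda>u. associated_family F c u (complex_of_real \<mu>)) ` U \<subseteq> sphere a r)))"
proof (intro exI[of _ lame] conjI ballI allI impI)
  show "complex_vec (lame u) = matrix_inv (F u 0) *v complex_vec c" if "u \<in> S" for u
    by (simp add: complex_vec_lame[OF that] matrix_inv_eqI(1)[OF unit_0(1)[OF that]])
  show "F 0 (complex_of_real \<mu>) = mat 1" for \<mu> by (rule F_0)
  fix U assume "open U \<and> connected U \<and> U \<subseteq> S \<and> (\<forall>u\<in>U. \<forall>i. lame u $ i \<noteq> 0)"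
  then have U: "open U" "U \<subseteq> S" and nz: "\<And>u i. u \<in> U \<Longrightarrow> lame u $ i \<noteq> 0" by auto
  show "flat_egoroff_metric_on U lame" by (rule flat_egoroff_lame[OF U nz])
  show "d_invariant_on U lame" using d_invariant_lame U(2) unfolding d_invariant_on_def by blast
  show "frame_equation_on U (rotation_coeffs lame) (complex_of_real \<mu>) F" for \<mu>
    by (rule frame_equation_lame[OF U nz])
  fix \<mu> :: real assume mu: "\<mu> \<noteq> 0"
  show "flat_lagrangian_immersion_on U (\<lambda>u. associated_family F c u (complex_of_real \<mu>))"
    by (rule flat_lagrangian_associated_family[OF U nz mu])
  show "induced_metric (\<lambda>u. associated_family F c u (complex_of_real \<mu>)) u = diag_metric lame u" if "u \<in> U" for u
    using induced_metric_associated_family[OF _ mu] that U(2) by blast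
  show "\<exists>a r. r > 0 \<and> (\<lambda>u. associated_family F c u (complex_of_real \<mu>)) ` U \<subseteq> sphere a r"
  proof (cases "U = {}")
    \<comment> \<open>The radius \<open>norm c / \<bar>\<mu>\<bar>\<close> is known to be positive only if \<open>U\<close> has a point, where \<open>h\<close> is nonzero.\<close>
    case True
    then show ?thesis by (intro exI[of _ 0] exI[of _ 1]) auto
  next
    case False
    then have "norm (complex_vec c) / \<bar>\<mu>\<bar> > 0"
      using lame_nonzero_imp nz U(2) mu by auto
    then show ?thesis using associated_family_in_sphere U(2) by blast
  qed
qed

end

section \<open>Hermitian frames and their dressing\<close>

text \<open>Frames over a set \<open>\<Lambda>\<close> of spectral parameters, since each dressing loses the parameters \<open>z\<close> and
  \<open>cnj z\<close>, and a second dressing evaluates the frame off the real line again.  The last clause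
  provides inverses.\<close>

definition hermitian_frame ::
    "(real^'n) set \<Rightarrow> (real^'n \<Rightarrow> complex^'n^'n) \<Rightarrow> complex set \<Rightarrow> (real^'n \<Rightarrow> complex \<Rightarrow> complex^'n^'n) \<Rightarrow> bool"
  where "hermitian_frame S b \<Lambda> E \<longleftrightarrow>
    (\<forall>u\<in>S. adj (b u) = b u) \<and> smooth_on S b \<and>
    (\<forall>\<mu>\<in>\<Lambda>. solves_frame_on S b \<mu> (\<lambda>u. E u \<mu>) \<and> E 0 \<mu> = mat 1 \<and>
      (\<forall>u\<in>S. E u \<mu> ** adj (E u (cnj \<mu>)) = mat 1))"

lemma hermitian_frameD:
  assumes "hermitian_frame S b \<Lambda> E"
  shows "\<And>u. u \<in> S \<Longrightarrow> adj (b u) = b u" "smooth_on S b"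
    "\<And>\<mu>. \<mu> \<in> \<Lambda> \<Longrightarrow> solves_frame_on S b \<mu> (\<lambda>u. E u \<mu>)" "\<And>\<mu>. \<mu> \<in> \<Lambda> \<Longrightarrow> E 0 \<mu> = mat 1"
    "\<And>\<mu> u. \<mu> \<in> \<Lambda> \<Longrightarrow> u \<in> S \<Longrightarrow> E u \<mu> ** adj (E u (cnj \<mu>)) = mat 1"
    "\<And>\<mu> u. \<mu> \<in> \<Lambda> \<Longrightarrow> u \<in> S \<Longrightarrow> matrix_inv (E u \<mu>) = adj (E u (cnj \<mu>))"
  using assms matrix_inv_eqI(1) unfolding hermitian_frame_def by blast+

text \<open>At the base point \<open>P\<close> is \<open>\<pi>\<close> itself, by uniqueness of projections, so the dressed frame starts
  at the identity again.  The relation between \<open>\<mu>\<close> and its conjugate survives because it holds for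
  each of the three factors.\<close>

lemma hermitian_frame_dressing:
  fixes P :: "real^'n \<Rightarrow> complex^'n^'n"
  assumes S: "open S" "0 \<in> S" and E: "hermitian_frame S b \<Lambda> E"
    and z: "z \<in> \<Lambda>" "cnj z \<in> \<Lambda>" and \<pi>: "hermitian_projection \<pi>"
    and P: "\<And>u. u \<in> S \<Longrightarrow> hermitian_projection_onto (P u) ((*v) (matrix_inv (E u z)) ` image_of \<pi>)"
    and E': "\<And>u \<mu>. u \<in> S \<Longrightarrow> E' u \<mu> = simple_factor z \<pi> \<mu> ** E u \<mu> ** matrix_inv (simple_factor z (P u) \<mu>)"
  shows "hermitian_frame S (\<lambda>u. b u + (\<i> * (z - cnj z)) *\<^sub>m P u) (\<Lambda> - {z, cnj z}) E'"
  unfolding hermitian_frame_def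
proof (intro conjI ballI)
  note ED = hermitian_frameD[OF E]
  have P': "hermitian_projection_onto (P u) ((*v) (adj (E u (cnj z))) ` image_of \<pi>)" if "u \<in> S" for u
    using P[OF that] ED(6)[OF z(1) that] by simp
  have herm: "hermitian_projection (P u)" if "u \<in> S" for u
    using P[OF that] by (simp add: hermitian_projection_onto_def)
  show "adj (b u + (\<i> * (z - cnj z)) *\<^sub>m P u) = b u + (\<i> * (z - cnj z)) *\<^sub>m P u" if "u \<in> S" for u
    using ED(1)[OF that] herm[OF that]
    by (simp add: adj_add adj_cscale hermitian_projection_adj algebra_simps)
  have "smooth_on S P"
    by (rule smooth_on_hermitian_projection_onto[OF S(1) ED(3)[OF z(1)] ED(3)[OF z(2)] ED(5)[OF z(1)] ED(1) \<pi> P' ED(2)])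
  then show "smooth_on S (\<lambda>u. b u + (\<i> * (z - cnj z)) *\<^sub>m P u)"
    by (intro smooth_on_add[OF S(1) ED(2)] smooth_on_bounded_linear[OF bounded_linear_cscale S(1)])
  fix \<mu> assume mu: "\<mu> \<in> \<Lambda> - {z, cnj z}"
  then have mu': "\<mu> \<noteq> z" "\<mu> \<noteq> cnj z" "\<mu> \<in> \<Lambda>" by auto
  have E'_eq: "E' u \<mu> = simple_factor z \<pi> \<mu> ** E u \<mu> ** simple_factor (cnj z) (P u) \<mu>" if "u \<in> S" for u
    using E'[OF that] matrix_inv_simple_factor[OF herm[OF that] mu'(1,2)] by simp
  show "solves_frame_on S (\<lambda>u. b u + (\<i> * (z - cnj z)) *\<^sub>m P u) \<mu> (\<lambda>u. E' u \<mu>)"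
    by (rule solves_frame_on_cong[OF dressed_frame_solves[OF S(1) ED(3)[OF z(1)] ED(3)[OF z(2)]
          ED(5)[OF z(1)] ED(1) \<pi> P' ED(3)[OF mu'(3)] mu'(1,2)] S(1) E'_eq])
  have "P 0 = \<pi>"
    using P'[OF S(2)] herm[OF S(2)] \<pi> ED(4)[OF z(2)]
    by (intro hermitian_projection_unique) (auto simp: hermitian_projection_onto_def)
  then show "E' 0 \<mu> = mat 1"
    using E'_eq[OF S(2)] ED(4)[OF mu'(3)] simple_factor_inverse(1)[OF hermitian_projection_idem[OF \<pi>] mu'(1,2)]
    by simp
  fix u assume u: "u \<in> S"
  have c: "cnj \<mu> \<noteq> z" "cnj \<mu> \<noteq> cnj z" using mu' by auto
  have "E' u (cnj \<mu>) = simple_factor z \<pi> (cnj \<mu>) ** E u (cnj \<mu>) ** simple_factor (cnj z) (P u) (cnj \<mu>)"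
    using E'[OF u] matrix_inv_simple_factor[OF herm[OF u] c] by simp
  then have adjE': "adj (E' u (cnj \<mu>)) = simple_factor z (P u) \<mu> ** adj (E u (cnj \<mu>)) ** simple_factor (cnj z) \<pi> \<mu>"
    by (simp add: adj_mult adj_simple_factor[OF \<pi>] adj_simple_factor[OF herm[OF u]] matrix_mul_assoc)
  have "E' u \<mu> ** adj (E' u (cnj \<mu>)) = simple_factor z \<pi> \<mu> ** (E u \<mu> **
     ((simple_factor (cnj z) (P u) \<mu> ** simple_factor z (P u) \<mu>) ** adj (E u (cnj \<mu>)))) ** simple_factor (cnj z) \<pi> \<mu>"
    unfolding E'_eq[OF u] adjE' by (simp add: matrix_mul_assoc)
  also have "\<dots> = mat 1"
    using simple_factor_inverse[OF hermitian_projection_idem[OF \<pi>] mu'(1,2)]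
      simple_factor_inverse[OF hermitian_projection_idem[OF herm[OF u]] mu'(1,2)] ED(5)[OF mu'(3) u]
    by simp
  finally show "E' u \<mu> ** adj (E' u (cnj \<mu>)) = mat 1" .
qed

lemma hermitian_frame_imp_real_unitary_frame:
  assumes "open S" "connected S" "0 \<in> S" "hermitian_frame S b \<Lambda> E"
    "\<And>\<mu>. complex_of_real \<mu> \<in> \<Lambda>" "\<And>u. u \<in> S \<Longrightarrow> conj_mat (E u 0) = E u 0"
  shows "real_unitary_frame S b E"
proof
  note ED = hermitian_frameD[OF assms(4)]
  show "open S" "connected S" "0 \<in> S" "smooth_on S b" by (fact assms ED)+
  show "solves_frame_on S b \<mu> (\<lambda>u. E u \<mu>)" for \<mu> :: real by (rule ED(3)[OF assms(5)])
  show "E 0 (complex_of_real \<mu>) = mat 1" for \<mu> by (rule ED(4)[OF assms(5)])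
  fix u assume u: "u \<in> S"
  show "adj (b u) = b u" by (rule ED(1)[OF u])
  show "conj_mat (E u 0) = E u 0" by (rule assms(6)[OF u])
  show "E u (complex_of_real \<mu>) ** adj (E u \<mu>) = mat 1" for \<mu>
    using ED(5)[OF assms(5) u, of \<mu>] by simp
qed


section \<open>Reality of products of two simple factors\<close>

lemma image_of_conj:
  fixes A :: "complex^'n^'n"
  shows "image_of (conj_mat A) = (\<lambda>x. \<chi> i. cnj (x $ i)) ` image_of A"
proof -
  have "conj_mat A *v (\<chi> i. cnj (x $ i)) = (\<chi> i. cnj ((A *v x) $ i))" for x
    by (simp add: vec_eq_iff matrix_vector_mult_def)
  note c = this
  have "range (\<lambda>x::complex^'n. \<chi> i. cnj (x $ i)) = UNIV"
    by (rule surjI[of _ "\<lambda>x. \<chi> i. cnj (x $ i)"]) simp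
  then have "image_of (conj_mat A) = (*v) (conj_mat A) ` range (\<lambda>x. \<chi> i. cnj (x $ i))"
    by (simp add: image_of_def)
  then show ?thesis by (simp add: image_image c image_of_def)
qed

lemma hermitian_projection_onto_conj:
  assumes "hermitian_projection_onto P ((*v) A ` image_of \<pi>)"
  shows "hermitian_projection_onto (conj_mat P) ((*v) (conj_mat A) ` image_of (conj_mat \<pi>))"
proof -
  have "image_of (conj_mat P) = image_of (conj_mat (A ** \<pi>))"
    using assms by (simp only: image_of_conj hermitian_projection_onto_def image_of_mult)
  then show ?thesis
    using assms hermitian_projection_conj[of P]
    by (simp add: hermitian_projection_onto_def image_of_mult conj_mult)
qed

lemma transpose_add: "transpose (A + B) = transpose A + transpose (B :: complex^'n^'n)"
  and transpose_diff: "transpose (A - B) = transpose A - transpose B"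
  and transpose_cscale: "transpose (a *\<^sub>m A) = a *\<^sub>m transpose A"
  and transpose_eq_conj_adj: "transpose A = conj_mat (adj A)"
  by (simp_all add: vec_eq_iff transpose_def)

lemma transpose_hermitian_projection: "hermitian_projection P \<Longrightarrow> transpose P = conj_mat P"
  by (simp add: transpose_eq_conj_adj hermitian_projection_adj)

lemma simple_factor_eq_one_plus:
  assumes "\<mu> \<noteq> z"
  shows "simple_factor z P \<mu> = mat 1 + ((z - cnj z) / (\<mu> - z)) *\<^sub>m (mat 1 - P)"
proof -
  have "(\<mu> - cnj z) / (\<mu> - z) = 1 + (z - cnj z) / (\<mu> - z)"
    using assms by (simp add: field_simps)
  then show ?thesis by (simp add: simple_factor_eq cscale_add_left)
qed

text \<open>The product has simple poles at \<open>z\<close> and \<open>- cnj z\<close> and tends to \<open>1\<close> at infinity; \<open>A\<close> and \<open>C\<close> are its residues.\<close>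

lemma two_factor_partial_fractions:
  fixes \<pi> \<rho> :: "complex^'n^'n"
  assumes k: "k = z - cnj z" and m: "m = k / (z + cnj z)" and z: "z + cnj z \<noteq> 0"
    and A: "A = k *\<^sub>m (mat 1 + m *\<^sub>m (mat 1 - \<rho>)) ** (mat 1 - \<pi>)"
    and C: "C = k *\<^sub>m (mat 1 - \<rho>) ** (mat 1 - m *\<^sub>m (mat 1 - \<pi>))"
    and mu: "\<mu> \<noteq> z" "\<mu> \<noteq> - cnj z"
  shows "simple_factor (- cnj z) \<rho> \<mu> ** simple_factor z \<pi> \<mu>
    = mat 1 + (1 / (\<mu> - z)) *\<^sub>m A + (1 / (\<mu> + cnj z)) *\<^sub>m C"
proof -
  define p where "p = mat 1 - \<pi>"
  define q where "q = mat 1 - \<rho>"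
  define x where "x = 1 / (\<mu> - z)"
  define y where "y = 1 / (\<mu> + cnj z)"
  have nz: "\<mu> - z \<noteq> 0" "\<mu> + cnj z \<noteq> 0" using mu by (auto simp: add_eq_0_iff)
  have xy: "k * k * (x * y) = k * m * x - k * m * y"
    using z nz unfolding m x_def y_def by (simp add: divide_simps) (simp add: algebra_simps)
  have s1: "simple_factor z \<pi> \<mu> = mat 1 + (k * x) *\<^sub>m p"
    using simple_factor_eq_one_plus[OF mu(1)] by (simp add: k p_def x_def)
  have s2: "simple_factor (- cnj z) \<rho> \<mu> = mat 1 + (k * y) *\<^sub>m q"
    using simple_factor_eq_one_plus[OF mu(2)] by (simp add: k q_def y_def)
  have "simple_factor (- cnj z) \<rho> \<mu> ** simple_factor z \<pi> \<mu>
     = mat 1 + (k * x) *\<^sub>m p + (k * y) *\<^sub>m q + (k * k * (x * y)) *\<^sub>m (q ** p)"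
    unfolding s1 s2 by (simp add: matrix_expand ac_simps)
  also have "\<dots> = mat 1 + x *\<^sub>m (k *\<^sub>m (mat 1 + m *\<^sub>m q) ** p) + y *\<^sub>m (k *\<^sub>m q ** (mat 1 - m *\<^sub>m p))"
    unfolding xy by (simp add: matrix_expand cscale_diff_left ac_simps)
  finally show ?thesis unfolding A C p_def q_def x_def y_def .
qed

text \<open>Let \<open>G(\<mu>)\<close> be the product of the two factors.  The rational function \<open>G(\<mu>) G(- \<mu>)\<^sup>T\<close> tends to \<open>1\<close> at
  infinity, and the position of the image of \<open>\<rho>\<close> implies that it has no poles, so it is
  constant.  Its value at zero shows that \<open>G(0)\<close> is complex orthogonal.  It is unitary as well,
  hence real.  The vanishing residues are used below in the form of two quadratic relations between \<open>A\<close>,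
  \<open>C\<close> and their transposes, from which the value at zero is computed directly.\<close>

lemma two_factor_real_at_0:
  fixes \<pi> \<rho> :: "complex^'n^'n"
  assumes z: "Re z \<noteq> 0" "Im z \<noteq> 0" and \<pi>: "hermitian_projection \<pi>"
    and \<rho>: "hermitian_projection_onto \<rho> ((*v) (simple_factor z \<pi> (- cnj z)) ` image_of (conj_mat \<pi>))"
  defines "G \<equiv> simple_factor (- cnj z) \<rho> 0 ** simple_factor z \<pi> 0"
  shows "conj_mat G = G"
proof -
  define k where "k = z - cnj z"
  define m where "m = k / (z + cnj z)"
  define A where "A = k *\<^sub>m (mat 1 + m *\<^sub>m (mat 1 - \<rho>)) ** (mat 1 - \<pi>)"
  define C where "C = k *\<^sub>m (mat 1 - \<rho>) ** (mat 1 - m *\<^sub>m (mat 1 - \<pi>))"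
  define g where "g = simple_factor z \<pi> (- cnj z)"
  define g' where "g' = simple_factor (cnj z) \<pi> (- cnj z)"
  have zs: "z + cnj z \<noteq> 0" "z \<noteq> 0" "cnj z \<noteq> 0" "k \<noteq> 0" "- cnj z \<noteq> z" "- cnj z \<noteq> cnj z"
    "- z \<noteq> z" "- z \<noteq> - cnj z" "cnj z \<noteq> z" "cnj z \<noteq> - cnj z"
    using z by (auto simp: complex_eq_iff k_def)
  have \<rho>h: "hermitian_projection \<rho>" using \<rho> by (simp add: hermitian_projection_onto_def)
  have gg': "g' ** g = mat 1"
    unfolding g_def g'_def using zs by (intro simple_factor_inverse hermitian_projection_idem[OF \<pi>]) auto
  note absorb = hermitian_projection_onto_absorb[OF \<rho>[folded g_def] gg'
      hermitian_projection_idem[OF hermitian_projection_conj[OF \<pi>]]]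
  have pf: "simple_factor (- cnj z) \<rho> \<mu> ** simple_factor z \<pi> \<mu>
    = mat 1 + (1 / (\<mu> - z)) *\<^sub>m A + (1 / (\<mu> + cnj z)) *\<^sub>m C" if "\<mu> \<noteq> z" "\<mu> \<noteq> - cnj z" for \<mu>
    by (rule two_factor_partial_fractions[OF k_def m_def zs(1) A_def C_def that])
  have g_eq: "g = mat 1 - m *\<^sub>m (mat 1 - \<pi>)"
  proof -
    have "(z - cnj z) / (- cnj z - z) = - m"
    proof -
      have d: "- cnj z - z = - (z + cnj z)" by simp
      show ?thesis unfolding d m_def k_def by (rule divide_minus_right)
    qed
    then show ?thesis unfolding g_def using simple_factor_eq_one_plus[OF zs(5), of \<pi>] by (simp add: cscale_minus_left)
  qed
  have g'_eq: "g' = mat 1 + (k / (2 * cnj z)) *\<^sub>m (mat 1 - \<pi>)"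
  proof -
    have "(cnj z - z) / (- cnj z - cnj z) = k / (2 * cnj z)"
      using zs(3) by (simp add: k_def divide_simps)
    then show ?thesis unfolding g'_def using simple_factor_eq_one_plus[OF zs(6), of \<pi>] by simp
  qed
  \<comment> \<open>There is no pole at \<open>- cnj z\<close>: the residue \<open>C\<close> of \<open>G\<close> kills the image of the conjugate of \<open>\<pi>\<close>, which
    contains the image of \<open>G(cnj z)\<^sup>T\<close>.\<close>
  have "C ** conj_mat \<pi> = 0"
    using absorb(3) unfolding C_def g_eq[symmetric] by (simp add: matrix_expand)
  moreover have "simple_factor z \<pi> (cnj z) = \<pi>" by (simp add: simple_factor_eq)
  ultimately have "C ** transpose (simple_factor (- cnj z) \<rho> (cnj z) ** simple_factor z \<pi> (cnj z)) = 0"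
    by (simp add: matrix_transpose_mul transpose_hermitian_projection[OF \<pi>] matrix_mul_assoc matrix_zero_left)
  then have r2: "C ** transpose (mat 1 - (1 / k) *\<^sub>m A + (1 / (2 * cnj z)) *\<^sub>m C) = 0"
  proof -
    have "cnj z - z = - k" by (simp add: k_def)
    then have "1 / (cnj z - z) = - (1 / k)" by simp
    with \<open>C ** transpose (simple_factor _ _ _ ** _) = 0\<close> show ?thesis
      unfolding pf[OF zs(9,10)] mult_2[symmetric] by (simp add: cscale_minus_left)
  qed
  \<comment> \<open>There is no pole at \<open>z\<close>: the residue \<open>A\<close> kills the image of \<open>\<pi>\<close>, which contains the image of
    \<open>G(- z)\<^sup>T\<close>.  The two other poles are those of the transposed product.\<close>
  have "conj_mat \<pi> ** (g' ** \<rho>) = g' ** \<rho>"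
  proof -
    have "g' ** \<rho> = g' ** ((g ** conj_mat \<pi> ** g') ** \<rho>)" by (simp only: absorb(2))
    also have "\<dots> = (g' ** g) ** conj_mat \<pi> ** g' ** \<rho>" by (simp add: matrix_mul_assoc)
    also have "\<dots> = conj_mat \<pi> ** (g' ** \<rho>)" by (simp add: gg' matrix_mul_assoc)
    finally show ?thesis ..
  qed
  from arg_cong[OF this, of conj_mat] have p0: "(mat 1 - \<pi>) ** (conj_mat g' ** conj_mat \<rho>) = 0"
    by (simp add: conj_mult matrix_diff_rdistrib)
  have "simple_factor (- cnj z) \<rho> (- z) = \<rho>" by (simp add: simple_factor_eq)
  moreover have "transpose (simple_factor z \<pi> (- z)) = conj_mat g'"
  proof -
    have "(z - cnj z) / (- z - z) = cnj (k / (2 * cnj z))"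
      using zs(2) by (simp add: k_def divide_simps)
    then show ?thesis
      using simple_factor_eq_one_plus[OF zs(7), of \<pi>]
      by (simp add: g'_eq transpose_add transpose_cscale transpose_diff transpose_hermitian_projection[OF \<pi>]
          conj_add conj_cscale conj_diff)
  qed
  ultimately have "A ** transpose (simple_factor (- cnj z) \<rho> (- z) ** simple_factor z \<pi> (- z)) = 0"
    using p0 by (simp add: A_def matrix_transpose_mul transpose_hermitian_projection[OF \<rho>h]
        matrix_mul_assoc[symmetric] cscale_mult_left matrix_zero_right)
  then have r1: "A ** transpose (mat 1 - (1 / (2 * z)) *\<^sub>m A - (1 / k) *\<^sub>m C) = 0"
  proof -
    have "1 / (- z - z) = - (1 / (2 * z))" by (simp add: divide_simps)
    moreover have "- z + cnj z = - k" by (simp add: k_def)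
    then have "1 / (- z + cnj z) = - (1 / k)" by (simp del: add_uminus_conv_diff uminus_add_conv_diff)
    ultimately show ?thesis
      using \<open>A ** transpose (simple_factor _ _ _ ** _) = 0\<close>
      unfolding pf[OF zs(7,8)] by (simp add: cscale_minus_left)
  qed
  \<comment> \<open>So \<open>G(0)\<close> is complex orthogonal.  Being unitary as well, it is real.\<close>
  define At where "At = transpose A"
  define Ct where "Ct = transpose C"
  have A_eq: "A = (1 / (2 * z)) *\<^sub>m (A ** At) + (1 / k) *\<^sub>m (A ** Ct)"
    using r1 by (simp add: At_def Ct_def transpose_add transpose_diff transpose_cscale matrix_expand algebra_simps)
  have C_eq: "C = (1 / k) *\<^sub>m (C ** At) - (1 / (2 * cnj z)) *\<^sub>m (C ** Ct)"
    using r2 by (simp add: At_def Ct_def transpose_add transpose_diff transpose_cscale matrix_expand algebra_simps add_eq_0_iff)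
  have At_eq: "At = (1 / (2 * z)) *\<^sub>m (A ** At) + (1 / k) *\<^sub>m (C ** At)"
    using arg_cong[OF A_eq, of transpose] by (simp add: At_def Ct_def transpose_add transpose_cscale matrix_transpose_mul)
  have Ct_eq: "Ct = (1 / k) *\<^sub>m (A ** Ct) - (1 / (2 * cnj z)) *\<^sub>m (C ** Ct)"
    using arg_cong[OF C_eq, of transpose] by (simp add: At_def Ct_def transpose_diff transpose_cscale matrix_transpose_mul)
  have G_eq: "G = mat 1 - (1 / z) *\<^sub>m A + (1 / cnj z) *\<^sub>m C"
    using pf[of 0] zs by (simp add: G_def cscale_minus_left)
  have "G ** transpose G = mat 1 - (1 / z) *\<^sub>m (A + At) + (1 / cnj z) *\<^sub>m (C + Ct)
     + (1 / (z * z)) *\<^sub>m (A ** At) + (1 / (cnj z * cnj z)) *\<^sub>m (C ** Ct)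
     - (1 / (z * cnj z)) *\<^sub>m (A ** Ct) - (1 / (z * cnj z)) *\<^sub>m (C ** At)"
    unfolding G_eq by (simp add: transpose_add transpose_diff transpose_cscale matrix_expand
        At_def[symmetric] Ct_def[symmetric] algebra_simps)
  also have "A + At = (1 / z) *\<^sub>m (A ** At) + (1 / k) *\<^sub>m (A ** Ct + C ** At)"
  proof -
    have "A + At = (1 / (2 * z) + 1 / (2 * z)) *\<^sub>m (A ** At) + (1 / k) *\<^sub>m (A ** Ct + C ** At)"
      by (rule trans[OF arg_cong2[where f = "(+)", OF A_eq At_eq]])
        (simp only: cscale_add_left cscale_add_right ac_simps)
    then show ?thesis by simp
  qed
  also have "C + Ct = (1 / k) *\<^sub>m (A ** Ct + C ** At) - (1 / cnj z) *\<^sub>m (C ** Ct)"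
  proof -
    have "C + Ct = (1 / k) *\<^sub>m (A ** Ct + C ** At) - (1 / (2 * cnj z) + 1 / (2 * cnj z)) *\<^sub>m (C ** Ct)"
      by (rule trans[OF arg_cong2[where f = "(+)", OF C_eq Ct_eq]])
        (simp only: cscale_add_left cscale_add_right algebra_simps)
    then show ?thesis by simp
  qed
  also have "mat 1 - (1 / z) *\<^sub>m ((1 / z) *\<^sub>m (A ** At) + (1 / k) *\<^sub>m (A ** Ct + C ** At))
     + (1 / cnj z) *\<^sub>m ((1 / k) *\<^sub>m (A ** Ct + C ** At) - (1 / cnj z) *\<^sub>m (C ** Ct))
     + (1 / (z * z)) *\<^sub>m (A ** At) + (1 / (cnj z * cnj z)) *\<^sub>m (C ** Ct)
     - (1 / (z * cnj z)) *\<^sub>m (A ** Ct) - (1 / (z * cnj z)) *\<^sub>m (C ** At)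
     = mat 1 + (1 / (cnj z * k) - 1 / (z * k) - 1 / (z * cnj z)) *\<^sub>m (A ** Ct + C ** At)"
    by (simp add: cscale_add_left cscale_add_right cscale_diff_right cscale_diff_left cscale_cscale algebra_simps)
  also have "1 / (cnj z * k) - 1 / (z * k) - 1 / (z * cnj z) = 0"
    using zs(2,3,4) by (simp add: divide_simps) (simp add: k_def algebra_simps)
  finally have orth: "G ** transpose G = mat 1" by simp
  have "G ** adj G = mat 1"
  proof -
    have "G ** adj G = simple_factor (- cnj z) \<rho> 0 ** (simple_factor z \<pi> 0 ** simple_factor (cnj z) \<pi> 0)
        ** simple_factor (cnj (- cnj z)) \<rho> 0"
      by (simp add: G_def adj_mult adj_simple_factor[OF \<pi>] adj_simple_factor[OF \<rho>h] matrix_mul_assoc)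
    then show ?thesis
      using simple_factor_inverse(1)[OF hermitian_projection_idem[OF \<pi>], of 0 z]
        simple_factor_inverse(1)[OF hermitian_projection_idem[OF \<rho>h], of 0 "- cnj z"] zs by simp
  qed
  with orth have "transpose G = adj G"
    by (metis matrix_left_right_inverse matrix_mul_assoc matrix_mul_lid matrix_mul_rid)
  then have "conj_mat (adj G) = adj G" by (simp add: transpose_eq_conj_adj)
  then show ?thesis by (metis adj_adj conj_adj)
qed


section \<open>The seed frame\<close>

text \<open>The potential \<open>\<phi>\<close> has \<open>\<partial>\<^sub>i \<phi> = h\<^sub>i\<^sup>2\<close>, and equality of its mixed derivatives is
  \<open>2 h\<^sub>i h\<^sub>j \<beta>\<^sub>i\<^sub>j = 2 h\<^sub>i h\<^sub>j \<beta>\<^sub>j\<^sub>i\<close>.\<close>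

lemma rotation_coeffs_symmetric:
  fixes h :: "real^'n \<Rightarrow> real^'n"
  assumes S: "open S" and h: "flat_egoroff_metric_on S h" and u: "u \<in> S"
  shows "rotation_coeffs h u $ i $ j = rotation_coeffs h u $ j $ i"
proof (cases "i = j")
  case False
  obtain \<phi> :: "real^'n \<Rightarrow> real" where \<phi>: "\<And>u. u \<in> S \<Longrightarrow> \<phi> differentiable (at u)"
      "\<And>u i. u \<in> S \<Longrightarrow> partial i \<phi> u = (h u $ i)\<^sup>2"
    using h unfolding flat_egoroff_metric_on_def by blast
  have hi: "smooth_on S (\<lambda>u. h u $ i)" and nz: "h u $ i \<noteq> 0" for i
    using h u smooth_on_vec_iff[OF S] unfolding flat_egoroff_metric_on_def by blast+
  have hd: "(\<lambda>u. h u $ i) differentiable (at u)" for i by (rule smooth_on_differentiable[OF hi u])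
  have sq: "(h u $ i)\<^sup>2 = h u $ i * h u $ i" for u i by (simp add: power2_eq_square)
  have "Ck_on (Suc 0) S (partial i \<phi>)" for i
  proof (rule Ck_on_cong[OF S])
    show "(h u $ i)\<^sup>2 = partial i \<phi> u" if "u \<in> S" for u using \<phi>(2)[OF that] by simp
    show "Ck_on (Suc 0) S (\<lambda>u. (h u $ i)\<^sup>2)"
      using smooth_on_bilinear[OF bounded_bilinear_mult S hi hi] unfolding sq smooth_on_def by blast
  qed
  then have "Ck_on 2 S \<phi>" using \<phi>(1) by (simp add: numeral_2_eq_2)
  from partial_commute[OF S u this, of i j]
  have "partial i (\<lambda>v. (h v $ j)\<^sup>2) u = partial j (\<lambda>v. (h v $ i)\<^sup>2) u"
    by (simp only: partial_cong[OF S u \<phi>(2)])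
  then have "2 * h u $ j * partial i (\<lambda>v. h v $ j) u = 2 * h u $ i * partial j (\<lambda>v. h v $ i) u"
    unfolding sq partial_mult[OF hd hd] by simp
  with False nz[of i] nz[of j] show ?thesis
    by (simp add: rotation_coeffs_def field_simps)
qed simp

lemma smooth_rotation_coeffs:
  assumes S: "open S" and h: "flat_egoroff_metric_on S h"
  shows "smooth_on S (rotation_coeffs h)"
proof -
  have hi: "smooth_on S (\<lambda>u. h u $ i)" and nz: "\<And>u. u \<in> S \<Longrightarrow> h u $ i \<noteq> 0" for i
    using h smooth_on_vec_iff[OF S] unfolding flat_egoroff_metric_on_def by blast+
  have "smooth_on S (\<lambda>u. if i = j then 0 else partial j (\<lambda>v. h v $ i) u / h u $ j)" for i j
    by (cases "i = j") (auto intro!: smooth_on_const smooth_on_divide[OF S nz] smooth_on_partial hi)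
  then show ?thesis by (simp add: smooth_on_vec_iff[OF S] rotation_coeffs_def)
qed

text \<open>Real symmetric \<open>\<beta>\<close> is Hermitian and equals its conjugate, so the conjugate of the frame at \<open>\<mu>\<close>
  solves the equation at \<open>- cnj \<mu>\<close>, and solutions are unique.\<close>

lemma frame_hermitian:
  assumes S: "open S" "connected S" "0 \<in> S" and h: "flat_egoroff_metric_on S h"
    and E: "is_frame S (rotation_coeffs h) E"
  shows "hermitian_frame S (\<lambda>u. map_matrix complex_of_real (rotation_coeffs h u)) UNIV E"
    and "\<And>u \<mu>. u \<in> S \<Longrightarrow> conj_mat (E u \<mu>) = E u (- cnj \<mu>)"
proof -
  let ?b = "\<lambda>u. map_matrix complex_of_real (rotation_coeffs h u)"
  have solves: "solves_frame_on S ?b \<mu> (\<lambda>u. E u \<mu>)" and E0: "E 0 \<mu> = mat 1" for \<mu>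
    using E frame_equation_imp_solves unfolding is_frame_def by blast+
  have b: "adj (?b u) = ?b u" if "u \<in> S" for u
    using rotation_coeffs_symmetric[OF S(1) h that] by (simp add: vec_eq_iff)
  have "smooth_on S (\<lambda>u. complex_of_real (rotation_coeffs h u $ i $ j))" for i j
    using smooth_rotation_coeffs[OF S(1) h]
    by (intro smooth_on_bounded_linear[OF bounded_linear_of_real S(1)]) (simp add: smooth_on_vec_iff[OF S(1)])
  then have "smooth_on S ?b" by (simp add: smooth_on_vec_iff[OF S(1)])
  moreover have "E u \<mu> ** adj (E u (cnj \<mu>)) = mat 1" if "u \<in> S" for u \<mu>
    using frame_mult_adj_constant[OF S solves solves b that, of \<mu>] E0 by simp
  ultimately show "hermitian_frame S ?b UNIV E"
    using solves E0 b by (simp add: hermitian_frame_def)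
  fix u \<mu> assume u: "u \<in> S"
  have "solves_frame_on S ?b (- cnj \<mu>) (\<lambda>u. conj_mat (E u \<mu>))"
    unfolding solves_frame_on_def
  proof
    fix x assume x: "x \<in> S"
    have "conj_mat (?b x) = ?b x" by (simp add: vec_eq_iff)
    then show "((\<lambda>u. conj_mat (E u \<mu>)) has_derivative (\<lambda>v. conj_mat (E x \<mu>) ** conn_form (?b x) (- cnj \<mu>) v)) (at x)"
      using has_derivative_conj[OF solves_frame_onD[OF solves x, of \<mu>]] by (simp add: conj_mult conj_conn_form)
  qed
  from frame_unique[OF S this solves solves b u] show "conj_mat (E u \<mu>) = E u (- cnj \<mu>)"
    using E0 by simp
qed

section \<open>New metrics and immersions by dressing\<close>

text \<open>An imaginary pole \<open>z\<close> is fixed by \<open>\<mu> \<mapsto> - cnj \<mu>\<close>.  So the frame is real at \<open>z\<close>, the image of \<open>P\<close>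
  is invariant under conjugation, and \<open>P\<close> and the simple factors at zero are real.\<close>

lemma real_unitary_frame_dressing_imaginary:
  assumes S: "open S" "connected S" "0 \<in> S" and E: "hermitian_frame S b UNIV E"
    and conjE: "\<And>u \<mu>. u \<in> S \<Longrightarrow> conj_mat (E u \<mu>) = E u (- cnj \<mu>)"
    and \<alpha>: "\<alpha> \<noteq> 0" and \<pi>: "hermitian_projection \<pi>" "conj_mat \<pi> = \<pi>"
    and P: "\<And>u. u \<in> S \<Longrightarrow> hermitian_projection_onto (P u)
      ((*v) (matrix_inv (E u (\<i> * complex_of_real \<alpha>))) ` image_of \<pi>)"
    and E': "\<And>u \<mu>. u \<in> S \<Longrightarrow> E' u \<mu> = simple_factor (\<i> * complex_of_real \<alpha>) \<pi> \<mu> ** E u \<mu>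
      ** matrix_inv (simple_factor (\<i> * complex_of_real \<alpha>) (P u) \<mu>)"
  shows "\<exists>b'. real_unitary_frame S b' E'"
proof -
  define z where "z = \<i> * complex_of_real \<alpha>"
  have z: "- cnj z = z" "0 \<noteq> z" "0 \<noteq> cnj z" using \<alpha> by (simp_all add: z_def)
  note dressed = hermitian_frame_dressing[OF S(1,3) E UNIV_I UNIV_I \<pi>(1) P E', folded z_def]
  have "real_unitary_frame S (\<lambda>u. b u + (\<i> * (z - cnj z)) *\<^sub>m P u) E'"
  proof (rule hermitian_frame_imp_real_unitary_frame[OF S dressed])
    show "complex_of_real \<mu> \<in> UNIV - {z, cnj z}" for \<mu>
      using \<alpha> by (auto simp: z_def complex_eq_iff)
    fix u assume u: "u \<in> S"
    note Pu = P[OF u, folded z_def]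
    have herm: "hermitian_projection (P u)"
      using Pu by (simp add: hermitian_projection_onto_def)
    have inv: "matrix_inv (E u z) = adj (E u (cnj z))" by (rule hermitian_frameD(6)[OF E UNIV_I u])
    have "conj_mat (E u (cnj z)) = E u (cnj z)" using conjE[OF u, of "cnj z"] arg_cong[OF z(1), of cnj] by simp
    then have "conj_mat (matrix_inv (E u z)) = matrix_inv (E u z)" by (simp add: inv conj_adj)
    then have "conj_mat (P u) = P u"
      using hermitian_projection_onto_conj[OF Pu] Pu
      by (intro hermitian_projection_unique) (auto simp: hermitian_projection_onto_def \<pi>(2))
    moreover have "conj_mat (E u 0) = E u 0" using conjE[OF u, of 0] by simp
    moreover have "- z = cnj z" using arg_cong[OF z(1), of uminus] by simp
    ultimately show "conj_mat (E' u 0) = E' u 0"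
      unfolding E'[OF u, folded z_def] matrix_inv_simple_factor[OF herm z(2,3)] conj_mult conj_simple_factor
      using z(1) \<pi>(2) by simp
  qed
  then show ?thesis by blast
qed

text \<open>At parameter zero the new frame is \<open>G E(u, 0) G'\<^sup>-\<^sup>1\<close>, where \<open>G\<close> and \<open>G'\<close> are the products of the two simple
  factors built from \<open>\<pi>\<close>, \<open>\<rho>\<close> and from \<open>P\<close>, \<open>Q\<close>.  Both products are real.\<close>

lemma real_unitary_frame_dressing_pair:
  assumes S: "open S" "connected S" "0 \<in> S" and E: "hermitian_frame S b UNIV E"
    and conjE: "\<And>u \<mu>. u \<in> S \<Longrightarrow> conj_mat (E u \<mu>) = E u (- cnj \<mu>)"
    and z: "Re z \<noteq> 0" "Im z \<noteq> 0" and \<pi>: "hermitian_projection \<pi>"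
    and \<rho>: "hermitian_projection_onto \<rho> ((*v) (simple_factor z \<pi> (- cnj z)) ` image_of (conj_mat \<pi>))"
    and P: "\<And>u. u \<in> S \<Longrightarrow> hermitian_projection_onto (P u) ((*v) (matrix_inv (E u z)) ` image_of \<pi>)"
    and E1: "\<And>u \<mu>. u \<in> S \<Longrightarrow> E1 u \<mu> = simple_factor z \<pi> \<mu> ** E u \<mu> ** matrix_inv (simple_factor z (P u) \<mu>)"
    and Q: "\<And>u. u \<in> S \<Longrightarrow> hermitian_projection_onto (Q u) ((*v) (matrix_inv (E1 u (- cnj z))) ` image_of \<rho>)"
    and E2: "\<And>u \<mu>. u \<in> S \<Longrightarrow> E2 u \<mu> = simple_factor (- cnj z) \<rho> \<mu> ** E1 u \<mu> ** matrix_inv (simple_factor (- cnj z) (Q u) \<mu>)"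
  shows "\<exists>b'. real_unitary_frame S b' E2"
proof -
  have zs: "0 \<noteq> z" "0 \<noteq> cnj z" "0 \<noteq> - cnj z" "0 \<noteq> cnj (- cnj z)"
    "- cnj z \<noteq> z" "- cnj z \<noteq> cnj z" "- z \<noteq> z" "- z \<noteq> cnj z"
    using z by (auto simp: complex_eq_iff)
  have \<rho>h: "hermitian_projection \<rho>" using \<rho> by (simp add: hermitian_projection_onto_def)
  note frame1 = hermitian_frame_dressing[OF S(1,3) E UNIV_I UNIV_I \<pi> P E1]
  have mem: "- cnj z \<in> UNIV - {z, cnj z}" "cnj (- cnj z) \<in> UNIV - {z, cnj z}" using zs by auto
  note frame2 = hermitian_frame_dressing[OF S(1,3) frame1 mem \<rho>h Q E2]
  show ?thesis
  proof (rule exI, rule hermitian_frame_imp_real_unitary_frame[OF S frame2])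
    show "complex_of_real \<mu> \<in> UNIV - {z, cnj z} - {- cnj z, cnj (- cnj z)}" for \<mu>
      using z by (auto simp: complex_eq_iff)
    fix u assume u: "u \<in> S"
    have Ph: "hermitian_projection (P u)" and Qh: "hermitian_projection (Q u)"
      using P[OF u] Q[OF u] by (simp_all add: hermitian_projection_onto_def)
    have invE: "matrix_inv (E u \<mu>) = adj (E u (cnj \<mu>))" for \<mu> by (rule hermitian_frameD(6)[OF E UNIV_I u])
    have E_inv: "E u \<mu> ** adj (E u (cnj \<mu>)) = mat 1" for \<mu> by (rule hermitian_frameD(5)[OF E UNIV_I u])
    define g where "g = simple_factor z \<pi> (- cnj z)"
    define gP where "gP = simple_factor z (P u) (- cnj z)"
    define K where "K = adj (E u (- z))"
    have K: "K = conj_mat (matrix_inv (E u z))"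
      using conjE[OF u, of "cnj z"] by (simp add: invE K_def conj_adj)
    \<comment> \<open>The pair \<open>P u\<close>, \<open>Q u\<close> is related in the same way as the pair \<open>\<pi>\<close>, \<open>\<rho>\<close>.\<close>
    have "matrix_inv (E1 u (- cnj z)) ** g = gP ** K"
    proof -
      have gP: "simple_factor (cnj z) (P u) (- cnj z) ** (gP ** X) = X" for X
        unfolding gP_def matrix_mul_assoc
        by (simp add: simple_factor_inverse(2)[OF hermitian_projection_idem[OF Ph] zs(5,6)])
      have g: "g ** simple_factor (cnj z) \<pi> (- cnj z) = mat 1" "simple_factor (cnj z) \<pi> (- cnj z) ** g = mat 1"
        unfolding g_def by (rule simple_factor_inverse[OF hermitian_projection_idem[OF \<pi>] zs(5,6)])+
      have "E1 u (- cnj z) = g ** E u (- cnj z) ** simple_factor (cnj z) (P u) (- cnj z)"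
        by (simp add: E1[OF u] matrix_inv_simple_factor[OF Ph zs(5,6)] g_def)
      moreover have EK: "E u (- cnj z) ** (K ** X) = X" for X
        using E_inv[of "- cnj z"] by (simp add: K_def matrix_mul_assoc)
      ultimately have "E1 u (- cnj z) ** (gP ** K ** simple_factor (cnj z) \<pi> (- cnj z)) = mat 1"
        by (simp add: matrix_mul_assoc[symmetric] gP EK g(1))
      from matrix_inv_eqI(1)[OF this] have "matrix_inv (E1 u (- cnj z)) = gP ** K ** simple_factor (cnj z) \<pi> (- cnj z)" .
      then show ?thesis by (simp add: matrix_mul_assoc[symmetric] g(2))
    qed
    moreover have "image_of (conj_mat (P u)) = (*v) K ` image_of (conj_mat \<pi>)"
      using hermitian_projection_onto_conj[OF P[OF u]] by (simp add: hermitian_projection_onto_def K)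
    moreover have "image_of (Q u) = (*v) (matrix_inv (E1 u (- cnj z))) ` (*v) g ` image_of (conj_mat \<pi>)"
      using Q[OF u] \<rho> by (simp add: hermitian_projection_onto_def g_def)
    ultimately have "image_of (Q u) = (*v) gP ` image_of (conj_mat (P u))"
      by (simp add: image_of_mult[symmetric] matrix_mul_assoc)
    then have Q': "hermitian_projection_onto (Q u) ((*v) (simple_factor z (P u) (- cnj z)) ` image_of (conj_mat (P u)))"
      using Qh by (simp add: hermitian_projection_onto_def gP_def)
    define G where "G = simple_factor (- cnj z) \<rho> 0 ** simple_factor z \<pi> 0"
    define G' where "G' = simple_factor (- cnj z) (Q u) 0 ** simple_factor z (P u) 0"
    have G: "conj_mat G = G" and G': "conj_mat G' = G'"
      unfolding G_def G'_def by (rule two_factor_real_at_0[OF z \<pi> \<rho>] two_factor_real_at_0[OF z Ph Q'])+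
    have "E2 u 0 = G ** E u 0 ** adj G'"
      unfolding E2[OF u] E1[OF u] matrix_inv_simple_factor[OF Ph zs(1,2)] matrix_inv_simple_factor[OF Qh zs(3,4)]
      by (simp add: G_def G'_def adj_mult adj_simple_factor[OF Ph] adj_simple_factor[OF Qh] matrix_mul_assoc)
    moreover have "conj_mat (E u 0) = E u 0" using conjE[OF u, of 0] by simp
    ultimately show "conj_mat (E2 u 0) = E2 u 0"
      by (simp add: conj_mult conj_adj G G')
  qed
qed

theorem theorem4p2:
  fixes \<Omega> :: "(real^'n) set"
    and h :: "real^'n \<Rightarrow> real^'n"
    and \<beta> :: "real^'n \<Rightarrow> real^'n^'n"
    and E :: "real^'n \<Rightarrow> complex \<Rightarrow> complex^'n^'n"
    and c :: "real^'n"
    and X :: "real^'n \<Rightarrow> complex \<Rightarrow> complex^'n"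
  assumes "open \<Omega>" and "connected \<Omega>" and "simply_connected \<Omega>" and "0 \<in> \<Omega>"
    and "flat_egoroff_metric_on \<Omega> h" and "d_invariant_on \<Omega> h"
    and "\<beta> = rotation_coeffs h"
    and "is_frame \<Omega> \<beta> E"
    and "c = h 0" and "X = associated_family E c"
  shows
    "(\<forall>(\<alpha>::real) (\<pi>::complex^'n^'n) (\<pi>t::real^'n \<Rightarrow> complex^'n^'n)
        (Et::real^'n \<Rightarrow> complex \<Rightarrow> complex^'n^'n) (ct::real^'n).
        \<alpha> \<noteq> 0 \<longrightarrow>
        hermitian_projection \<pi> \<longrightarrow>
        map_matrix cnj \<pi> = \<pi> \<longrightarrow>
        (\<forall>u\<in>\<Omega>. hermitian_projection_onto (\<pi>t u)
                 ((*v) (matrix_inv (E u (\<i> * complex_of_real \<alpha>))) ` image_of \<pi>)) \<longrightarrow>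
        (\<forall>u\<in>\<Omega>. \<forall>\<mu>. Et u \<mu> = simple_factor (\<i> * complex_of_real \<alpha>) \<pi> \<mu> ** E u \<mu>
                 ** matrix_inv (simple_factor (\<i> * complex_of_real \<alpha>) (\<pi>t u) \<mu>)) \<longrightarrow>
        (\<exists>ht::real^'n \<Rightarrow> real^'n.
          (\<forall>u\<in>\<Omega>. complex_vec (ht u) = matrix_inv (Et u 0) *v complex_vec ct) \<and>
          (\<forall>\<mu>::real. Et 0 (complex_of_real \<mu>) = mat 1) \<and>
          (\<forall>U. open U \<and> connected U \<and> U \<subseteq> \<Omega> \<and> (\<forall>u\<in>U. \<forall>i. ht u $ i \<noteq> 0) \<longrightarrow>
            flat_egoroff_metric_on U ht \<and> d_invariant_on U ht \<and>
            (\<forall>\<mu>::real. frame_equation_on U (rotation_coeffs ht) (complex_of_real \<mu>) Et) \<and>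
            (\<forall>\<mu>::real. \<mu> \<noteq> 0 \<longrightarrow>
              flat_lagrangian_immersion_on U (\<lambda>u. associated_family Et ct u (complex_of_real \<mu>)) \<and>
              (\<forall>u\<in>U. induced_metric (\<lambda>u. associated_family Et ct u (complex_of_real \<mu>)) u = diag_metric ht u) \<and>
              (\<exists>a r. r > 0 \<and> (\<lambda>u. associated_family Et ct u (complex_of_real \<mu>)) ` U \<subseteq> sphere a r)))))
   \<and>
     (\<forall>(z::complex) (\<pi>::complex^'n^'n) (\<rho>::complex^'n^'n) (f::complex \<Rightarrow> complex^'n^'n)
        (\<pi>h::real^'n \<Rightarrow> complex^'n^'n) (\<rho>h::real^'n \<Rightarrow> complex^'n^'n)
        (E1::real^'n \<Rightarrow> complex \<Rightarrow> complex^'n^'n)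
        (Eh::real^'n \<Rightarrow> complex \<Rightarrow> complex^'n^'n) (ch::real^'n).
        Re z \<noteq> 0 \<longrightarrow> Im z \<noteq> 0 \<longrightarrow>
        hermitian_projection \<pi> \<longrightarrow>
        hermitian_projection_onto \<rho>
          ((*v) (simple_factor z \<pi> (- cnj z)) ` image_of (map_matrix cnj \<pi>)) \<longrightarrow>
        (\<forall>\<mu>. f \<mu> = simple_factor (- cnj z) \<rho> \<mu> ** simple_factor z \<pi> \<mu>) \<longrightarrow>
        (\<forall>u\<in>\<Omega>. hermitian_projection_onto (\<pi>h u)
                 ((*v) (matrix_inv (E u z)) ` image_of \<pi>)) \<longrightarrow>
        (\<forall>u\<in>\<Omega>. \<forall>\<mu>. E1 u \<mu> = simple_factor z \<pi> \<mu> ** E u \<mu>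
                 ** matrix_inv (simple_factor z (\<pi>h u) \<mu>)) \<longrightarrow>
        (\<forall>u\<in>\<Omega>. hermitian_projection_onto (\<rho>h u)
                 ((*v) (matrix_inv (E1 u (- cnj z))) ` image_of \<rho>)) \<longrightarrow>
        (\<forall>u\<in>\<Omega>. \<forall>\<mu>. Eh u \<mu> = f \<mu> ** E u \<mu>
                 ** matrix_inv (simple_factor z (\<pi>h u) \<mu>)
                 ** matrix_inv (simple_factor (- cnj z) (\<rho>h u) \<mu>)) \<longrightarrow>
        (\<exists>hh::real^'n \<Rightarrow> real^'n.
          (\<forall>u\<in>\<Omega>. complex_vec (hh u) = matrix_inv (Eh u 0) *v complex_vec ch) \<and>
          (\<forall>\<mu>::real. Eh 0 (complex_of_real \<mu>) = mat 1) \<and>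
          (\<forall>U. open U \<and> connected U \<and> U \<subseteq> \<Omega> \<and> (\<forall>u\<in>U. \<forall>i. hh u $ i \<noteq> 0) \<longrightarrow>
            flat_egoroff_metric_on U hh \<and> d_invariant_on U hh \<and>
            (\<forall>\<mu>::real. frame_equation_on U (rotation_coeffs hh) (complex_of_real \<mu>) Eh) \<and>
            (\<forall>\<mu>::real. \<mu> \<noteq> 0 \<longrightarrow>
              flat_lagrangian_immersion_on U (\<lambda>u. associated_family Eh ch u (complex_of_real \<mu>)) \<and>
              (\<forall>u\<in>U. induced_metric (\<lambda>u. associated_family Eh ch u (complex_of_real \<mu>)) u = diag_metric hh u) \<and>
              (\<exists>a r. r > 0 \<and> (\<lambda>u. associated_family Eh ch u (complex_of_real \<mu>)) ` U \<subseteq> sphere a r)))))"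
proof -
  note S = assms(1,2,4)
  have frame: "is_frame \<Omega> (rotation_coeffs h) E" using assms(7,8) by simp
  note E = frame_hermitian(1)[OF S assms(5) frame] and conjE = frame_hermitian(2)[OF S assms(5) frame]
  show ?thesis
  proof (intro conjI allI impI, goal_cases)
    case (1 \<alpha> \<pi> \<pi>t Et ct)
    then have "\<exists>b'. real_unitary_frame \<Omega> b' Et"
      by (intro real_unitary_frame_dressing_imaginary[OF S E conjE, of \<alpha> \<pi> \<pi>t Et]) auto
    then obtain b' where "real_unitary_frame \<Omega> b' Et" ..
    then show ?case by (rule real_unitary_frame.new_metric_and_immersions)
  next
    case (2 z \<pi> \<rho> f \<pi>h \<rho>h E1 Eh ch)
    then have "\<exists>b'. real_unitary_frame \<Omega> b' Eh"
      by (intro real_unitary_frame_dressing_pair[OF S E conjE, of z \<pi> \<rho> \<pi>h E1 \<rho>h Eh])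
         (auto simp: matrix_mul_assoc)
    then obtain b' where "real_unitary_frame \<Omega> b' Eh" ..
    then show ?case by (rule real_unitary_frame.new_metric_and_immersions)
  qed
qed

end
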